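(* Let $n,p,q\ge 1$ be integers, $N=p+q$, and $\mu\in\mathbb{C}$. For every $\mathfrak{gl}_N(\mathbb{C})$-module $M$, let $W=S_n\ltimes(\mathbb{Z}/2\mathbb{Z})^n$ act on $F_{n,p,\mu}(M)=(M\otimes V^{\otimes n})^{\mathfrak{k}_0,\mu}$ by letting $S_{ij}$ permute the $i$-th and $j$-th tensor factors $V$ and letting $\gamma_i$ act by $J$ on the $i$-th factor $V$, and for $k=1,\dots,n$ let $$\tilde y_k=-\sum_{(i,j)}E_{ij}\otimes (E_{ji})_k ,$$ where the sum is over all pairs $(i,j)\in\{1,\dots,N\}^2$ such that exactly one of $i,j$ is $\le p$, $E_{ij}$ acts on $M$, and $(E_{ji})_k$ acts on the $k$-th factor $V$. Then these operators combine into a representation of the degenerate affine Hecke algebra $\mathcal{H}(\kappa_1,\kappa_2)$ of type $BC_n$ (in the presentation by $W$ and $\tilde y_1,\dots,\tilde y_n$ given in the context) on $F_{n,p,\mu}(M)$, with $$\kappa_1=1,\qquad \kappa_2=p-q-\mu N .$$ Consequently $F_{n,p,\mu}$ is a functor from the category of $\mathfrak{gl}_N(\mathbb{C})$-modules to the category of representations of $\mathcal{H}(1,p-q-\mu N)$, and its restriction to the category of Harish-Chandra modules for the pair $(\mathfrak{gl}_N,\mathfrak{gl}_p\oplus\mathfrak{gl}_q)$ is exact.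
   Context: Notation. $V=\mathbb{C}^N$ is the vector representation of $\mathfrak{g}=\mathfrak{gl}_N(\mathbb{C})$; $E_{ij}$ are the matrix units; $J=\mathrm{diag}(I_p,-I_q)$; $\mathfrak{k}=\mathfrak{gl}_p(\mathbb{C})\times\mathfrak{gl}_q(\mathbb{C})\subset\mathfrak{g}$ (block diagonal matrices); $\mathfrak{k}_0\subset\mathfrak{k}$ is the subalgebra of trace zero matrices. The character $\chi$ of $\mathfrak{k}$ is $\chi(\mathrm{diag}(X_1,X_2))=q\,\mathrm{tr}X_1-p\,\mathrm{tr}X_2$. For a $\mathfrak{k}_0$-module $Y$, $Y^{\mathfrak{k}_0,\mu}=\{v\in Y: xv=\mu\chi(x)v \text{ for all } x\in\mathfrak{k}_0\}$. In $M\otimes V^{\otimes n}$ the factor $M$ is regarded as the $0$-th factor, and $\mathfrak{k}_0$ acts on $M\otimes V^{\otimes n}$ by the tensor product action. Weyl group. $W=S_n\ltimes(\mathbb{Z}/2\mathbb{Z})^n$ is the Weyl group of type $BC_n$ acting on $\mathbb{R}^n$ with orthonormal basis $\epsilon_1,\dots,\epsilon_n$; $S_{ij}$ is the reflection in $\epsilon_i-\epsilon_j$ and $\gamma_i$ the reflection in $\epsilon_i$; $S_i=S_{i,i+1}$. Presentation of $\mathcal{H}(\kappa_1,\kappa_2)$. It is the $\mathbb{C}$-algebra generated by $\mathbb{C}W$ and $\tilde y_1,\dots,\tilde y_n$ with relations: $S_i\tilde y_i=\tilde y_{i+1}S_i$; $S_j\tilde y_i=\tilde y_iS_j$ for $i\ne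 j,j+1$; $\tilde y_n\gamma_n+\gamma_n\tilde y_n=0$; $\tilde y_i\gamma_n=\gamma_n\tilde y_i$ for $i\neq n$; and for $i\ne j$ $$[\tilde y_i,\tilde y_j]=\tfrac{\kappa_1\kappa_2}{2}S_{ij}(\gamma_j-\gamma_i)+\tfrac{\kappa_1^2}{4}\sum_{k\ne i,j}S_{jk}S_{ik}-\tfrac{\kappa_1^2}{4}\sum_{k\ne i,j}S_{ik}S_{jk}$$ $$+\tfrac{\kappa_1^2}{4}\sum_{k\ne i,j}S_{ik}S_{jk}(-\gamma_i\gamma_k+\gamma_i\gamma_j+\gamma_j\gamma_k)-\tfrac{\kappa_1^2}{4}\sum_{k\ne i,j}S_{jk}S_{ik}(\gamma_i\gamma_j-\gamma_j\gamma_k+\gamma_i\gamma_k).$$ Harish-Chandra modules for $(\mathfrak{gl}_N,\mathfrak{gl}_p\oplus\mathfrak{gl}_q)$ are $\mathfrak{g}$-modules which, as $\mathfrak{k}$-modules, are direct sums of finite dimensional simple $\mathfrak{k}$-modules. *)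

theory Defs
  imports
    Complex_Main
    "HOL-Library.Function_Algebras"
    "HOL-Library.Poly_Mapping"
    "HOL-Library.FuncSet"
    "HOL-Combinatorics.Permutations"
    "HOL-Algebra.QuotRing"
    "Jordan_Normal_Form.Matrix"
begin

section \<open>Categories and functors\<close>

record ('o, 'f) cat =
  Ob :: "'o set"
  Hom :: "'o \<Rightarrow> 'o \<Rightarrow> 'f set"
  Idn :: "'o \<Rightarrow> 'f"
  Cmp :: "'o \<Rightarrow> 'o \<Rightarrow> 'o \<Rightarrow> 'f \<Rightarrow> 'f \<Rightarrow> 'f"  (* Cmp A B C g f is g after f, for f : A -> B, g : B -> C *)

definition is_category :: "('o, 'f) cat \<Rightarrow> bool" where
  "is_category C \<longleftrightarrow>
     (\<forall>A\<in>Ob C. Idn C A \<in> Hom C A A) \<and>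
     (\<forall>A\<in>Ob C. \<forall>B\<in>Ob C. \<forall>D\<in>Ob C. \<forall>f\<in>Hom C A B. \<forall>g\<in>Hom C B D. Cmp C A B D g f \<in> Hom C A D) \<and>
     (\<forall>A\<in>Ob C. \<forall>B\<in>Ob C. \<forall>f\<in>Hom C A B.
        Cmp C A A B f (Idn C A) = f \<and> Cmp C A B B (Idn C B) f = f) \<and>
     (\<forall>A\<in>Ob C. \<forall>B\<in>Ob C. \<forall>D\<in>Ob C. \<forall>E\<in>Ob C.
        \<forall>f\<in>Hom C A B. \<forall>g\<in>Hom C B D. \<forall>h\<in>Hom C D E.
          Cmp C A D E h (Cmp C A B D g f) = Cmp C A B E (Cmp C B D E h g) f)"

definition is_functor ::
  "('o, 'f) cat \<Rightarrow> ('p, 'g) cat \<Rightarrow> ('o \<Rightarrow> 'p) \<Rightarrow> ('o \<Rightarrow> 'o \<Rightarrow> 'f \<Rightarrow> 'g) \<Rightarrow> bool" where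
  "is_functor C D Fo Fm \<longleftrightarrow>
     is_category C \<and> is_category D \<and>
     (\<forall>A\<in>Ob C. Fo A \<in> Ob D) \<and>
     (\<forall>A\<in>Ob C. \<forall>B\<in>Ob C. \<forall>f\<in>Hom C A B. Fm A B f \<in> Hom D (Fo A) (Fo B)) \<and>
     (\<forall>A\<in>Ob C. Fm A A (Idn C A) = Idn D (Fo A)) \<and>
     (\<forall>A\<in>Ob C. \<forall>B\<in>Ob C. \<forall>E\<in>Ob C. \<forall>f\<in>Hom C A B. \<forall>g\<in>Hom C B E.
        Fm A E (Cmp C A B E g f) = Cmp D (Fo A) (Fo B) (Fo E) (Fm B E g) (Fm A B f))"


section \<open>Representations on subspaces of an ambient vector space\<close>

text \<open>
  A representation consists of a complex vector space \<open>vecs\<close>, realised as a linear subspace of an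
  ambient vector space \<open>('v, scale)\<close> (possibly all of it), and of an action on it of the elements of
  some Lie or associative algebra. Actions and morphisms are extensional functions, so that two
  representations, or two morphisms, are equal as soon as they agree where they are meaningful.
\<close>

record ('g, 'v) repn =
  vecs :: "'v set"
  act :: "'g \<Rightarrow> 'v \<Rightarrow> 'v"

definition linear_over ::
  "(complex \<Rightarrow> 'a::ab_group_add \<Rightarrow> 'a) \<Rightarrow> (complex \<Rightarrow> 'b::ab_group_add \<Rightarrow> 'b) \<Rightarrow> 'a set \<Rightarrow> ('a \<Rightarrow> 'b) \<Rightarrow> bool"
  where
  "linear_over s t U f \<longleftrightarrow>
     (\<forall>u\<in>U. \<forall>v\<in>U. f (u + v) = f u + f v) \<and> (\<forall>c. \<forall>u\<in>U. f (s c u) = t c (f u))"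

definition rep_hom ::
  "(complex \<Rightarrow> 'v::ab_group_add \<Rightarrow> 'v) \<Rightarrow> 'g set \<Rightarrow> ('g, 'v) repn \<Rightarrow> ('g, 'v) repn \<Rightarrow> ('v \<Rightarrow> 'v) set" where
  "rep_hom s G M M' = {f \<in> vecs M \<rightarrow>\<^sub>E vecs M'. linear_over s s (vecs M) f \<and>
     (\<forall>g\<in>G. \<forall>v\<in>vecs M. f (act M g v) = act M' g (f v))}"

definition rep_cat ::
  "(complex \<Rightarrow> 'v::ab_group_add \<Rightarrow> 'v) \<Rightarrow> 'g set \<Rightarrow> ('g, 'v) repn set \<Rightarrow> (('g, 'v) repn, 'v \<Rightarrow> 'v) cat" where
  "rep_cat s G Obs = \<lparr>Ob = Obs, Hom = rep_hom s G, Idn = (\<lambda>M. \<lambda>v\<in>vecs M. v),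
     Cmp = (\<lambda>A B C g f. compose (vecs A) g f)\<rparr>"

definition short_exact ::
  "('g, 'v::zero) repn \<Rightarrow> ('g, 'v) repn \<Rightarrow> ('g, 'v) repn \<Rightarrow> ('v \<Rightarrow> 'v) \<Rightarrow> ('v \<Rightarrow> 'v) \<Rightarrow> bool" where
  "short_exact A B C f g \<longleftrightarrow>
     inj_on f (vecs A) \<and> f ` vecs A = {v \<in> vecs B. g v = 0} \<and> g ` vecs B = vecs C"

definition is_exact_functor ::
  "(('g, 'v::zero) repn, 'v \<Rightarrow> 'v) cat \<Rightarrow> (('h, 'w::zero) repn, 'w \<Rightarrow> 'w) cat \<Rightarrow>
   (('g, 'v) repn \<Rightarrow> ('h, 'w) repn) \<Rightarrow>
   (('g, 'v) repn \<Rightarrow> ('g, 'v) repn \<Rightarrow> ('v \<Rightarrow> 'v) \<Rightarrow> ('w \<Rightarrow> 'w)) \<Rightarrow> bool" where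
  "is_exact_functor C D Fo Fm \<longleftrightarrow> is_functor C D Fo Fm \<and>
     (\<forall>L\<in>Ob C. \<forall>M\<in>Ob C. \<forall>R\<in>Ob C. \<forall>f\<in>Hom C L M. \<forall>g\<in>Hom C M R.
        short_exact L M R f g \<longrightarrow> short_exact (Fo L) (Fo M) (Fo R) (Fm L M f) (Fm M R g))"


section \<open>The Lie algebras and their modules\<close>

text \<open>Matrix indices start at \<open>0\<close>, as always for the type \<open>mat\<close>; the first block is \<open>{..<p}\<close>.\<close>

definition gl_module ::
  "nat \<Rightarrow> (complex \<Rightarrow> 'v::ab_group_add \<Rightarrow> 'v) \<Rightarrow> (complex mat, 'v) repn \<Rightarrow> bool" where
  "gl_module N s M \<longleftrightarrow>
     module.subspace s (vecs M) \<and>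
     act M \<in> carrier_mat N N \<rightarrow>\<^sub>E (vecs M \<rightarrow>\<^sub>E vecs M) \<and>
     (\<forall>X\<in>carrier_mat N N. linear_over s s (vecs M) (act M X)) \<and>
     (\<forall>X\<in>carrier_mat N N. \<forall>Y\<in>carrier_mat N N. \<forall>v\<in>vecs M.
        act M (X + Y) v = act M X v + act M Y v) \<and>
     (\<forall>c. \<forall>X\<in>carrier_mat N N. \<forall>v\<in>vecs M. act M (c \<cdot>\<^sub>m X) v = s c (act M X v)) \<and>
     (\<forall>X\<in>carrier_mat N N. \<forall>Y\<in>carrier_mat N N. \<forall>v\<in>vecs M.
        act M (X * Y - Y * X) v = act M X (act M Y v) - act M Y (act M X v))"

definition matrix_unit :: "nat \<Rightarrow> nat \<Rightarrow> nat \<Rightarrow> complex mat" where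
  "matrix_unit N i j = mat N N (\<lambda>(a, b). if a = i \<and> b = j then 1 else 0)"

definition Jmat :: "nat \<Rightarrow> nat \<Rightarrow> complex mat" where
  "Jmat p q = four_block_mat (1\<^sub>m p) (0\<^sub>m p q) (0\<^sub>m q p) (- 1\<^sub>m q)"

definition tr :: "complex mat \<Rightarrow> complex" where
  "tr X = (\<Sum>i<dim_row X. X $$ (i, i))"

definition \<kk> :: "nat \<Rightarrow> nat \<Rightarrow> complex mat set" where
  "\<kk> p q = {four_block_mat X1 (0\<^sub>m p q) (0\<^sub>m q p) X2 | X1 X2.
     X1 \<in> carrier_mat p p \<and> X2 \<in> carrier_mat q q}"

definition \<kk>0 :: "nat \<Rightarrow> nat \<Rightarrow> complex mat set" where
  "\<kk>0 p q = {X \<in> \<kk> p q. tr X = 0}"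

definition chi :: "nat \<Rightarrow> nat \<Rightarrow> complex mat \<Rightarrow> complex" where
  "chi p q X = (case split_block X p p of (X1, _, _, X2) \<Rightarrow> of_nat q * tr X1 - of_nat p * tr X2)"

definition k_submodule ::
  "nat \<Rightarrow> nat \<Rightarrow> (complex \<Rightarrow> 'v::ab_group_add \<Rightarrow> 'v) \<Rightarrow> (complex mat, 'v) repn \<Rightarrow> 'v set \<Rightarrow> bool" where
  "k_submodule p q s M T \<longleftrightarrow>
     module.subspace s T \<and> T \<subseteq> vecs M \<and> (\<forall>X\<in>\<kk> p q. \<forall>v\<in>T. act M X v \<in> T)"

definition simple_k_submodule ::
  "nat \<Rightarrow> nat \<Rightarrow> (complex \<Rightarrow> 'v::ab_group_add \<Rightarrow> 'v) \<Rightarrow> (complex mat, 'v) repn \<Rightarrow> 'v set \<Rightarrow> bool" where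
  "simple_k_submodule p q s M T \<longleftrightarrow> k_submodule p q s M T \<and> T \<noteq> {0} \<and>
     (\<forall>T'. k_submodule p q s M T' \<and> T' \<subseteq> T \<longrightarrow> T' = {0} \<or> T' = T)"

definition finite_dim :: "(complex \<Rightarrow> 'v::ab_group_add \<Rightarrow> 'v) \<Rightarrow> 'v set \<Rightarrow> bool" where
  "finite_dim s T \<longleftrightarrow> (\<exists>B. finite B \<and> module.span s B = T)"

definition is_direct_sum :: "(complex \<Rightarrow> 'v::ab_group_add \<Rightarrow> 'v) \<Rightarrow> 'v set set \<Rightarrow> 'v set \<Rightarrow> bool" where
  "is_direct_sum s \<T> U \<longleftrightarrow> module.span s (\<Union>\<T>) = U \<and>
     (\<forall>T\<in>\<T>. T \<inter> module.span s (\<Union>(\<T> - {T})) = {0})"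

definition harish_chandra_module ::
  "nat \<Rightarrow> nat \<Rightarrow> (complex \<Rightarrow> 'v::ab_group_add \<Rightarrow> 'v) \<Rightarrow> (complex mat, 'v) repn \<Rightarrow> bool" where
  "harish_chandra_module p q s M \<longleftrightarrow> gl_module (p + q) s M \<and>
     (\<exists>\<T>. (\<forall>T\<in>\<T>. simple_k_submodule p q s M T \<and> finite_dim s T) \<and> is_direct_sum s \<T> (vecs M))"


section \<open>The Weyl group of type BC\<close>

text \<open>
  \<open>S\<^sub>n \<ltimes> (\<int>/2)\<^sup>n\<close>, where a sign vector is given by the set \<open>A\<close> of its nontrivial coordinates and
  \<open>(\<sigma>, A)\<close> stands for the product of the \<open>\<gamma>\<^sub>i\<close>, \<open>i \<in> A\<close>, and of \<open>\<sigma>\<close> (permutation applied first).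
\<close>

type_synonym weyl_elem = "(nat \<Rightarrow> nat) \<times> nat set"

definition weyl :: "nat \<Rightarrow> weyl_elem monoid" where
  "weyl n = \<lparr>carrier = {(\<sigma>, A). \<sigma> permutes {1..n} \<and> A \<subseteq> {1..n}},
     monoid.mult = (\<lambda>(\<sigma>, A) (\<tau>, B). (\<sigma> \<circ> \<tau>, (A - \<sigma> ` B) \<union> (\<sigma> ` B - A))),
     one = (id, {})\<rparr>"

definition refl_S :: "nat \<Rightarrow> nat \<Rightarrow> weyl_elem" where
  "refl_S i j = (transpose i j, {})"

definition refl_gamma :: "nat \<Rightarrow> weyl_elem" where
  "refl_gamma i = (id, {i})"

definition weyl_act :: "weyl_elem \<Rightarrow> (nat \<Rightarrow> real) \<Rightarrow> nat \<Rightarrow> real" where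
  "weyl_act w x = (\<lambda>i. (if i \<in> snd w then -1 else 1) * x (inv_into UNIV (fst w) i))"

lemma weyl_act_mult:
  assumes "v \<in> carrier (weyl n)" "w \<in> carrier (weyl n)"
  shows "weyl_act (v \<otimes>\<^bsub>weyl n\<^esub> w) x = weyl_act v (weyl_act w x)"
proof -
  obtain \<sigma> A \<tau> B where vw: "v = (\<sigma>, A)" "w = (\<tau>, B)" by (cases v, cases w)
  with assms have b: "bij \<sigma>" "bij \<tau>" by (auto simp: weyl_def permutes_bij)
  then have "i \<in> \<sigma> ` B \<longleftrightarrow> inv_into UNIV \<sigma> i \<in> B" for i
    by (metis bij_inv_eq_iff image_iff)
  then show ?thesis using b by (auto simp: vw weyl_def weyl_act_def o_inv_distrib fun_eq_iff)
qed

lemma weyl_act_S: "i \<noteq> j \<Longrightarrow>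
  weyl_act (refl_S i j) x = (\<lambda>k. x k - (x i - x j) * (of_bool (k = i) - of_bool (k = j)))"
  by (auto simp: weyl_act_def refl_S_def transpose_def fun_eq_iff)

lemma weyl_act_gamma: "weyl_act (refl_gamma i) x = (\<lambda>k. x k - 2 * x i * of_bool (k = i))"
  by (auto simp: weyl_act_def refl_gamma_def fun_eq_iff)


section \<open>The degenerate affine Hecke algebra of type BC\<close>

datatype 'g free_word = Word (letters: "'g list")

instantiation free_word :: (type) monoid_add
begin

definition zero_free_word :: "'g free_word" where
  "zero_free_word = Word []"

definition plus_free_word :: "'g free_word \<Rightarrow> 'g free_word \<Rightarrow> 'g free_word" where
  "plus_free_word u v = Word (letters u @ letters v)"

instance
  by standard (simp_all add: zero_free_word_def plus_free_word_def)

end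

text \<open>
  Hence \<open>'g free_word \<Rightarrow>\<^sub>0 complex\<close>, with the convolution product, is the free associative unital
  complex algebra on \<open>'g\<close>; \<open>free_algebra\<close> is the subalgebra on the generators \<open>G\<close>.
\<close>

type_synonym 'g free_alg = "'g free_word \<Rightarrow>\<^sub>0 complex"

definition free_algebra :: "'g set \<Rightarrow> 'g free_alg ring" where
  "free_algebra G = \<lparr>carrier = {P. \<forall>u\<in>Poly_Mapping.keys P. set (letters u) \<subseteq> G},
     monoid.mult = (*), one = 1, ring.zero = 0, add = (+)\<rparr>"

definition scal :: "complex \<Rightarrow> 'g free_alg" where
  "scal c = Poly_Mapping.single 0 c"

definition gen :: "'g \<Rightarrow> 'g free_alg" where
  "gen g = Poly_Mapping.single (Word [g]) 1"

datatype hecke_gen = W weyl_elem | Y nat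

definition hecke_gens :: "nat \<Rightarrow> hecke_gen set" where
  "hecke_gens n = W ` carrier (weyl n) \<union> Y ` {1..n}"

abbreviation \<S> :: "nat \<Rightarrow> nat \<Rightarrow> hecke_gen free_alg" where
  "\<S> i j \<equiv> gen (W (refl_S i j))"

abbreviation \<G> :: "nat \<Rightarrow> hecke_gen free_alg" where
  "\<G> i \<equiv> gen (W (refl_gamma i))"

abbreviation \<Y> :: "nat \<Rightarrow> hecke_gen free_alg" where
  "\<Y> i \<equiv> gen (Y i)"

definition y_commutator :: "nat \<Rightarrow> complex \<Rightarrow> complex \<Rightarrow> nat \<Rightarrow> nat \<Rightarrow> hecke_gen free_alg" where
  "y_commutator n \<kappa>1 \<kappa>2 i j =
     scal (\<kappa>1 * \<kappa>2 / 2) * (\<S> i j * (\<G> j - \<G> i))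
   + scal (\<kappa>1\<^sup>2 / 4) * (\<Sum>k\<in>{1..n} - {i, j}. \<S> j k * \<S> i k)
   - scal (\<kappa>1\<^sup>2 / 4) * (\<Sum>k\<in>{1..n} - {i, j}. \<S> i k * \<S> j k)
   + scal (\<kappa>1\<^sup>2 / 4) * (\<Sum>k\<in>{1..n} - {i, j}.
       \<S> i k * \<S> j k * (- (\<G> i * \<G> k) + \<G> i * \<G> j + \<G> j * \<G> k))
   - scal (\<kappa>1\<^sup>2 / 4) * (\<Sum>k\<in>{1..n} - {i, j}.
       \<S> j k * \<S> i k * (\<G> i * \<G> j - \<G> j * \<G> k + \<G> i * \<G> k))"

text \<open>The first two lines say that the generators \<open>W w\<close> span an image of the group algebra.\<close>

definition hecke_relations :: "nat \<Rightarrow> complex \<Rightarrow> complex \<Rightarrow> hecke_gen free_alg set" where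
  "hecke_relations n \<kappa>1 \<kappa>2 =
     {gen (W v) * gen (W w) - gen (W (v \<otimes>\<^bsub>weyl n\<^esub> w)) | v w.
        v \<in> carrier (weyl n) \<and> w \<in> carrier (weyl n)} \<union>
     {gen (W \<one>\<^bsub>weyl n\<^esub>) - 1} \<union>
     {\<S> i (i + 1) * \<Y> i - \<Y> (i + 1) * \<S> i (i + 1) | i. 1 \<le> i \<and> i < n} \<union>
     {\<S> j (j + 1) * \<Y> i - \<Y> i * \<S> j (j + 1) | i j.
        1 \<le> j \<and> j < n \<and> i \<in> {1..n} \<and> i \<noteq> j \<and> i \<noteq> j + 1} \<union>
     {\<Y> n * \<G> n + \<G> n * \<Y> n} \<union>
     {\<Y> i * \<G> n - \<G> n * \<Y> i | i. i \<in> {1..n} \<and> i \<noteq> n} \<union>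
     {\<Y> i * \<Y> j - \<Y> j * \<Y> i - y_commutator n \<kappa>1 \<kappa>2 i j | i j.
        i \<in> {1..n} \<and> j \<in> {1..n} \<and> i \<noteq> j}"

definition hecke_ideal :: "nat \<Rightarrow> complex \<Rightarrow> complex \<Rightarrow> hecke_gen free_alg set" where
  "hecke_ideal n \<kappa>1 \<kappa>2 = genideal (free_algebra (hecke_gens n)) (hecke_relations n \<kappa>1 \<kappa>2)"

definition hecke :: "nat \<Rightarrow> complex \<Rightarrow> complex \<Rightarrow> hecke_gen free_alg set ring" where
  "hecke n \<kappa>1 \<kappa>2 = free_algebra (hecke_gens n) Quot hecke_ideal n \<kappa>1 \<kappa>2"

definition hecke_class :: "nat \<Rightarrow> complex \<Rightarrow> complex \<Rightarrow> hecke_gen free_alg \<Rightarrow> hecke_gen free_alg set" where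
  "hecke_class n \<kappa>1 \<kappa>2 P = hecke_ideal n \<kappa>1 \<kappa>2 +>\<^bsub>free_algebra (hecke_gens n)\<^esub> P"

definition hecke_rep ::
  "nat \<Rightarrow> complex \<Rightarrow> complex \<Rightarrow> (complex \<Rightarrow> 'v::ab_group_add \<Rightarrow> 'v) \<Rightarrow>
   (hecke_gen free_alg set, 'v) repn \<Rightarrow> bool" where
  "hecke_rep n \<kappa>1 \<kappa>2 s R \<longleftrightarrow> (let H = hecke n \<kappa>1 \<kappa>2 in
     module.subspace s (vecs R) \<and>
     act R \<in> carrier H \<rightarrow>\<^sub>E (vecs R \<rightarrow>\<^sub>E vecs R) \<and>
     (\<forall>a\<in>carrier H. linear_over s s (vecs R) (act R a)) \<and>
     (\<forall>a\<in>carrier H. \<forall>b\<in>carrier H. \<forall>v\<in>vecs R. act R (a \<oplus>\<^bsub>H\<^esub> b) v = act R a v + act R b v) \<and>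
     (\<forall>a\<in>carrier H. \<forall>b\<in>carrier H. \<forall>v\<in>vecs R. act R (a \<otimes>\<^bsub>H\<^esub> b) v = act R a (act R b v)) \<and>
     (\<forall>c. \<forall>v\<in>vecs R. act R (hecke_class n \<kappa>1 \<kappa>2 (scal c)) v = s c v))"


section \<open>The tensor product of a vector space with a tensor power of \<open>V\<close>\<close>

text \<open>
  With the standard basis \<open>e\<^sub>0, \<dots>, e\<^bsub>N-1\<^esub>\<close> of \<open>V\<close>, every element of \<open>U \<otimes> V\<^sup>\<otimes>\<^sup>n\<close> is uniquely a sum of
  \<open>f w \<otimes> e\<^bsub>w 1\<^esub> \<otimes> \<dots> \<otimes> e\<^bsub>w n\<^esub>\<close> over the maps \<open>w\<close> from \<open>{1..n}\<close> to \<open>{..<N}\<close>; it is represented by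
  its coefficient function \<open>f\<close>. The lemma \<open>tensor_universal\<close> below shows that this is the tensor product.
\<close>

type_synonym 'v tensor = "(nat \<Rightarrow> nat) \<Rightarrow> 'v"

definition ix :: "nat \<Rightarrow> nat \<Rightarrow> (nat \<Rightarrow> nat) set" where
  "ix n N = {1..n} \<rightarrow>\<^sub>E {..<N}"

definition tensor_space :: "nat \<Rightarrow> nat \<Rightarrow> 'v::zero set \<Rightarrow> 'v tensor set" where
  "tensor_space n N U = {f. (\<forall>w\<in>ix n N. f w \<in> U) \<and> (\<forall>w. w \<notin> ix n N \<longrightarrow> f w = 0)}"

definition tscale :: "(complex \<Rightarrow> 'v \<Rightarrow> 'v) \<Rightarrow> complex \<Rightarrow> 'v tensor \<Rightarrow> 'v tensor" where
  "tscale s c f = (\<lambda>w. s c (f w))"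

definition pure_tensor ::
  "nat \<Rightarrow> nat \<Rightarrow> (complex \<Rightarrow> 'v::zero \<Rightarrow> 'v) \<Rightarrow> 'v \<Rightarrow> (nat \<Rightarrow> complex vec) \<Rightarrow> 'v tensor" where
  "pure_tensor n N s m v = (\<lambda>w. if w \<in> ix n N then s (\<Prod>k\<in>{1..n}. v k $ w k) m else 0)"

definition on_zeroth :: "('v \<Rightarrow> 'v) \<Rightarrow> 'v tensor \<Rightarrow> 'v tensor" where
  "on_zeroth T f = (\<lambda>w. T (f w))"

definition on_factor ::
  "nat \<Rightarrow> nat \<Rightarrow> (complex \<Rightarrow> 'v::ab_group_add \<Rightarrow> 'v) \<Rightarrow> nat \<Rightarrow> complex mat \<Rightarrow> 'v tensor \<Rightarrow> 'v tensor" where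
  "on_factor n N s k X f =
     (\<lambda>w. if w \<in> ix n N then \<Sum>b<N. s (X $$ (w k, b)) (f (w(k := b))) else 0)"

definition swap_factors :: "nat \<Rightarrow> nat \<Rightarrow> nat \<Rightarrow> nat \<Rightarrow> 'v::zero tensor \<Rightarrow> 'v tensor" where
  "swap_factors n N i j f = (\<lambda>w. if w \<in> ix n N then f (w \<circ> transpose i j) else 0)"

definition multilinear_on ::
  "nat \<Rightarrow> nat \<Rightarrow> (complex \<Rightarrow> 'v::ab_group_add \<Rightarrow> 'v) \<Rightarrow> (complex \<Rightarrow> 'z::ab_group_add \<Rightarrow> 'z) \<Rightarrow> 'v set \<Rightarrow>
   ('v \<Rightarrow> (nat \<Rightarrow> complex vec) \<Rightarrow> 'z) \<Rightarrow> bool" where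
  "multilinear_on n N s t U \<beta> \<longleftrightarrow>
     (\<forall>v\<in>{1..n} \<rightarrow>\<^sub>E carrier_vec N. linear_over s t U (\<lambda>m. \<beta> m v)) \<and>
     (\<forall>m\<in>U. \<forall>v\<in>{1..n} \<rightarrow>\<^sub>E carrier_vec N. \<forall>k\<in>{1..n}.
        (\<forall>x\<in>carrier_vec N. \<forall>y\<in>carrier_vec N.
           \<beta> m (v(k := x + y)) = \<beta> m (v(k := x)) + \<beta> m (v(k := y))) \<and>
        (\<forall>c. \<forall>x\<in>carrier_vec N. \<beta> m (v(k := c \<cdot>\<^sub>v x)) = t c (\<beta> m (v(k := x)))))"

lemma finite_ix [simp]: "finite (ix n N)"
  by (simp add: ix_def finite_PiE)

lemma ix_upd: "w \<in> ix n N \<Longrightarrow> k \<in> {1..n} \<Longrightarrow> b < N \<Longrightarrow> w(k := b) \<in> ix n N"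
  by (auto simp: ix_def PiE_def extensional_def)

lemma ix_lt: "w \<in> ix n N \<Longrightarrow> k \<in> {1..n} \<Longrightarrow> w k < N"
  by (auto simp: ix_def PiE_def Pi_def)

lemma ix_transpose:
  assumes "w \<in> ix n N" "i \<in> {1..n}" "j \<in> {1..n}"
  shows "w \<circ> transpose i j \<in> ix n N"
  using assms by (fastforce simp: ix_def PiE_def Pi_def extensional_def transpose_def)

lemma slot_expansion:
  assumes t: "vector_space t" and \<beta>: "multilinear_on n N s t U \<beta>"
    and m: "m \<in> U" and u: "u \<in> {1..n} \<rightarrow>\<^sub>E carrier_vec N" and i: "i \<in> {1..n}"
    and x: "x \<in> carrier_vec N"
  shows "\<beta> m (u(i := x)) = (\<Sum>b<N. t (x $ b) (\<beta> m (u(i := unit_vec N b))))"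
proof -
  interpret t: vector_space t by fact
  have add: "\<beta> m (u(i := a + b)) = \<beta> m (u(i := a)) + \<beta> m (u(i := b))"
    if "a \<in> carrier_vec N" "b \<in> carrier_vec N" for a b
    using \<beta> m u i that unfolding multilinear_on_def by blast
  have scl: "\<beta> m (u(i := c \<cdot>\<^sub>v a)) = t c (\<beta> m (u(i := a)))" if "a \<in> carrier_vec N" for c a
    using \<beta> m u i that unfolding multilinear_on_def by blast
  have "\<beta> m (u(i := vec N (\<lambda>b. if b < j then x $ b else 0)))
      = (\<Sum>b<j. t (x $ b) (\<beta> m (u(i := unit_vec N b))))" if "j \<le> N" for j
    using that
  proof (induction j)
    case 0
    have z: "vec N (\<lambda>b. if b < 0 then x $ b else 0) = 0 \<cdot>\<^sub>v (0\<^sub>v N :: complex vec)"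
      by (rule eq_vecI) auto
    have "\<beta> m (u(i := vec N (\<lambda>b. if b < 0 then x $ b else 0))) = t 0 (\<beta> m (u(i := 0\<^sub>v N)))"
      unfolding z by (rule scl) simp
    also have "\<dots> = 0" by simp
    finally show ?case by (simp only: lessThan_0 sum.empty)
  next
    case (Suc j)
    have "vec N (\<lambda>b. if b < Suc j then x $ b else 0)
        = vec N (\<lambda>b. if b < j then x $ b else 0) + (x $ j) \<cdot>\<^sub>v unit_vec N j"
      using Suc.prems by (intro eq_vecI) (auto simp: less_Suc_eq)
    then have "\<beta> m (u(i := vec N (\<lambda>b. if b < Suc j then x $ b else 0)))
        = \<beta> m (u(i := vec N (\<lambda>b. if b < j then x $ b else 0))) + t (x $ j) (\<beta> m (u(i := unit_vec N j)))"
      using add[of "vec N (\<lambda>b. if b < j then x $ b else 0)" "(x $ j) \<cdot>\<^sub>v unit_vec N j"]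
        scl[of "unit_vec N j" "x $ j"] by (simp del: fun_upd_apply)
    with Suc show ?case by (simp only: sum.lessThan_Suc Suc_leD)
  qed
  from this[of N] have "\<beta> m (u(i := vec N (\<lambda>b. if b < N then x $ b else 0)))
      = (\<Sum>b<N. t (x $ b) (\<beta> m (u(i := unit_vec N b))))" by simp
  moreover have "vec N (\<lambda>b. if b < N then x $ b else 0) = x"
    using x by (intro eq_vecI) auto
  ultimately show ?thesis by simp
qed

lemma sum_PiE_insert:
  assumes "i \<notin> I"
  shows "(\<Sum>w \<in> insert i I \<rightarrow>\<^sub>E B. g w) = (\<Sum>(b, w) \<in> B \<times> (I \<rightarrow>\<^sub>E B). g (w(i := b)))"
proof -
  have "(\<Sum>w \<in> insert i I \<rightarrow>\<^sub>E B. g w) = sum (g \<circ> (\<lambda>(b, w). w(i := b))) (B \<times> (I \<rightarrow>\<^sub>E B))"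
    unfolding PiE_insert_eq using inj_combinator[OF assms] by (rule sum.reindex)
  then show ?thesis by (simp add: o_def case_prod_unfold)
qed

lemma multilinear_expansion:
  assumes t: "vector_space t" and \<beta>: "multilinear_on n N s t U \<beta>"
    and m: "m \<in> U" and v: "v \<in> {1..n} \<rightarrow>\<^sub>E carrier_vec N"
    and I: "finite I" "I \<subseteq> {1..n}"
  shows "\<beta> m v = (\<Sum>w \<in> I \<rightarrow>\<^sub>E {..<N}.
    t (\<Prod>k\<in>I. v k $ w k) (\<beta> m (\<lambda>k. if k \<in> I then unit_vec N (w k) else v k)))"
  using I
proof (induction I rule: finite_induct)
  case empty
  interpret t: vector_space t by fact
  show ?case by simp
next
  case (insert i I)
  interpret t: vector_space t by fact
  define e where "e w = (\<lambda>k. if k \<in> I then unit_vec N (w k) else v k)" for w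
  have i: "i \<in> {1..n}" "v i \<in> carrier_vec N" using insert v by (auto simp: PiE_def Pi_def)
  have e: "e w \<in> {1..n} \<rightarrow>\<^sub>E carrier_vec N" for w
    using insert v by (auto simp: e_def PiE_def Pi_def extensional_def)
  have split: "\<beta> m (e w) = (\<Sum>b<N. t (v i $ b) (\<beta> m ((e w)(i := unit_vec N b))))" for w
  proof -
    have "(e w)(i := v i) = e w" using insert by (auto simp: e_def)
    then show ?thesis using slot_expansion[OF t \<beta> m e i, of w] by simp
  qed
  have fin: "finite (I \<rightarrow>\<^sub>E {..<N})" using insert by (intro finite_PiE) auto
  have "\<beta> m v = (\<Sum>w \<in> I \<rightarrow>\<^sub>E {..<N}. t (\<Prod>k\<in>I. v k $ w k) (\<beta> m (e w)))"
    using insert by (simp add: e_def)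
  also have "\<dots> = (\<Sum>w \<in> I \<rightarrow>\<^sub>E {..<N}. \<Sum>b<N.
      t ((\<Prod>k\<in>I. v k $ w k) * v i $ b) (\<beta> m ((e w)(i := unit_vec N b))))"
    by (subst split) (simp add: t.scale_sum_right)
  also have "\<dots> = (\<Sum>(b, w) \<in> {..<N} \<times> (I \<rightarrow>\<^sub>E {..<N}).
      t ((\<Prod>k\<in>I. v k $ w k) * v i $ b) (\<beta> m ((e w)(i := unit_vec N b))))"
    by (subst sum.swap) (simp add: sum.cartesian_product)
  also have "\<dots> = (\<Sum>(b, w) \<in> {..<N} \<times> (I \<rightarrow>\<^sub>E {..<N}).
      t (\<Prod>k\<in>insert i I. v k $ (w(i := b)) k)
        (\<beta> m (\<lambda>k. if k \<in> insert i I then unit_vec N ((w(i := b)) k) else v k)))"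
  proof (intro sum.cong refl, clarify)
    fix b w
    have "(\<Prod>k\<in>insert i I. v k $ (w(i := b)) k) = v i $ b * (\<Prod>k\<in>I. v k $ (w(i := b)) k)"
      using insert by simp
    also have "(\<Prod>k\<in>I. v k $ (w(i := b)) k) = (\<Prod>k\<in>I. v k $ w k)"
      using insert by (intro prod.cong) auto
    finally have 1: "(\<Prod>k\<in>insert i I. v k $ (w(i := b)) k) = (\<Prod>k\<in>I. v k $ w k) * v i $ b"
      by (simp add: mult.commute)
    have 2: "(\<lambda>k. if k \<in> insert i I then unit_vec N ((w(i := b)) k) else v k) = (e w)(i := unit_vec N b)"
      by (auto simp: e_def)
    show "t ((\<Prod>k\<in>I. v k $ w k) * v i $ b) (\<beta> m ((e w)(i := unit_vec N b))) =
      t (\<Prod>k\<in>insert i I. v k $ (w(i := b)) k)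
        (\<beta> m (\<lambda>k. if k \<in> insert i I then unit_vec N ((w(i := b)) k) else v k))"
      unfolding 1 2 ..
  qed
  also have "\<dots> = (\<Sum>w \<in> insert i I \<rightarrow>\<^sub>E {..<N}.
      t (\<Prod>k\<in>insert i I. v k $ w k)
        (\<beta> m (\<lambda>k. if k \<in> insert i I then unit_vec N (w k) else v k)))"
    by (rule sum_PiE_insert[OF insert(2), symmetric, where g = "\<lambda>w. t (\<Prod>k\<in>insert i I. v k $ w k)
        (\<beta> m (\<lambda>k. if k \<in> insert i I then unit_vec N (w k) else v k))"])
  finally show ?case .
qed

lemma linear_over_sum:
  assumes "vector_space s" "vector_space t" "module.subspace s U" "linear_over s t U h"
    and "finite A" "\<And>a. a \<in> A \<Longrightarrow> g a \<in> U"
  shows "h (sum g A) = (\<Sum>a\<in>A. h (g a))"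
proof -
  interpret s: vector_space s by fact
  interpret t: vector_space t by fact
  have "h (s 0 0) = t 0 (h 0)"
    using assms(3,4) s.subspace_0 unfolding linear_over_def by blast
  then have h0: "h 0 = 0" by simp
  show ?thesis using assms(5,6)
  proof (induction A rule: finite_induct)
    case empty
    show ?case by (simp add: h0)
  next
    case (insert a A)
    then have "sum g A \<in> U" by (intro s.subspace_sum[OF assms(3)]) auto
    with insert assms(4) show ?case by (simp add: linear_over_def)
  qed
qed

lemma vector_space_tscale: "vector_space s \<Longrightarrow> vector_space (tscale s)"
  unfolding vector_space_def tscale_def by (auto simp: fun_eq_iff)

lemma subspace_tensor_space:
  assumes "vector_space s" "module.subspace s U"
  shows "module.subspace (tscale s) (tensor_space n N U)"
proof -
  interpret s: vector_space s by fact
  interpret ts: vector_space "tscale s" using assms(1) by (rule vector_space_tscale)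
  show ?thesis using assms(2)
    unfolding ts.subspace_def s.subspace_def tensor_space_def tscale_def by auto
qed

lemma pure_tensor_in:
  assumes "vector_space s" "module.subspace s U" "m \<in> U"
  shows "pure_tensor n N s m v \<in> tensor_space n N U"
proof -
  interpret s: vector_space s by fact
  show ?thesis using assms by (auto simp: tensor_space_def pure_tensor_def intro: s.subspace_scale)
qed

lemma prod_upd_slot:
  fixes k n :: nat
  assumes "k \<in> {1..n}"
  shows "(\<Prod>l\<in>{1..n}. (v(k := x)) l $ w l) = x $ w k * (\<Prod>l\<in>{1..n} - {k}. v l $ w l)"
    (is "?L = _")
proof -
  have "?L = (v(k := x)) k $ w k * (\<Prod>l\<in>{1..n} - {k}. (v(k := x)) l $ w l)"
    using assms by (intro prod.remove) auto
  also have "(\<Prod>l\<in>{1..n} - {k}. (v(k := x)) l $ w l) = (\<Prod>l\<in>{1..n} - {k}. v l $ w l)"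
    by (intro prod.cong) auto
  finally show ?thesis by simp
qed

lemma pure_tensor_multilinear:
  assumes "vector_space s"
  shows "multilinear_on n N s (tscale s) U (pure_tensor n N s)"
proof -
  interpret s: vector_space s by fact
  show ?thesis unfolding multilinear_on_def
  proof (intro conjI ballI allI)
    fix v
    show "linear_over s (tscale s) U (\<lambda>m. pure_tensor n N s m v)"
      by (auto simp: linear_over_def pure_tensor_def tscale_def fun_eq_iff
          s.scale_right_distrib mult.commute)
  next
    fix m v k and x y :: "complex vec" assume *: "k \<in> {1..n}" "x \<in> carrier_vec N" "y \<in> carrier_vec N"
    then have "w \<in> ix n N \<Longrightarrow> (x + y) $ w k = x $ w k + y $ w k" for w
      using ix_lt[of w n N k] by simp
    with * show "pure_tensor n N s m (v(k := x + y)) =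
        pure_tensor n N s m (v(k := x)) + pure_tensor n N s m (v(k := y))"
      unfolding pure_tensor_def prod_upd_slot[OF *(1)]
      by (auto simp: fun_eq_iff algebra_simps s.scale_left_distrib)
  next
    fix m v k c and x :: "complex vec" assume *: "k \<in> {1..n}" "x \<in> carrier_vec N"
    then have "w \<in> ix n N \<Longrightarrow> (c \<cdot>\<^sub>v x) $ w k = c * x $ w k" for w
      using ix_lt[of w n N k] by simp
    with * show "pure_tensor n N s m (v(k := c \<cdot>\<^sub>v x)) = tscale s c (pure_tensor n N s m (v(k := x)))"
      unfolding pure_tensor_def prod_upd_slot[OF *(1)] tscale_def
      by (auto simp: fun_eq_iff mult.assoc)
  qed
qed

lemma tensor_expansion:
  assumes s: "vector_space s" and f: "f \<in> tensor_space n N U"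
  shows "f = (\<Sum>w\<in>ix n N. pure_tensor n N s (f w) (\<lambda>k\<in>{1..n}. unit_vec N (w k)))"
proof (rule ext)
  interpret s: vector_space s by fact
  fix x :: "nat \<Rightarrow> nat"
  have ap: "(\<Sum>w\<in>ix n N. g w) x = (\<Sum>w\<in>ix n N. g w x)" for g :: "_ \<Rightarrow> _ \<Rightarrow> 'a"
    by (induction rule: infinite_finite_induct) auto
  have "pure_tensor n N s (f w) (\<lambda>k\<in>{1..n}. unit_vec N (w k)) x = (if w = x then f x else 0)"
    if w: "w \<in> ix n N" for w
  proof (cases "x \<in> ix n N")
    case True
    have "(\<Prod>k\<in>{1..n}. (\<lambda>k\<in>{1..n}. unit_vec N (w k)) k $ x k)
        = (\<Prod>k\<in>{1..n}. if x k = w k then 1 else (0::complex))"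
      using ix_lt[OF True] ix_lt[OF w] by (intro prod.cong) auto
    also have "\<dots> = (if w = x then 1 else 0)"
    proof (cases "w = x")
      case False
      then obtain k where "k \<in> {1..n}" "w k \<noteq> x k"
        using w True PiE_ext[of w "{1..n}" "\<lambda>_. {..<N}" x] unfolding ix_def by blast
      with False show ?thesis by (auto intro!: prod_zero)
    qed auto
    finally show ?thesis using True unfolding pure_tensor_def by simp
  next
    case False
    with f show ?thesis by (auto simp: pure_tensor_def tensor_space_def)
  qed
  then show "f x = (\<Sum>w\<in>ix n N. pure_tensor n N s (f w) (\<lambda>k\<in>{1..n}. unit_vec N (w k))) x"
    using f unfolding ap by (auto simp: tensor_space_def)
qed

lemma tensor_universal:
  fixes s :: "complex \<Rightarrow> 'v::ab_group_add \<Rightarrow> 'v" and t :: "complex \<Rightarrow> 'z::ab_group_add \<Rightarrow> 'z"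
  assumes s: "vector_space s" and t: "vector_space t" and U: "module.subspace s U"
    and \<beta>: "multilinear_on n N s t U \<beta>"
  shows "\<exists>!h. h \<in> extensional (tensor_space n N U) \<and> linear_over (tscale s) t (tensor_space n N U) h \<and>
    (\<forall>m\<in>U. \<forall>v\<in>{1..n} \<rightarrow>\<^sub>E carrier_vec N. h (pure_tensor n N s m v) = \<beta> m v)"
proof -
  interpret s: vector_space s by fact
  interpret t: vector_space t by fact
  let ?T = "tensor_space n N U"
  define e where "e w = (\<lambda>k\<in>{1..n}. unit_vec N (w k) :: complex vec)" for w
  have e: "e w \<in> {1..n} \<rightarrow>\<^sub>E carrier_vec N" for w
    by (auto simp: e_def)
  have lin: "linear_over s t U (\<lambda>m. \<beta> m (e w))" for w
    using \<beta> e unfolding multilinear_on_def by blast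
  define h where "h = (\<lambda>f\<in>?T. \<Sum>w\<in>ix n N. \<beta> (f w) (e w))"
  have T: "f w \<in> U" if "f \<in> ?T" "w \<in> ix n N" for f w using that by (simp add: tensor_space_def)
  have subT: "module.subspace (tscale s) ?T" by (rule subspace_tensor_space[OF s U])
  interpret ts: vector_space "tscale s" using s by (rule vector_space_tscale)
  have "linear_over (tscale s) t ?T h"
    unfolding linear_over_def
  proof (intro conjI ballI allI)
    fix f g assume fg: "f \<in> ?T" "g \<in> ?T"
    then have "f + g \<in> ?T" by (rule ts.subspace_add[OF subT])
    then show "h (f + g) = h f + h g" using fg lin T
      by (simp add: h_def linear_over_def sum.distrib)
  next
    fix c f assume f: "f \<in> ?T"
    then have "tscale s c f \<in> ?T" by (rule ts.subspace_scale[OF subT])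
    then show "h (tscale s c f) = t c (h f)" using f lin T
      by (simp add: h_def linear_over_def t.scale_sum_right tscale_def)
  qed
  moreover have "h (pure_tensor n N s m v) = \<beta> m v"
    if mv: "m \<in> U" "v \<in> {1..n} \<rightarrow>\<^sub>E carrier_vec N" for m v
  proof -
    have "(\<lambda>k. if k \<in> {1..n} then unit_vec N (w k) else v k) = e w" for w
      using mv(2) by (auto simp: e_def PiE_def extensional_def)
    then have "\<beta> m v = (\<Sum>w \<in> ix n N. t (\<Prod>k\<in>{1..n}. v k $ w k) (\<beta> m (e w)))"
      using multilinear_expansion[OF t \<beta> mv, of "{1..n}"] unfolding ix_def by simp
    also have "\<dots> = (\<Sum>w \<in> ix n N. \<beta> (pure_tensor n N s m v w) (e w))"
      using lin mv(1) by (intro sum.cong) (auto simp: pure_tensor_def linear_over_def)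
    finally show ?thesis using pure_tensor_in[OF s U mv(1)] by (simp add: h_def)
  qed
  moreover have "h \<in> extensional ?T" by (simp add: h_def)
  moreover have "h' = h" if h': "h' \<in> extensional ?T" "linear_over (tscale s) t ?T h'"
    "\<forall>m\<in>U. \<forall>v\<in>{1..n} \<rightarrow>\<^sub>E carrier_vec N. h' (pure_tensor n N s m v) = \<beta> m v" for h'
  proof (rule extensionalityI[OF h'(1)])
    fix f assume f: "f \<in> ?T"
    have "h' f = h' (\<Sum>w\<in>ix n N. pure_tensor n N s (f w) (e w))"
      using tensor_expansion[OF s f] unfolding e_def by simp
    also have "\<dots> = (\<Sum>w\<in>ix n N. h' (pure_tensor n N s (f w) (e w)))"
      by (rule linear_over_sum[OF vector_space_tscale[OF s] t subT h'(2) finite_ix])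
        (rule pure_tensor_in[OF s U T[OF f]])
    also have "\<dots> = h f" using h'(3) e f T by (simp add: h_def)
    finally show "h' f = h f" .
  qed (simp add: h_def)
  ultimately show ?thesis by (intro ex1I[of _ h]) blast+
qed

lemma on_zeroth_pure:
  assumes "vector_space s" "linear_over s s U T" "m \<in> U" "T 0 = 0"
  shows "on_zeroth T (pure_tensor n N s m v) = pure_tensor n N s (T m) v"
  using assms by (auto simp: on_zeroth_def pure_tensor_def linear_over_def fun_eq_iff)

lemma on_factor_pure:
  assumes s: "vector_space s" and X: "X \<in> carrier_mat N N" and k: "k \<in> {1..n}"
    and v: "v k \<in> carrier_vec N"
  shows "on_factor n N s k X (pure_tensor n N s m v) = pure_tensor n N s m (v(k := X *\<^sub>v v k))"
proof (rule ext)
  interpret s: vector_space s by fact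
  fix w
  show "on_factor n N s k X (pure_tensor n N s m v) w = pure_tensor n N s m (v(k := X *\<^sub>v v k)) w"
  proof (cases "w \<in> ix n N")
    case True
    let ?P = "\<Prod>l\<in>{1..n} - {k}. v l $ w l"
    have "(\<Prod>l\<in>{1..n}. v l $ (w(k := b)) l) = v k $ b * ?P" for b
    proof -
      have "(\<Prod>l\<in>{1..n}. v l $ (w(k := b)) l)
          = v k $ (w(k := b)) k * (\<Prod>l\<in>{1..n} - {k}. v l $ (w(k := b)) l)"
        using k by (intro prod.remove) auto
      also have "(\<Prod>l\<in>{1..n} - {k}. v l $ (w(k := b)) l) = ?P" by (intro prod.cong) auto
      finally show ?thesis by simp
    qed
    then have "on_factor n N s k X (pure_tensor n N s m v) w
        = (\<Sum>b<N. s (X $$ (w k, b)) (s (v k $ b * ?P) m))"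
      using True ix_upd[OF True k] by (simp add: on_factor_def pure_tensor_def)
    also have "\<dots> = s ((\<Sum>b<N. X $$ (w k, b) * v k $ b) * ?P) m"
      by (simp add: s.scale_sum_left sum_distrib_right mult.assoc)
    also have "(\<Sum>b<N. X $$ (w k, b) * v k $ b) = (X *\<^sub>v v k) $ w k"
      using X v ix_lt[OF True k] by (simp add: scalar_prod_def lessThan_atLeast0)
    also have "s ((X *\<^sub>v v k) $ w k * ?P) m = pure_tensor n N s m (v(k := X *\<^sub>v v k)) w"
      unfolding pure_tensor_def prod_upd_slot[OF k] using True by simp
    finally show ?thesis .
  qed (simp add: on_factor_def pure_tensor_def)
qed

lemma swap_factors_pure:
  assumes "i \<in> {1..n}" "j \<in> {1..n}"
  shows "swap_factors n N i j (pure_tensor n N s m v) = pure_tensor n N s m (v \<circ> transpose i j)"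
proof -
  have *: "(\<Prod>l\<in>{1..n}. v l $ (w \<circ> transpose i j) l) = (\<Prod>l\<in>{1..n}. (v \<circ> transpose i j) l $ w l)"
    for w :: "nat \<Rightarrow> nat"
    unfolding prod.permute[OF permutes_swap_id[OF assms], of "\<lambda>l. v l $ (w \<circ> transpose i j) l"]
    by (simp add: o_def)
  show ?thesis
    unfolding swap_factors_def pure_tensor_def * [symmetric]
    by (rule ext) (simp add: ix_transpose[OF _ assms])
qed


section \<open>The functor\<close>

definition tensor_act ::
  "nat \<Rightarrow> nat \<Rightarrow> (complex \<Rightarrow> 'v::ab_group_add \<Rightarrow> 'v) \<Rightarrow> (complex mat, 'v) repn \<Rightarrow>
   complex mat \<Rightarrow> 'v tensor \<Rightarrow> 'v tensor" where
  "tensor_act n N s M X f = on_zeroth (act M X) f + (\<Sum>k\<in>{1..n}. on_factor n N s k X f)"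

definition F_space ::
  "nat \<Rightarrow> nat \<Rightarrow> nat \<Rightarrow> complex \<Rightarrow> (complex \<Rightarrow> 'v::ab_group_add \<Rightarrow> 'v) \<Rightarrow> (complex mat, 'v) repn \<Rightarrow>
   'v tensor set" where
  "F_space n p q \<mu> s M = {f \<in> tensor_space n (p + q) (vecs M).
     \<forall>X\<in>\<kk>0 p q. tensor_act n (p + q) s M X f = tscale s (\<mu> * chi p q X) f}"

definition y_op ::
  "nat \<Rightarrow> nat \<Rightarrow> nat \<Rightarrow> (complex \<Rightarrow> 'v::ab_group_add \<Rightarrow> 'v) \<Rightarrow> (complex mat, 'v) repn \<Rightarrow>
   nat \<Rightarrow> 'v tensor \<Rightarrow> 'v tensor" where
  "y_op n p q s M k f =
     - (\<Sum>(i, j) \<in> {(i, j). i < p + q \<and> j < p + q \<and> (i < p) \<noteq> (j < p)}.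
          on_zeroth (act M (matrix_unit (p + q) i j))
            (on_factor n (p + q) s k (matrix_unit (p + q) j i) f))"

definition is_F_rep ::
  "nat \<Rightarrow> nat \<Rightarrow> nat \<Rightarrow> complex \<Rightarrow> (complex \<Rightarrow> 'v::ab_group_add \<Rightarrow> 'v) \<Rightarrow> complex \<Rightarrow> complex \<Rightarrow>
   (complex mat, 'v) repn \<Rightarrow> (hecke_gen free_alg set, 'v tensor) repn \<Rightarrow> bool" where
  "is_F_rep n p q \<mu> s \<kappa>1 \<kappa>2 M R \<longleftrightarrow>
     hecke_rep n \<kappa>1 \<kappa>2 (tscale s) R \<and>
     vecs R = F_space n p q \<mu> s M \<and>
     (\<forall>f\<in>F_space n p q \<mu> s M.
        (\<forall>i\<in>{1..n}. \<forall>j\<in>{1..n}. i \<noteq> j \<longrightarrow>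
           act R (hecke_class n \<kappa>1 \<kappa>2 (\<S> i j)) f = swap_factors n (p + q) i j f) \<and>
        (\<forall>i\<in>{1..n}. act R (hecke_class n \<kappa>1 \<kappa>2 (\<G> i)) f = on_factor n (p + q) s i (Jmat p q) f) \<and>
        (\<forall>k\<in>{1..n}. act R (hecke_class n \<kappa>1 \<kappa>2 (\<Y> k)) f = y_op n p q s M k f))"

definition F_obj ::
  "nat \<Rightarrow> nat \<Rightarrow> nat \<Rightarrow> complex \<Rightarrow> (complex \<Rightarrow> 'v::ab_group_add \<Rightarrow> 'v) \<Rightarrow> complex \<Rightarrow> complex \<Rightarrow>
   (complex mat, 'v) repn \<Rightarrow> (hecke_gen free_alg set, 'v tensor) repn" where
  "F_obj n p q \<mu> s \<kappa>1 \<kappa>2 M = (THE R. is_F_rep n p q \<mu> s \<kappa>1 \<kappa>2 M R)"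

definition F_map ::
  "nat \<Rightarrow> nat \<Rightarrow> nat \<Rightarrow> complex \<Rightarrow> (complex \<Rightarrow> 'v::ab_group_add \<Rightarrow> 'v) \<Rightarrow>
   (complex mat, 'v) repn \<Rightarrow> (complex mat, 'v) repn \<Rightarrow> ('v \<Rightarrow> 'v) \<Rightarrow> 'v tensor \<Rightarrow> 'v tensor" where
  "F_map n p q \<mu> s M M' \<phi> = (\<lambda>f\<in>F_space n p q \<mu> s M. on_zeroth \<phi> f)"

definition gl_cat ::
  "nat \<Rightarrow> (complex \<Rightarrow> 'v::ab_group_add \<Rightarrow> 'v) \<Rightarrow> ((complex mat, 'v) repn, 'v \<Rightarrow> 'v) cat" where
  "gl_cat N s = rep_cat s (carrier_mat N N) {M. gl_module N s M}"

definition harish_chandra_cat ::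
  "nat \<Rightarrow> nat \<Rightarrow> (complex \<Rightarrow> 'v::ab_group_add \<Rightarrow> 'v) \<Rightarrow> ((complex mat, 'v) repn, 'v \<Rightarrow> 'v) cat" where
  "harish_chandra_cat p q s =
     rep_cat s (carrier_mat (p + q) (p + q)) {M. harish_chandra_module p q s M}"

definition hecke_cat ::
  "nat \<Rightarrow> complex \<Rightarrow> complex \<Rightarrow> (complex \<Rightarrow> 'v::ab_group_add \<Rightarrow> 'v) \<Rightarrow>
   ((hecke_gen free_alg set, 'v) repn, 'v \<Rightarrow> 'v) cat" where
  "hecke_cat n \<kappa>1 \<kappa>2 s = rep_cat s (carrier (hecke n \<kappa>1 \<kappa>2)) {R. hecke_rep n \<kappa>1 \<kappa>2 s R}"

end

theory Submission
  imports Defs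
begin

text \<open>
  Tensors in \<open>M \<otimes> V\<^sup>\<otimes>\<^sup>n\<close> are coefficient functions \<open>f\<close> on words \<open>w\<close>, and all operators are computed on
  coefficients. The Weyl group permutes and signs the letters, and
  \<open>(y\<^sub>k f)(w) = - \<Sum>\<^sub>i E\<^bsub>i, w k\<^esub> f (w (k := i))\<close>, where \<open>i\<close> runs over the block opposite to \<open>w k\<close>
  (\<open>y_eq\<close>). From this formula the relations between the \<open>y\<^sub>k\<close> and the Weyl group are immediate
  (\<open>y_weyl_op\<close>). All these operators commute with \<open>\<kk>\<close>, hence preserve the semi-invariants
  (\<open>tensor_act_weyl_op\<close>, \<open>tensor_act_y\<close>).

  The substance is the bracket \<open>[y\<^sub>a, y\<^sub>b]\<close>. The commutation rule of the matrix units turns it into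
  \<open>S\<^sub>a\<^sub>b (\<Omega>\<^sub>a - \<Omega>\<^sub>b)\<close>, restricted to words whose letters at \<open>a\<close> and \<open>b\<close> lie in different blocks, where \<open>\<Omega>\<^sub>a\<close>
  is the Casimir element of \<open>\<kk>\<close> acting between \<open>M\<close> and the place \<open>a\<close> (\<open>y_bracket_Casimir\<close>). On
  semi-invariants the action of \<open>\<kk>0\<close> on \<open>M\<close> equals \<open>\<mu> \<chi>\<close> minus the action on the factors \<open>V\<close>, which
  expresses \<open>\<Omega>\<^sub>a - \<Omega>\<^sub>b\<close> by signs and permutations (\<open>Casimir_difference\<close>). The character contributes
  \<open>\<mu> N\<close>, the action on the place \<open>a\<close> itself contributes the sizes \<open>p\<close> and \<open>q\<close> of the blocks, and together
  they give \<open>\<kappa>\<^sub>2 = p - q - \<mu> N\<close>; the other places give the transpositions. Writing the conditions on blocks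
  as polynomials in the signs yields the stated relation (\<open>y_bracket_at\<close>).

  The rest is formal. Operators satisfying the relations define an action of the quotient algebra,
  since the polynomials acting by zero form an ideal (\<open>annihilator_ideal\<close>), and the action is unique
  because the reflections and the \<open>y\<^sub>k\<close> generate the algebra (\<open>hecke_rep_eqI\<close>). Morphisms act on
  \<open>M\<close> alone and commute with all these operators. For exactness, a surjection from a Harish-Chandra module
  splits as a map of \<open>\<kk>\<close>-modules by semisimplicity (\<open>harish_chandra_section\<close>), and such a splitting,
  applied to the zeroth factor, lifts semi-invariants (\<open>F_map_short_exact\<close>).
\<close>

section \<open>Linear maps on subspaces\<close>

lemma linear_over_zero:
  assumes "vector_space s" "vector_space t" "module.subspace s U" "linear_over s t U h"
  shows "h 0 = 0"
  using linear_over_sum[OF assms, of "{}" "\<lambda>_. 0"] by simp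

lemma linear_over_compose:
  assumes "linear_over s t U g" "linear_over t r T h" "g \<in> U \<rightarrow> T"
  shows "linear_over s r U (\<lambda>u. h (g u))"
  using assms by (auto simp: linear_over_def Pi_iff)

lemma linear_over_cong:
  assumes "vector_space s" "module.subspace s U" "linear_over s t U g" "\<And>u. u \<in> U \<Longrightarrow> h u = g u"
  shows "linear_over s t U h"
proof -
  interpret s: vector_space s by fact
  show ?thesis using assms(3,4) s.subspace_add[OF assms(2)] s.subspace_scale[OF assms(2)]
    by (simp add: linear_over_def)
qed

lemma linear_over_subset: "linear_over t r B h \<Longrightarrow> A \<subseteq> B \<Longrightarrow> linear_over t r A h"
  unfolding linear_over_def by blast

section \<open>Categories of representations\<close>

lemma rep_cat_is_category:
  assumes s: "vector_space s"
    and sub: "\<And>M. M \<in> Obs \<Longrightarrow> module.subspace s (vecs M)"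
    and cl: "\<And>M g v. M \<in> Obs \<Longrightarrow> g \<in> G \<Longrightarrow> v \<in> vecs M \<Longrightarrow> act M g v \<in> vecs M"
  shows "is_category (rep_cat s G Obs)"
proof -
  interpret s: vector_space s by fact
  have idn: "(\<lambda>v\<in>vecs M. v) \<in> rep_hom s G M M" if M: "M \<in> Obs" for M
  proof -
    have "linear_over s s (vecs M) (\<lambda>v\<in>vecs M. v)"
      by (rule linear_over_cong[OF s sub[OF M], of _ "\<lambda>v. v"]) (auto simp: linear_over_def)
    then show ?thesis using cl[OF M] by (auto simp: rep_hom_def)
  qed
  have comp: "compose (vecs A) g f \<in> rep_hom s G A D"
    if A: "A \<in> Obs" and f: "f \<in> rep_hom s G A B" and g: "g \<in> rep_hom s G B D" for A B D f g
  proof -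
    have fB: "f v \<in> vecs B" if "v \<in> vecs A" for v using f that by (auto simp: rep_hom_def)
    have "linear_over s s (vecs A) (compose (vecs A) g f)"
    proof (rule linear_over_cong[OF s sub[OF A]])
      show "linear_over s s (vecs A) (\<lambda>v. g (f v))"
        by (rule linear_over_compose[of s s _ f s "vecs B"]) (use f g in \<open>auto simp: rep_hom_def\<close>)
    qed (simp add: compose_def)
    then show ?thesis using f g fB cl[OF A]
      by (auto simp: rep_hom_def compose_def)
  qed
  have "compose (vecs A) f (\<lambda>v\<in>vecs A. v) = f \<and> compose (vecs A) (\<lambda>v\<in>vecs B. v) f = f"
    if "f \<in> rep_hom s G A B" for A B f
    using that by (auto simp: rep_hom_def compose_def fun_eq_iff PiE_def extensional_def)
  moreover have "compose (vecs A) h (compose (vecs A) g f) = compose (vecs A) (compose (vecs B) h g) f"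
    if "f \<in> rep_hom s G A B" for A B f g h
    using that by (auto simp: rep_hom_def compose_def fun_eq_iff)
  ultimately show ?thesis using idn comp
    unfolding is_category_def rep_cat_def by (simp, blast)
qed

section \<open>Actions of the free algebra\<close>

lemma gen_in_free: "g \<in> G \<Longrightarrow> gen g \<in> carrier (free_algebra G)"
  by (simp add: free_algebra_def gen_def)

lemma scal_in_free: "scal c \<in> carrier (free_algebra G)"
  by (simp add: free_algebra_def scal_def zero_free_word_def)

lemma one_in_free: "1 \<in> carrier (free_algebra G)"
  by (simp add: free_algebra_def zero_free_word_def)

lemma add_in_free:
  "P \<in> carrier (free_algebra G) \<Longrightarrow> Q \<in> carrier (free_algebra G) \<Longrightarrow> P + Q \<in> carrier (free_algebra G)"
  using keys_add[of P Q] by (auto simp: free_algebra_def)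

lemma diff_in_free:
  "P \<in> carrier (free_algebra G) \<Longrightarrow> Q \<in> carrier (free_algebra G) \<Longrightarrow> P - Q \<in> carrier (free_algebra G)"
  using keys_diff[of P Q] by (auto simp: free_algebra_def)

lemma uminus_in_free: "P \<in> carrier (free_algebra G) \<Longrightarrow> - P \<in> carrier (free_algebra G)"
  by (simp add: free_algebra_def)

lemma mult_in_free:
  assumes "P \<in> carrier (free_algebra G)" "Q \<in> carrier (free_algebra G)"
  shows "P * Q \<in> carrier (free_algebra G)"
proof -
  have "set (letters w) \<subseteq> G" if "w \<in> Poly_Mapping.keys (P * Q)" for w
  proof -
    from that keys_mult[of P Q] obtain u v
      where "u \<in> Poly_Mapping.keys P" "v \<in> Poly_Mapping.keys Q" "w = u + v"
      by blast
    then show ?thesis using assms by (auto simp: free_algebra_def plus_free_word_def)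
  qed
  then show ?thesis by (simp add: free_algebra_def)
qed

lemma sum_in_free:
  assumes "\<And>a. a \<in> A \<Longrightarrow> h a \<in> carrier (free_algebra G)"
  shows "sum h A \<in> carrier (free_algebra G)"
  using assms
proof (induction A rule: infinite_finite_induct)
  case (insert x F)
  then show ?case by (simp add: add_in_free)
qed (simp_all add: free_algebra_def)

lemmas in_free = gen_in_free scal_in_free one_in_free add_in_free diff_in_free uminus_in_free
  mult_in_free sum_in_free

lemma free_algebra_simps [simp]:
  "a \<oplus>\<^bsub>free_algebra G\<^esub> b = a + b" "a \<otimes>\<^bsub>free_algebra G\<^esub> b = a * b"
  "\<zero>\<^bsub>free_algebra G\<^esub> = 0" "\<one>\<^bsub>free_algebra G\<^esub> = 1"
  by (simp_all add: free_algebra_def)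

lemma free_algebra_ring: "ring (free_algebra G)"
proof (rule ringI)
  have zero: "0 \<in> carrier (free_algebra G)" by (simp add: free_algebra_def)
  show "abelian_group (free_algebra G)"
  proof (rule abelian_groupI)
    fix x assume x: "x \<in> carrier (free_algebra G)"
    show "\<exists>y\<in>carrier (free_algebra G). y \<oplus>\<^bsub>free_algebra G\<^esub> x = \<zero>\<^bsub>free_algebra G\<^esub>"
      by (rule bexI[OF _ uminus_in_free[OF x]]) simp
  qed (simp_all add: zero add_in_free add.assoc add.commute)
  show "Group.monoid (free_algebra G)"
    by (rule Group.monoidI) (simp_all add: one_in_free mult_in_free mult.assoc)
qed (simp_all add: distrib_left distrib_right)

text \<open>
  Additive inverses in the ring record are defined by a description operator; ideals of
  \<open>free_algebra G\<close> speak about these, whereas the evaluation below speaks about \<open>-\<close>.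
\<close>

lemma free_algebra_minus:
  assumes "P \<in> carrier (free_algebra G)"
  shows "\<ominus>\<^bsub>free_algebra G\<^esub> P = - P"
proof -
  interpret ring "free_algebra G" by (rule free_algebra_ring)
  show ?thesis
    by (rule minus_equality) (simp_all add: assms uminus_in_free)
qed

lemma single_word_Cons: "Poly_Mapping.single (Word (g # gs)) c = gen g * Poly_Mapping.single (Word gs) c"
  by (simp add: gen_def mult_single plus_free_word_def)

text \<open>
  A polynomial is the sum of its terms, so additive properties need to be checked on multiples of
  words only; words are in turn built letter by letter with \<open>single_word_Cons\<close>.
\<close>

lemma free_algebra_induct [consumes 1, case_names single add]:
  assumes P: "P \<in> carrier (free_algebra G)"
    and single: "\<And>gs c. set gs \<subseteq> G \<Longrightarrow> Q (Poly_Mapping.single (Word gs) c)"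
    and add: "\<And>A B. A \<in> carrier (free_algebra G) \<Longrightarrow> B \<in> carrier (free_algebra G)
      \<Longrightarrow> Q A \<Longrightarrow> Q B \<Longrightarrow> Q (A + B)"
  shows "Q P"
proof -
  let ?t = "\<lambda>u. Poly_Mapping.single u (Poly_Mapping.lookup P u)"
  have sum: "P = (\<Sum>u\<in>Poly_Mapping.keys P. ?t u)"
    by (rule poly_mapping_eqI)
      (auto simp: lookup_sum lookup_single when_def sum.delta' in_keys_iff)
  have "K \<subseteq> Poly_Mapping.keys P \<Longrightarrow> (\<Sum>u\<in>K. ?t u) \<in> carrier (free_algebra G) \<and> Q (\<Sum>u\<in>K. ?t u)"
    if "finite K" for K using that
  proof (induction K rule: finite_induct)
    case empty
    show ?case using single[of "[]" 0] sum_in_free[of "{}"] by simp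
  next
    case (insert u K)
    have u: "set (letters u) \<subseteq> G" using insert P by (auto simp: free_algebra_def)
    have "?t u \<in> carrier (free_algebra G)" using u by (auto simp: free_algebra_def)
    moreover have "Q (?t u)" using single[OF u, of "Poly_Mapping.lookup P u"] by simp
    ultimately show ?case using insert by (simp add: add add_in_free)
  qed
  from this[OF finite_keys order_refl] have "Q (\<Sum>u\<in>Poly_Mapping.keys P. ?t u)" ..
  then show ?thesis by (simp only: sum[symmetric])
qed

text \<open>
  The universal property of the free algebra: each letter is replaced by an operator, and a word
  acts with its last letter first, so that concatenation becomes composition.
\<close>

definition evaluate ::
  "(complex \<Rightarrow> 'x::ab_group_add \<Rightarrow> 'x) \<Rightarrow> ('g \<Rightarrow> 'x \<Rightarrow> 'x) \<Rightarrow> 'g free_alg \<Rightarrow> 'x \<Rightarrow> 'x" where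
  "evaluate t op P f =
     (\<Sum>u\<in>Poly_Mapping.keys P. t (Poly_Mapping.lookup P u) (foldr op (letters u) f))"

text \<open>
  The operators are only controlled on the subspace \<open>F\<close>, which they have to preserve. Evaluation is
  then an action of \<open>free_algebra G\<close> on \<open>F\<close> by linear maps.
\<close>

locale operators =
  fixes t :: "complex \<Rightarrow> 'x::ab_group_add \<Rightarrow> 'x" and F :: "'x set"
    and G :: "'g set" and op :: "'g \<Rightarrow> 'x \<Rightarrow> 'x"
  assumes vector_space: "vector_space t"
    and subspace: "module.subspace t F"
    and op_linear: "g \<in> G \<Longrightarrow> linear_over t t F (op g)"
    and op_in: "g \<in> G \<Longrightarrow> f \<in> F \<Longrightarrow> op g f \<in> F"
begin

sublocale t: vector_space t by (rule vector_space)

lemma word_in: "set gs \<subseteq> G \<Longrightarrow> f \<in> F \<Longrightarrow> foldr op gs f \<in> F"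
  by (induction gs) (auto intro: op_in)

lemma word_linear: "set gs \<subseteq> G \<Longrightarrow> linear_over t t F (foldr op gs)"
proof (induction gs)
  case (Cons g gs)
  then show ?case
    using linear_over_compose[of t t F "foldr op gs" t F "op g"] word_in op_linear
    by (auto simp: o_def)
qed (simp add: linear_over_def id_def)

text \<open>
  The support of a sum of polynomials may be smaller than the union of the supports; summing over
  any finite superset of the support makes evaluation visibly additive.
\<close>

lemma evaluate_superset:
  assumes "finite K" "Poly_Mapping.keys P \<subseteq> K"
  shows "evaluate t op P f = (\<Sum>u\<in>K. t (Poly_Mapping.lookup P u) (foldr op (letters u) f))"
  unfolding evaluate_def using assms
  by (intro sum.mono_neutral_left) (auto simp: in_keys_iff)

lemma evaluate_add: "evaluate t op (P + Q) f = evaluate t op P f + evaluate t op Q f"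
  using evaluate_superset[of "Poly_Mapping.keys P \<union> Poly_Mapping.keys Q"] keys_add[of P Q]
  by (simp add: lookup_add t.scale_left_distrib sum.distrib)

lemma evaluate_uminus: "evaluate t op (- P) f = - evaluate t op P f"
  by (simp add: evaluate_def sum_negf)

lemma evaluate_diff: "evaluate t op (P - Q) f = evaluate t op P f - evaluate t op Q f"
  using evaluate_add[of P "- Q"] by (simp add: evaluate_uminus)

lemma evaluate_sum: "evaluate t op (sum h A) f = (\<Sum>a\<in>A. evaluate t op (h a) f)"
  by (induction A rule: infinite_finite_induct) (simp_all add: evaluate_add, simp_all add: evaluate_def)

lemma evaluate_single: "evaluate t op (Poly_Mapping.single u c) f = t c (foldr op (letters u) f)"
  by (simp add: evaluate_def)

lemma evaluate_scal [simp]: "evaluate t op (scal c) f = t c f"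
  by (simp add: scal_def evaluate_single zero_free_word_def)

lemma evaluate_one [simp]: "evaluate t op 1 f = f"
  using evaluate_scal[of 1 f] by (simp add: scal_def)

lemma evaluate_gen [simp]: "evaluate t op (gen g) f = op g f"
  by (simp add: gen_def evaluate_single)

lemma evaluate_in:
  assumes "P \<in> carrier (free_algebra G)" "f \<in> F"
  shows "evaluate t op P f \<in> F"
  unfolding evaluate_def using assms
  by (intro t.subspace_sum[OF subspace] t.subspace_scale[OF subspace] word_in)
    (auto simp: free_algebra_def)

lemma evaluate_linear:
  assumes "P \<in> carrier (free_algebra G)"
  shows "linear_over t t F (evaluate t op P)"
  using assms
proof (induction rule: free_algebra_induct)
  case (single gs c)
  then show ?case using word_linear[of gs]
    by (simp add: linear_over_def evaluate_single t.scale_right_distrib mult.commute)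
next
  case (add A B)
  then show ?case by (simp add: linear_over_def evaluate_add t.scale_right_distrib algebra_simps)
qed

lemma evaluate_mult:
  assumes "P \<in> carrier (free_algebra G)" "Q \<in> carrier (free_algebra G)" "f \<in> F"
  shows "evaluate t op (P * Q) f = evaluate t op P (evaluate t op Q f)"
  using assms(1)
proof (induction rule: free_algebra_induct)
  case (single gs c)
  from assms(2) show ?case
  proof (induction rule: free_algebra_induct)
    case (single hs d)
    then show ?case using word_linear[OF \<open>set gs \<subseteq> G\<close>] word_in[OF _ \<open>f \<in> F\<close>]
      by (simp add: mult_single evaluate_single plus_free_word_def linear_over_def)
  next
    case (add A B)
    then show ?case using word_linear[OF \<open>set gs \<subseteq> G\<close>] evaluate_in[OF _ \<open>f \<in> F\<close>]
      by (simp add: distrib_left evaluate_add evaluate_single linear_over_def t.scale_right_distrib)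
  qed
next
  case (add A B)
  then show ?case by (simp add: distrib_right evaluate_add)
qed

text \<open>
  A map that commutes with the letters commutes with all polynomials in them. It gives both the
  functoriality of the construction and, with \<open>\<phi>\<close> the identity, the fact that an action depends only on
  the action of the generators.
\<close>

lemma evaluate_intertwines:
  assumes P: "P \<in> carrier (free_algebra G)" and f: "f \<in> F"
    and \<phi>: "linear_over t t F \<phi>" "\<And>g f. g \<in> G \<Longrightarrow> f \<in> F \<Longrightarrow> \<phi> (op g f) = op' g (\<phi> f)"
  shows "\<phi> (evaluate t op P f) = evaluate t op' P (\<phi> f)"
proof -
  have word: "\<phi> (foldr op gs f) = foldr op' gs (\<phi> f)" if "set gs \<subseteq> G" for gs
    using that by (induction gs) (use \<phi>(2) word_in f in auto)
  have w: "set (letters u) \<subseteq> G" if "u \<in> Poly_Mapping.keys P" for u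
    using P that by (auto simp: free_algebra_def)
  have "\<phi> (evaluate t op P f)
      = (\<Sum>u\<in>Poly_Mapping.keys P. \<phi> (t (Poly_Mapping.lookup P u) (foldr op (letters u) f)))"
    unfolding evaluate_def
    by (rule linear_over_sum[OF vector_space vector_space subspace \<phi>(1)])
      (use w f in \<open>auto intro!: t.subspace_scale[OF subspace] word_in\<close>)
  also have "\<dots> = evaluate t op' P (\<phi> f)"
    unfolding evaluate_def using \<phi>(1) w f word word_in
    by (intro sum.cong refl) (simp add: linear_over_def)
  finally show ?thesis .
qed

text \<open>
  Since the annihilator is an ideal, an ideal acts by zero as soon as its generators do.
\<close>

lemma annihilator_ideal:
  "ideal {P \<in> carrier (free_algebra G). \<forall>f\<in>F. evaluate t op P f = 0} (free_algebra G)"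
  (is "ideal ?K _")
proof (rule idealI[OF free_algebra_ring])
  interpret ring "free_algebra G" by (rule free_algebra_ring)
  show "subgroup ?K (add_monoid (free_algebra G))"
  proof (rule add.subgroupI)
    have "0 \<in> ?K" using zero_closed by (simp add: evaluate_def)
    then show "?K \<noteq> {}" by blast
  qed (auto simp: evaluate_add evaluate_uminus free_algebra_minus in_free)
  have eval0: "evaluate t op P 0 = 0" if "P \<in> carrier (free_algebra G)" for P
    by (rule linear_over_zero[OF vector_space vector_space subspace evaluate_linear[OF that]])
  show "x \<otimes>\<^bsub>free_algebra G\<^esub> a \<in> ?K" if "a \<in> ?K" "x \<in> carrier (free_algebra G)" for a x
    using that by (simp add: evaluate_mult eval0 mult_in_free)
  show "a \<otimes>\<^bsub>free_algebra G\<^esub> x \<in> ?K" if "a \<in> ?K" "x \<in> carrier (free_algebra G)" for a x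
    using that by (simp add: evaluate_mult evaluate_in mult_in_free)
qed

end

section \<open>The Hecke algebra and its representations\<close>

lemma refl_S_in_weyl: "i \<in> {1..n} \<Longrightarrow> j \<in> {1..n} \<Longrightarrow> refl_S i j \<in> carrier (weyl n)"
  by (simp add: weyl_def refl_S_def permutes_swap_id)

lemma refl_gamma_in_weyl: "i \<in> {1..n} \<Longrightarrow> refl_gamma i \<in> carrier (weyl n)"
  by (simp add: weyl_def refl_gamma_def permutes_id)

lemma one_in_weyl: "\<one>\<^bsub>weyl n\<^esub> \<in> carrier (weyl n)"
  by (simp add: weyl_def permutes_id)

lemma mult_in_weyl:
  assumes "v \<in> carrier (weyl n)" "w \<in> carrier (weyl n)"
  shows "v \<otimes>\<^bsub>weyl n\<^esub> w \<in> carrier (weyl n)"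
proof -
  obtain \<sigma> A \<tau> B where vw: "v = (\<sigma>, A)" "w = (\<tau>, B)" by (cases v, cases w)
  with assms have *: "\<sigma> permutes {1..n}" "A \<subseteq> {1..n}" "\<tau> permutes {1..n}" "B \<subseteq> {1..n}"
    by (auto simp: weyl_def)
  then have "\<sigma> ` B \<subseteq> {1..n}" using permutes_image[OF *(1)] by blast
  then show ?thesis using * permutes_compose[OF *(3,1)] by (auto simp: vw weyl_def)
qed

text \<open>
  The elements \<open>refl_S i j\<close> and \<open>refl_gamma i\<close> generate the group: permutations are products of
  transpositions, and the sign set can be built up one element at a time.
\<close>

lemma weyl_induct [consumes 1, case_names one S gamma]:
  assumes w: "w \<in> carrier (weyl n)" and one: "P \<one>\<^bsub>weyl n\<^esub>"
    and S: "\<And>i j w. i \<in> {1..n} \<Longrightarrow> j \<in> {1..n} \<Longrightarrow> i \<noteq> j \<Longrightarrow> w \<in> carrier (weyl n) \<Longrightarrow> P w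
      \<Longrightarrow> P (refl_S i j \<otimes>\<^bsub>weyl n\<^esub> w)"
    and gamma: "\<And>i w. i \<in> {1..n} \<Longrightarrow> w \<in> carrier (weyl n) \<Longrightarrow> P w
      \<Longrightarrow> P (refl_gamma i \<otimes>\<^bsub>weyl n\<^esub> w)"
  shows "P w"
proof -
  obtain \<sigma> A where wA: "w = (\<sigma>, A)" by fastforce
  with w have \<sigma>: "\<sigma> permutes {1..n}" and A: "A \<subseteq> {1..n}" by (auto simp: weyl_def)
  have "P (\<sigma>, {})" using \<sigma> finite_atLeastAtMost
  proof (induction rule: permutes_induct)
    case id
    show ?case using one by (simp add: weyl_def id_def)
  next
    case (swap a b p)
    then have "(p, {}) \<in> carrier (weyl n)" by (simp add: weyl_def)
    then show ?case using S[OF swap.hyps(1-3) _ swap.IH] by (simp add: weyl_def refl_S_def comp_def)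
  qed
  have "finite A" using A finite_subset by blast
  then have "P (\<sigma>, A)" using A
  proof (induction A rule: finite_induct)
    case empty
    show ?case by fact
  next
    case (insert i A)
    then have "(\<sigma>, A) \<in> carrier (weyl n)" using \<sigma> by (simp add: weyl_def)
    moreover have "refl_gamma i \<otimes>\<^bsub>weyl n\<^esub> (\<sigma>, A) = (\<sigma>, insert i A)"
      using insert by (auto simp: weyl_def refl_gamma_def)
    ultimately show ?case using gamma[of i "(\<sigma>, A)"] insert by simp
  qed
  then show ?thesis by (simp add: wA)
qed

lemma W_in_free: "w \<in> carrier (weyl n) \<Longrightarrow> gen (W w) \<in> carrier (free_algebra (hecke_gens n))"
  by (intro gen_in_free) (simp add: hecke_gens_def)

lemma Y_in_free: "k \<in> {1..n} \<Longrightarrow> \<Y> k \<in> carrier (free_algebra (hecke_gens n))"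
  by (intro gen_in_free) (simp add: hecke_gens_def)

lemmas hecke_in_free = in_free(2-8) W_in_free Y_in_free refl_S_in_weyl refl_gamma_in_weyl
  one_in_weyl mult_in_weyl

lemma y_commutator_in_free:
  assumes "i \<in> {1..n}" "j \<in> {1..n}"
  shows "y_commutator n \<kappa>1 \<kappa>2 i j \<in> carrier (free_algebra (hecke_gens n))"
  unfolding y_commutator_def using assms by (intro hecke_in_free) auto

lemma hecke_relations_in_free:
  assumes "1 \<le> n"
  shows "hecke_relations n \<kappa>1 \<kappa>2 \<subseteq> carrier (free_algebra (hecke_gens n))"
proof
  fix P assume "P \<in> hecke_relations n \<kappa>1 \<kappa>2"
  then show "P \<in> carrier (free_algebra (hecke_gens n))"
    unfolding hecke_relations_def using assms
    by safe (intro hecke_in_free y_commutator_in_free; (simp; fail | assumption))+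
qed

lemma hecke_ideal_is_ideal:
  assumes "1 \<le> n"
  shows "ideal (hecke_ideal n \<kappa>1 \<kappa>2) (free_algebra (hecke_gens n))"
  unfolding hecke_ideal_def
  by (rule ring.genideal_ideal[OF free_algebra_ring hecke_relations_in_free[OF assms]])

lemma hecke_carrier:
  "carrier (hecke n \<kappa>1 \<kappa>2) = hecke_class n \<kappa>1 \<kappa>2 ` carrier (free_algebra (hecke_gens n))"
  by (auto simp: hecke_def FactRing_def A_RCOSETS_def' hecke_class_def)

lemma hecke_class_add:
  assumes n: "1 \<le> n" and P: "P \<in> carrier (free_algebra (hecke_gens n))"
    and Q: "Q \<in> carrier (free_algebra (hecke_gens n))"
  shows "hecke_class n \<kappa>1 \<kappa>2 P \<oplus>\<^bsub>hecke n \<kappa>1 \<kappa>2\<^esub> hecke_class n \<kappa>1 \<kappa>2 Q = hecke_class n \<kappa>1 \<kappa>2 (P + Q)"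
proof -
  interpret ideal "hecke_ideal n \<kappa>1 \<kappa>2" "free_algebra (hecke_gens n)"
    by (rule hecke_ideal_is_ideal[OF n])
  show ?thesis using a_rcos_sum[OF P Q] by (simp add: hecke_def FactRing_def hecke_class_def)
qed

lemma hecke_class_mult:
  assumes n: "1 \<le> n" and P: "P \<in> carrier (free_algebra (hecke_gens n))"
    and Q: "Q \<in> carrier (free_algebra (hecke_gens n))"
  shows "hecke_class n \<kappa>1 \<kappa>2 P \<otimes>\<^bsub>hecke n \<kappa>1 \<kappa>2\<^esub> hecke_class n \<kappa>1 \<kappa>2 Q = hecke_class n \<kappa>1 \<kappa>2 (P * Q)"
proof -
  interpret ideal "hecke_ideal n \<kappa>1 \<kappa>2" "free_algebra (hecke_gens n)"
    by (rule hecke_ideal_is_ideal[OF n])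
  show ?thesis using rcoset_mult_add[OF P Q] by (simp add: hecke_def FactRing_def hecke_class_def)
qed

lemma mem_hecke_class:
  "Q \<in> hecke_class n \<kappa>1 \<kappa>2 P \<longleftrightarrow> (\<exists>h\<in>hecke_ideal n \<kappa>1 \<kappa>2. Q = h + P)"
  by (auto simp: hecke_class_def a_r_coset_def')

text \<open>
  Congruent polynomials have the same class; this is how relations of the presentation turn into
  identities in the Hecke algebra.
\<close>

lemma hecke_class_eqI:
  assumes n: "1 \<le> n" and P: "P \<in> carrier (free_algebra (hecke_gens n))"
    and Q: "Q \<in> carrier (free_algebra (hecke_gens n))" and PQ: "P - Q \<in> hecke_ideal n \<kappa>1 \<kappa>2"
  shows "hecke_class n \<kappa>1 \<kappa>2 P = hecke_class n \<kappa>1 \<kappa>2 Q"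
proof -
  interpret ideal "hecke_ideal n \<kappa>1 \<kappa>2" "free_algebra (hecke_gens n)"
    by (rule hecke_ideal_is_ideal[OF n])
  have "P \<in> hecke_class n \<kappa>1 \<kappa>2 Q" unfolding mem_hecke_class using PQ by (intro bexI[of _ "P - Q"]) auto
  then show ?thesis unfolding hecke_class_def using a_repr_independence[OF _ Q a_subgroup] by simp
qed

text \<open>
  Operators on \<open>F\<close>, one for every generator, that satisfy the defining relations.
\<close>

locale hecke_operators =
  operators t F "hecke_gens n" op
  for t :: "complex \<Rightarrow> 'x::ab_group_add \<Rightarrow> 'x" and F :: "'x set" and n :: nat
    and op :: "hecke_gen \<Rightarrow> 'x \<Rightarrow> 'x" +
  fixes \<kappa>1 \<kappa>2 :: complex
  assumes n_pos: "1 \<le> n"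
    and relations: "P \<in> hecke_relations n \<kappa>1 \<kappa>2 \<Longrightarrow> f \<in> F \<Longrightarrow> evaluate t op P f = 0"
begin

text \<open>
  The annihilator of \<open>F\<close> is an ideal containing the relations, hence contains the ideal they generate.
\<close>

lemma evaluate_hecke_ideal:
  assumes P: "P \<in> hecke_ideal n \<kappa>1 \<kappa>2" and f: "f \<in> F"
  shows "evaluate t op P f = 0"
proof -
  have "hecke_ideal n \<kappa>1 \<kappa>2
      \<subseteq> {P \<in> carrier (free_algebra (hecke_gens n)). \<forall>f\<in>F. evaluate t op P f = 0}"
    unfolding hecke_ideal_def
    by (rule ring.genideal_minimal[OF free_algebra_ring annihilator_ideal])
      (use hecke_relations_in_free[OF n_pos] relations in blast)
  then show ?thesis using P f by blast
qed

text \<open>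
  An element of the Hecke algebra is a coset of polynomials; it acts through an arbitrary
  representative, and by \<open>evaluate_hecke_ideal\<close> the choice does not matter.
\<close>

definition action :: "(hecke_gen free_alg set, 'x) repn" where
  "action = \<lparr>vecs = F,
     act = (\<lambda>C\<in>carrier (hecke n \<kappa>1 \<kappa>2). \<lambda>f\<in>F. evaluate t op (SOME P. P \<in> C) f)\<rparr>"

lemma vecs_action [simp]: "vecs action = F"
  by (simp add: action_def)

lemma act_action:
  assumes P: "P \<in> carrier (free_algebra (hecke_gens n))" and f: "f \<in> F"
  shows "act action (hecke_class n \<kappa>1 \<kappa>2 P) f = evaluate t op P f"
proof -
  let ?C = "hecke_class n \<kappa>1 \<kappa>2 P"
  interpret ideal "hecke_ideal n \<kappa>1 \<kappa>2" "free_algebra (hecke_gens n)"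
    by (rule hecke_ideal_is_ideal[OF n_pos])
  have "0 \<in> hecke_ideal n \<kappa>1 \<kappa>2"
    using additive_subgroup.zero_closed[OF is_additive_subgroup] by simp
  then have "P \<in> ?C" unfolding mem_hecke_class by (intro bexI[of _ 0]) auto
  then have "(SOME Q. Q \<in> ?C) \<in> ?C" by (rule someI)
  then obtain h where h: "h \<in> hecke_ideal n \<kappa>1 \<kappa>2" "(SOME Q. Q \<in> ?C) = h + P"
    unfolding mem_hecke_class by blast
  have "act action ?C f = evaluate t op (SOME Q. Q \<in> ?C) f"
    using P f by (simp add: action_def hecke_carrier)
  also have "\<dots> = evaluate t op P f"
    by (simp only: h(2) evaluate_add evaluate_hecke_ideal[OF h(1) f] add_0)
  finally show ?thesis .
qed

lemma hecke_rep_action: "hecke_rep n \<kappa>1 \<kappa>2 t action"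
proof -
  let ?c = "hecke_class n \<kappa>1 \<kappa>2"
  have "act action (?c P) \<in> F \<rightarrow>\<^sub>E F" if P: "P \<in> carrier (free_algebra (hecke_gens n))" for P
  proof
    show "act action (?c P) f \<in> F" if "f \<in> F" for f
      using P that by (simp add: act_action evaluate_in)
    show "act action (?c P) f = undefined" if "f \<notin> F" for f
      using P that by (simp add: action_def hecke_carrier)
  qed
  moreover have "linear_over t t F (act action (?c P))"
    if "P \<in> carrier (free_algebra (hecke_gens n))" for P
    by (rule linear_over_cong[OF vector_space subspace evaluate_linear[OF that]])
      (simp add: act_action that)
  moreover have "act action C = undefined" if "C \<notin> carrier (hecke n \<kappa>1 \<kappa>2)" for C
    using that by (simp add: action_def)
  ultimately show ?thesis
    unfolding hecke_rep_def Let_def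
    by (auto simp: hecke_carrier hecke_class_add[OF n_pos] hecke_class_mult[OF n_pos] act_action
        subspace in_free evaluate_add evaluate_mult evaluate_in)
qed

end

lemma hecke_rep_gen_multiplicative:
  assumes n: "1 \<le> n" and R: "hecke_rep n \<kappa>1 \<kappa>2 t R" and v: "v \<in> carrier (weyl n)"
    and w: "w \<in> carrier (weyl n)" and f: "f \<in> vecs R"
  shows "act R (hecke_class n \<kappa>1 \<kappa>2 (gen (W (v \<otimes>\<^bsub>weyl n\<^esub> w)))) f
    = act R (hecke_class n \<kappa>1 \<kappa>2 (gen (W v))) (act R (hecke_class n \<kappa>1 \<kappa>2 (gen (W w))) f)"
proof -
  let ?c = "hecke_class n \<kappa>1 \<kappa>2"
  have "gen (W v) * gen (W w) - gen (W (v \<otimes>\<^bsub>weyl n\<^esub> w)) \<in> hecke_relations n \<kappa>1 \<kappa>2"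
    unfolding hecke_relations_def using v w by blast
  then have "gen (W v) * gen (W w) - gen (W (v \<otimes>\<^bsub>weyl n\<^esub> w)) \<in> hecke_ideal n \<kappa>1 \<kappa>2"
    unfolding hecke_ideal_def
    using ring.genideal_self[OF free_algebra_ring hecke_relations_in_free[OF n]] by blast
  then have "?c (gen (W (v \<otimes>\<^bsub>weyl n\<^esub> w))) = ?c (gen (W v) * gen (W w))"
    by (intro hecke_class_eqI[OF n, symmetric] hecke_in_free v w)
  also have "\<dots> = ?c (gen (W v)) \<otimes>\<^bsub>hecke n \<kappa>1 \<kappa>2\<^esub> ?c (gen (W w))"
    by (rule hecke_class_mult[OF n, symmetric]) (intro hecke_in_free v w)+
  finally show ?thesis
    using R v w f W_in_free[of v n] W_in_free[of w n] by (simp add: hecke_rep_def Let_def hecke_carrier)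
qed

lemma hecke_rep_one:
  assumes n: "1 \<le> n" and t: "vector_space t" and R: "hecke_rep n \<kappa>1 \<kappa>2 t R" and f: "f \<in> vecs R"
  shows "act R (hecke_class n \<kappa>1 \<kappa>2 (gen (W \<one>\<^bsub>weyl n\<^esub>))) f = f"
proof -
  interpret t: vector_space t by fact
  have "gen (W \<one>\<^bsub>weyl n\<^esub>) - 1 \<in> hecke_relations n \<kappa>1 \<kappa>2"
    unfolding hecke_relations_def by blast
  then have "gen (W \<one>\<^bsub>weyl n\<^esub>) - 1 \<in> hecke_ideal n \<kappa>1 \<kappa>2"
    unfolding hecke_ideal_def
    using ring.genideal_self[OF free_algebra_ring hecke_relations_in_free[OF n]] by blast
  then have "hecke_class n \<kappa>1 \<kappa>2 (gen (W \<one>\<^bsub>weyl n\<^esub>)) = hecke_class n \<kappa>1 \<kappa>2 (scal 1)"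
    by (subst hecke_class_eqI[OF n, of _ 1]) (auto intro!: hecke_in_free simp: scal_def)
  then show ?thesis using R f by (simp add: hecke_rep_def Let_def)
qed

lemma hecke_rep_operators:
  assumes t: "vector_space t" and R: "hecke_rep n \<kappa>1 \<kappa>2 t R"
  shows "operators t (vecs R) (hecke_gens n) (\<lambda>g. act R (hecke_class n \<kappa>1 \<kappa>2 (gen g)))"
proof -
  have c: "hecke_class n \<kappa>1 \<kappa>2 (gen g) \<in> carrier (hecke n \<kappa>1 \<kappa>2)" if "g \<in> hecke_gens n" for g
    using gen_in_free[OF that] by (simp add: hecke_carrier)
  show ?thesis
    using t R c unfolding operators_def hecke_rep_def Let_def PiE_iff by blast
qed

text \<open>
  Conversely, every representation of the Hecke algebra is obtained by evaluating polynomials at the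
  operators by which it lets the generators act.
\<close>

lemma hecke_rep_evaluate:
  assumes n: "1 \<le> n" and t: "vector_space t" and R: "hecke_rep n \<kappa>1 \<kappa>2 t R"
    and P: "P \<in> carrier (free_algebra (hecke_gens n))" and f: "f \<in> vecs R"
  shows "act R (hecke_class n \<kappa>1 \<kappa>2 P) f
    = evaluate t (\<lambda>g. act R (hecke_class n \<kappa>1 \<kappa>2 (gen g))) P f"
proof -
  note R' = R[unfolded hecke_rep_def Let_def hecke_carrier]
  let ?c = "hecke_class n \<kappa>1 \<kappa>2" and ?FA = "carrier (free_algebra (hecke_gens n))"
  interpret operators t "vecs R" "hecke_gens n" "\<lambda>g. act R (?c (gen g))"
    by (rule hecke_rep_operators) fact+
  from P show ?thesis
  proof (induction rule: free_algebra_induct)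
    case (single gs c)
    then show ?case
    proof (induction gs)
      case Nil
      show ?case using R' f by (simp add: evaluate_single flip: zero_free_word_def scal_def)
    next
      case (Cons g gs)
      have g: "gen g \<in> ?FA" using Cons by (intro gen_in_free) simp
      have gs: "Poly_Mapping.single (Word gs) c \<in> ?FA" using Cons by (auto simp: free_algebra_def)
      have "act R (?c (gen g * Poly_Mapping.single (Word gs) c)) f
          = act R (?c (gen g)) (act R (?c (Poly_Mapping.single (Word gs) c)) f)"
        unfolding hecke_class_mult[OF n g gs, symmetric] using R' g gs f by blast
      also have "\<dots> = evaluate t (\<lambda>g. act R (?c (gen g))) (gen g * Poly_Mapping.single (Word gs) c) f"
        using Cons f g gs by (simp add: evaluate_mult)
      finally show ?case by (simp add: single_word_Cons)
    qed
  next
    case (add A B)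
    have "act R (?c (A + B)) f = act R (?c A) f + act R (?c B) f"
      unfolding hecke_class_add[OF n add(1,2), symmetric] using R' add f by blast
    with add show ?case by (simp add: evaluate_add)
  qed
qed

text \<open>
  Representations are extensional, so they are equal as soon as their generators act in the same
  way; by \<open>weyl_induct\<close> the reflections account for the whole Weyl group. This is the uniqueness
  of the representation on the space of semi-invariants.
\<close>

lemma hecke_rep_eqI:
  fixes R R' :: "(hecke_gen free_alg set, 'x::ab_group_add) repn"
  assumes n: "1 \<le> n" and t: "vector_space t"
    and R: "hecke_rep n \<kappa>1 \<kappa>2 t R" and R': "hecke_rep n \<kappa>1 \<kappa>2 t R'" and vecs: "vecs R = vecs R'"
    and S: "\<And>i j f. i \<in> {1..n} \<Longrightarrow> j \<in> {1..n} \<Longrightarrow> i \<noteq> j \<Longrightarrow> f \<in> vecs R \<Longrightarrow>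
      act R (hecke_class n \<kappa>1 \<kappa>2 (\<S> i j)) f = act R' (hecke_class n \<kappa>1 \<kappa>2 (\<S> i j)) f"
    and G: "\<And>i f. i \<in> {1..n} \<Longrightarrow> f \<in> vecs R \<Longrightarrow>
      act R (hecke_class n \<kappa>1 \<kappa>2 (\<G> i)) f = act R' (hecke_class n \<kappa>1 \<kappa>2 (\<G> i)) f"
    and Y: "\<And>i f. i \<in> {1..n} \<Longrightarrow> f \<in> vecs R \<Longrightarrow>
      act R (hecke_class n \<kappa>1 \<kappa>2 (\<Y> i)) f = act R' (hecke_class n \<kappa>1 \<kappa>2 (\<Y> i)) f"
  shows "R = R'"
proof -
  let ?c = "hecke_class n \<kappa>1 \<kappa>2"
  have ext: "act R \<in> carrier (hecke n \<kappa>1 \<kappa>2) \<rightarrow>\<^sub>E (vecs R \<rightarrow>\<^sub>E vecs R)"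
    "act R' \<in> carrier (hecke n \<kappa>1 \<kappa>2) \<rightarrow>\<^sub>E (vecs R \<rightarrow>\<^sub>E vecs R)"
    using R R' vecs by (simp_all add: hecke_rep_def Let_def)
  have W: "act R (?c (gen (W w))) f = act R' (?c (gen (W w))) f"
    if w: "w \<in> carrier (weyl n)" and f: "f \<in> vecs R" for w f
    using w
  proof (induction rule: weyl_induct)
    case one
    show ?case using hecke_rep_one[OF n t R] hecke_rep_one[OF n t R'] f vecs by simp
  next
    case (S i j w)
    have "?c (gen (W w)) \<in> carrier (hecke n \<kappa>1 \<kappa>2)" using S W_in_free by (auto simp: hecke_carrier)
    then have "act R (?c (gen (W w))) f \<in> vecs R" using ext(1) f by blast
    with S show ?case
      using hecke_rep_gen_multiplicative[OF n R _ _ f] hecke_rep_gen_multiplicative[OF n R', of _ _ f]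
        f vecs assms(6) by (simp add: refl_S_in_weyl)
  next
    case (gamma i w)
    have "?c (gen (W w)) \<in> carrier (hecke n \<kappa>1 \<kappa>2)" using gamma W_in_free by (auto simp: hecke_carrier)
    then have "act R (?c (gen (W w))) f \<in> vecs R" using ext(1) f by blast
    with gamma show ?case
      using hecke_rep_gen_multiplicative[OF n R _ _ f] hecke_rep_gen_multiplicative[OF n R', of _ _ f]
        f vecs G by (simp add: refl_gamma_in_weyl)
  qed
  have gen: "act R (?c (gen g)) f = act R' (?c (gen g)) f" if "g \<in> hecke_gens n" "f \<in> vecs R" for g f
    using that W Y by (auto simp: hecke_gens_def)
  interpret operators t "vecs R" "hecke_gens n" "\<lambda>g. act R (?c (gen g))"
    by (rule hecke_rep_operators) fact+
  have "act R (?c P) f = act R' (?c P) f"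
    if P: "P \<in> carrier (free_algebra (hecke_gens n))" and f: "f \<in> vecs R" for P f
  proof -
    have "act R (?c P) f = evaluate t (\<lambda>g. act R (?c (gen g))) P f"
      by (rule hecke_rep_evaluate[OF n t R P f])
    also have "\<dots> = evaluate t (\<lambda>g. act R' (?c (gen g))) P f"
      using evaluate_intertwines[OF P f, of "\<lambda>f. f"] gen by (simp add: linear_over_def)
    also have "\<dots> = act R' (?c P) f"
      by (rule hecke_rep_evaluate[OF n t R' P, symmetric]) (use f vecs in simp)
    finally show ?thesis .
  qed
  then have "act R C = act R' C" if "C \<in> carrier (hecke n \<kappa>1 \<kappa>2)" for C
    using ext that by (intro PiE_ext[of "act R C" "vecs R" "\<lambda>_. vecs R"]) (auto simp: hecke_carrier)
  then have "act R = act R'"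
    by (intro PiE_ext[OF ext])
  with vecs show ?thesis by simp
qed

section \<open>Block matrices\<close>

lemma matrix_unit_carrier [simp]: "matrix_unit N i j \<in> carrier_mat N N"
  by (simp add: matrix_unit_def)

lemma matrix_unit_index:
  "a < N \<Longrightarrow> b < N \<Longrightarrow> matrix_unit N i j $$ (a, b) = (if a = i \<and> b = j then 1 else 0)"
  by (simp add: matrix_unit_def)

lemma matrix_unit_mult:
  assumes "j < N" "k < N"
  shows "matrix_unit N i j * matrix_unit N k l = (if j = k then matrix_unit N i l else 0\<^sub>m N N)"
proof (rule eq_matI)
  fix a b assume "a < dim_row (if j = k then matrix_unit N i l else 0\<^sub>m N N)"
    "b < dim_col (if j = k then matrix_unit N i l else 0\<^sub>m N N)"
  then have ab: "a < N" "b < N" by (auto simp: matrix_unit_def split: if_splits)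
  then have "(matrix_unit N i j * matrix_unit N k l) $$ (a, b)
      = (\<Sum>c<N. (if a = i \<and> c = j then 1 else 0) * (if c = k \<and> b = l then 1 else 0))"
    by (simp add: matrix_unit_def scalar_prod_def lessThan_atLeast0)
  also have "\<dots> = (\<Sum>c<N. if c = j then (if a = i \<and> j = k \<and> b = l then 1 else 0) else 0)"
    by (intro sum.cong) auto
  also have "\<dots> = (if a = i \<and> j = k \<and> b = l then 1 else 0)"
    using assms by simp
  finally show "(matrix_unit N i j * matrix_unit N k l) $$ (a, b)
      = (if j = k then matrix_unit N i l else 0\<^sub>m N N) $$ (a, b)"
    using ab by (simp add: matrix_unit_index)
qed (simp_all add: matrix_unit_def)

text \<open>
  The description by vanishing off-diagonal blocks is the one to which matrix entries can be fed.
\<close>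

lemma \<kk>_iff:
  "X \<in> \<kk> p q \<longleftrightarrow> X \<in> carrier_mat (p + q) (p + q) \<and>
     (\<forall>a<p + q. \<forall>b<p + q. (a < p) \<noteq> (b < p) \<longrightarrow> X $$ (a, b) = 0)"
  (is "?L \<longleftrightarrow> ?R")
proof
  assume ?L
  then obtain X1 X2 where "X1 \<in> carrier_mat p p" "X2 \<in> carrier_mat q q"
    "X = four_block_mat X1 (0\<^sub>m p q) (0\<^sub>m q p) X2"
    by (auto simp: \<kk>_def)
  then show ?R by auto
next
  assume R: ?R
  have "X = four_block_mat (mat p p (\<lambda>ij. X $$ ij)) (0\<^sub>m p q) (0\<^sub>m q p)
      (mat q q (\<lambda>(i, j). X $$ (i + p, j + p)))"
    by (rule eq_matI) (use R in \<open>auto simp: not_less\<close>)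
  then show ?L unfolding \<kk>_def by (intro CollectI exI conjI) (assumption, auto)
qed

lemma chi_altdef:
  assumes "X \<in> carrier_mat (p + q) (p + q)"
  shows "chi p q X = of_nat q * (\<Sum>i<p. X $$ (i, i)) - of_nat p * (\<Sum>i<q. X $$ (i + p, i + p))"
  using assms by (simp add: chi_def split_block_def Let_def tr_def)

lemma tr_altdef:
  assumes "X \<in> carrier_mat (p + q) (p + q)"
  shows "tr X = (\<Sum>i<p. X $$ (i, i)) + (\<Sum>i<q. X $$ (i + p, i + p))"
proof -
  have "(\<Sum>i<p + q. X $$ (i, i)) = (\<Sum>i<p. X $$ (i, i)) + (\<Sum>i\<in>{p..<p + q}. X $$ (i, i))"
    by (simp add: lessThan_atLeast0 sum.atLeastLessThan_concat)
  also have "(\<Sum>i\<in>{p..<p + q}. X $$ (i, i)) = (\<Sum>i<q. X $$ (i + p, i + p))"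
    using sum.shift_bounds_nat_ivl[of "\<lambda>i. X $$ (i, i)" 0 p q] by (simp add: lessThan_atLeast0 add.commute)
  finally show ?thesis using assms by (simp add: tr_def)
qed

lemma Jmat_index:
  "a < p + q \<Longrightarrow> b < p + q \<Longrightarrow> Jmat p q $$ (a, b) = (if a = b then if a < p then 1 else - 1 else 0)"
  by (auto simp: Jmat_def)

section \<open>The Weyl group on tensors\<close>

lemma sum_apply: "(\<Sum>a\<in>A. g a) x = (\<Sum>a\<in>A. g a x)" for g :: "_ \<Rightarrow> _ \<Rightarrow> 'a::ab_group_add"
  by (induction A rule: infinite_finite_induct) auto

text \<open>
  The diagonal entries of \<open>Jmat p q\<close>. Two indices lie in the same block if and only if their signs
  agree, so every condition on blocks becomes an identity between numbers \<open>1\<close> and \<open>-1\<close>.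
\<close>

definition Jsign :: "nat \<Rightarrow> nat \<Rightarrow> complex" where
  "Jsign p i = (if i < p then 1 else - 1)"

lemma Jsign_square [simp]: "Jsign p i * Jsign p i = 1"
  by (simp add: Jsign_def)

text \<open>
  The action of the whole group: the permutation rearranges the letters of the index word, and the
  sign set multiplies by the values of \<open>J\<close> on the letters at its places. No case distinction on
  \<open>ix n N\<close> is made, because \<open>w \<circ> \<sigma>\<close> lies in \<open>ix n N\<close> exactly when \<open>w\<close> does.
\<close>

definition weyl_op :: "nat \<Rightarrow> (complex \<Rightarrow> 'v \<Rightarrow> 'v) \<Rightarrow> weyl_elem \<Rightarrow> 'v tensor \<Rightarrow> 'v tensor" where
  "weyl_op p s = (\<lambda>(\<sigma>, A) f w. s (\<Prod>i\<in>A. Jsign p (w i)) (f (w \<circ> \<sigma>)))"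

lemma ix_permutes:
  assumes "\<sigma> permutes {1..n}"
  shows "w \<circ> \<sigma> \<in> ix n N \<longleftrightarrow> w \<in> ix n N"
proof -
  have *: "v \<circ> \<tau> \<in> ix n N" if v: "v \<in> ix n N" and \<tau>: "\<tau> permutes {1..n}" for v \<tau>
  proof -
    have "\<tau> i \<in> {1..n} \<longleftrightarrow> i \<in> {1..n}" for i by (rule permutes_in_image[OF \<tau>])
    moreover have "\<tau> i = i" if "i \<notin> {1..n}" for i using permutes_not_in[OF \<tau> that] .
    ultimately show ?thesis using v by (auto simp: ix_def PiE_def Pi_def extensional_def)
  qed
  show ?thesis
  proof
    assume "w \<circ> \<sigma> \<in> ix n N"
    from *[OF this permutes_inv[OF assms]] show "w \<in> ix n N"
      by (simp add: o_assoc[symmetric] permutes_inv_o[OF assms])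
  qed (rule *[OF _ assms])
qed

text \<open>
  The sign set of a product is the symmetric difference of \<open>A\<close> and \<open>\<sigma> ` B\<close>: a place that occurs in
  both contributes the square of a sign, which is \<open>1\<close>.
\<close>

lemma weyl_op_mult:
  assumes s: "vector_space s" and v: "v \<in> carrier (weyl n)" and w: "w \<in> carrier (weyl n)"
  shows "weyl_op p s (v \<otimes>\<^bsub>weyl n\<^esub> w) f = weyl_op p s v (weyl_op p s w f)"
proof
  interpret s: vector_space s by fact
  fix x :: "nat \<Rightarrow> nat"
  obtain \<sigma> A \<tau> B where vw: "v = (\<sigma>, A)" "w = (\<tau>, B)" by (cases v, cases w)
  with v w have *: "\<sigma> permutes {1..n}" "A \<subseteq> {1..n}" "B \<subseteq> {1..n}" by (auto simp: weyl_def)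
  then have fin: "finite A" "finite B" using finite_subset by blast+
  let ?h = "\<lambda>i. Jsign p (x i)"
  have "(\<Prod>i\<in>B. Jsign p ((x \<circ> \<sigma>) i)) = (\<Prod>i\<in>\<sigma> ` B. ?h i)"
    using permutes_inj_on[OF *(1)] by (subst prod.reindex) (auto simp: o_def)
  moreover have "(\<Prod>i\<in>A. ?h i) * (\<Prod>i\<in>C. ?h i) = (\<Prod>i\<in>(A - C) \<union> (C - A). ?h i)"
    if "finite C" for C
  proof -
    have "(\<Prod>i\<in>A. ?h i) * (\<Prod>i\<in>C. ?h i)
        = ((\<Prod>i\<in>A - C. ?h i) * (\<Prod>i\<in>A \<inter> C. ?h i)) * ((\<Prod>i\<in>C - A. ?h i) * (\<Prod>i\<in>A \<inter> C. ?h i))"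
      using fin that prod.Int_Diff[of A ?h C] prod.Int_Diff[of C ?h A] by (simp add: ac_simps Int_commute)
    also have "\<dots> = (\<Prod>i\<in>A - C. ?h i) * (\<Prod>i\<in>C - A. ?h i) * (\<Prod>i\<in>A \<inter> C. ?h i * ?h i)"
      by (simp add: prod.distrib ac_simps del: Jsign_square)
    also have "\<dots> = (\<Prod>i\<in>(A - C) \<union> (C - A). ?h i)"
      using fin that by (subst prod.union_disjoint) auto
    finally show ?thesis .
  qed
  ultimately show "weyl_op p s (v \<otimes>\<^bsub>weyl n\<^esub> w) f x = weyl_op p s v (weyl_op p s w f) x"
    using fin by (simp add: vw weyl_op_def weyl_def o_assoc)
qed

lemma weyl_op_one: "vector_space s \<Longrightarrow> weyl_op p s \<one>\<^bsub>weyl n\<^esub> f = f"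
  using vector_space.vector_space_assms(4) by (fastforce simp: weyl_op_def weyl_def)

lemma weyl_op_refl_S: "vector_space s \<Longrightarrow> weyl_op p s (refl_S i j) f = (\<lambda>w. f (w \<circ> transpose i j))"
  using vector_space.vector_space_assms(4) by (fastforce simp: weyl_op_def refl_S_def)

lemma weyl_op_refl_gamma: "weyl_op p s (refl_gamma i) f = (\<lambda>w. s (Jsign p (w i)) (f w))"
  by (simp add: weyl_op_def refl_gamma_def)

lemma swap_factors_weyl_op:
  assumes s: "vector_space s" and "i \<in> {1..n}" "j \<in> {1..n}" "f \<in> tensor_space n N U"
  shows "swap_factors n N i j f = weyl_op p s (refl_S i j) f"
  using assms ix_permutes[OF permutes_swap_id, of i n j _ N]
  by (auto simp: swap_factors_def weyl_op_refl_S tensor_space_def fun_eq_iff)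

lemma on_factor_Jmat:
  assumes s: "vector_space s" and i: "i \<in> {1..n}" and f: "f \<in> tensor_space n (p + q) U"
  shows "on_factor n (p + q) s i (Jmat p q) f = weyl_op p s (refl_gamma i) f"
proof
  interpret s: vector_space s by fact
  fix w
  show "on_factor n (p + q) s i (Jmat p q) f w = weyl_op p s (refl_gamma i) f w"
  proof (cases "w \<in> ix n (p + q)")
    case True
    have "(\<Sum>b<p + q. s (Jmat p q $$ (w i, b)) (f (w(i := b))))
        = (\<Sum>b<p + q. if b = w i then s (Jsign p (w i)) (f w) else 0)"
      using ix_lt[OF True i] by (intro sum.cong) (auto simp: Jmat_index Jsign_def)
    also have "\<dots> = s (Jsign p (w i)) (f w)" using ix_lt[OF True i] by simp
    finally show ?thesis using True by (simp add: on_factor_def weyl_op_refl_gamma)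
  next
    case False
    then show ?thesis using f by (simp add: on_factor_def weyl_op_refl_gamma tensor_space_def)
  qed
qed

section \<open>The operators \<open>y\<close> in coordinates\<close>

text \<open>
  Write \<open>e i j\<close> for the action of the matrix unit \<open>E\<^sub>i\<^sub>j\<close> on \<open>M\<close>. For an index \<open>j\<close>, \<open>same j\<close> and \<open>opp j\<close>
  are the block of \<open>j\<close> and the other block.
\<close>

locale gl_module_operators =
  fixes p q n :: nat and s :: "complex \<Rightarrow> 'v::ab_group_add \<Rightarrow> 'v" and M :: "(complex mat, 'v) repn"
  assumes vs: "vector_space s" and gl: "gl_module (p + q) s M"
begin

sublocale s: vector_space s by (rule vs)

abbreviation N :: nat where "N \<equiv> p + q"
abbreviation U :: "'v set" where "U \<equiv> vecs M"
abbreviation T :: "'v tensor set" where "T \<equiv> tensor_space n N U"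
abbreviation y :: "nat \<Rightarrow> 'v tensor \<Rightarrow> 'v tensor" where "y \<equiv> y_op n p q s M"

definition e :: "nat \<Rightarrow> nat \<Rightarrow> 'v \<Rightarrow> 'v" where "e i j = act M (matrix_unit N i j)"

definition opp :: "nat \<Rightarrow> nat set" where "opp j = {i. i < N \<and> (i < p) \<noteq> (j < p)}"
definition same :: "nat \<Rightarrow> nat set" where "same j = {i. i < N \<and> (i < p) = (j < p)}"

lemma finite_blocks [simp]: "finite (opp j)" "finite (same j)"
  by (simp_all add: opp_def same_def)

lemma subspace_U: "module.subspace s U"
  using gl by (simp add: gl_module_def)

lemma subspace_T: "module.subspace (tscale s) T"
  by (rule subspace_tensor_space[OF vs subspace_U])

lemma act_in: "X \<in> carrier_mat N N \<Longrightarrow> v \<in> U \<Longrightarrow> act M X v \<in> U"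
  using gl unfolding gl_module_def by blast

lemma act_linear: "X \<in> carrier_mat N N \<Longrightarrow> linear_over s s U (act M X)"
  using gl unfolding gl_module_def by blast

lemma act_add: "X \<in> carrier_mat N N \<Longrightarrow> Z \<in> carrier_mat N N \<Longrightarrow> v \<in> U \<Longrightarrow>
    act M (X + Z) v = act M X v + act M Z v"
  using gl unfolding gl_module_def by blast

lemma act_smult: "X \<in> carrier_mat N N \<Longrightarrow> v \<in> U \<Longrightarrow> act M (c \<cdot>\<^sub>m X) v = s c (act M X v)"
  using gl unfolding gl_module_def by blast

lemma act_bracket: "X \<in> carrier_mat N N \<Longrightarrow> Z \<in> carrier_mat N N \<Longrightarrow> v \<in> U \<Longrightarrow>
    act M (X * Z - Z * X) v = act M X (act M Z v) - act M Z (act M X v)"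
  using gl unfolding gl_module_def by blast

lemma act_zero: "v \<in> U \<Longrightarrow> act M (0\<^sub>m N N) v = 0"
  using act_smult[of "0\<^sub>m N N" v 0] by (simp add: smult_zero_mat)

lemma act_diff:
  assumes "X \<in> carrier_mat N N" "Z \<in> carrier_mat N N" "v \<in> U"
  shows "act M (X - Z) v = act M X v - act M Z v"
proof -
  have "X - Z = X + (- 1) \<cdot>\<^sub>m Z" using assms by (intro eq_matI) auto
  then show ?thesis using act_add[of X "(- 1) \<cdot>\<^sub>m Z" v] act_smult[of Z v "- 1"] assms by simp
qed

lemma e_in: "v \<in> U \<Longrightarrow> e i j v \<in> U"
  by (simp add: e_def act_in)

lemma e_linear: "linear_over s s U (e i j)"
  by (simp add: e_def act_linear)

lemma e_add: "u \<in> U \<Longrightarrow> v \<in> U \<Longrightarrow> e i j (u + v) = e i j u + e i j v"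
  and e_scale: "v \<in> U \<Longrightarrow> e i j (s c v) = s c (e i j v)"
  using e_linear by (simp_all add: linear_over_def)

lemma e_zero [simp]: "e i j 0 = 0"
  by (rule linear_over_zero[OF vs vs subspace_U e_linear])

lemma e_minus: "v \<in> U \<Longrightarrow> e i j (- v) = - e i j v"
  using e_scale[of v i j "- 1"] by simp

lemma e_sum: "finite A \<Longrightarrow> (\<And>a. a \<in> A \<Longrightarrow> g a \<in> U) \<Longrightarrow> e i j (sum g A) = (\<Sum>a\<in>A. e i j (g a))"
  by (rule linear_over_sum[OF vs vs subspace_U e_linear])

text \<open>
  The commutation rules, in the form in which every bracket below is computed.
\<close>

lemma e_bracket:
  assumes "i < N" "j < N" "k < N" "l < N" "v \<in> U"
  shows "e i j (e k l v) - e k l (e i j v)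
    = (if j = k then e i l v else 0) - (if l = i then e k j v else 0)"
  using act_bracket[of "matrix_unit N i j" "matrix_unit N k l" v] assms
  by (auto simp: e_def matrix_unit_mult act_diff act_zero)

text \<open>
  Matrices are not a type with addition, so a matrix is written as a combination of matrix units
  by adding one entry at a time.
\<close>

lemma act_expand:
  assumes X: "X \<in> carrier_mat N N" and v: "v \<in> U"
  shows "act M X v = (\<Sum>a<N. \<Sum>b<N. s (X $$ (a, b)) (e a b v))"
proof -
  have "act M (mat N N (\<lambda>ab. if ab \<in> D then X $$ ab else 0)) v
      = (\<Sum>(a, b)\<in>D. s (X $$ (a, b)) (e a b v))"
    if "finite D" "D \<subseteq> {..<N} \<times> {..<N}" for D
    using that
  proof (induction D rule: finite_induct)
    case empty
    have "mat N N (\<lambda>ab. if ab \<in> {} then X $$ ab else 0) = 0\<^sub>m N N" by (rule eq_matI) auto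
    then show ?case using v by (simp add: act_zero)
  next
    case (insert ab D)
    obtain a b where ab: "ab = (a, b)" by fastforce
    have "mat N N (\<lambda>ab'. if ab' \<in> insert ab D then X $$ ab' else 0)
        = mat N N (\<lambda>ab. if ab \<in> D then X $$ ab else 0) + (X $$ ab) \<cdot>\<^sub>m matrix_unit N a b"
      using insert.hyps by (intro eq_matI) (auto simp: ab matrix_unit_index matrix_unit_def)
    then show ?case using insert v
      by (simp add: act_add act_smult ab e_def add.commute)
  qed
  from this[of "{..<N} \<times> {..<N}"]
  have "act M (mat N N (\<lambda>ab. if ab \<in> {..<N} \<times> {..<N} then X $$ ab else 0)) v
      = (\<Sum>a<N. \<Sum>b<N. s (X $$ (a, b)) (e a b v))"
    by (simp add: sum.cartesian_product)
  moreover have "mat N N (\<lambda>ab. if ab \<in> {..<N} \<times> {..<N} then X $$ ab else 0) = X"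
    using X by (intro eq_matI) auto
  ultimately show ?thesis by simp
qed

lemma T_in: "f \<in> T \<Longrightarrow> w \<in> ix n N \<Longrightarrow> f w \<in> U"
  and T_out: "f \<in> T \<Longrightarrow> w \<notin> ix n N \<Longrightarrow> f w = 0"
  by (auto simp: tensor_space_def)

lemma T_in_U: "f \<in> T \<Longrightarrow> f w \<in> U"
  using T_in T_out s.subspace_0[OF subspace_U] by metis

lemma y_out: "f \<in> T \<Longrightarrow> w \<notin> ix n N \<Longrightarrow> y k f w = 0"
  unfolding y_op_def by (simp add: sum_apply on_zeroth_def on_factor_def case_prod_unfold flip: e_def)

text \<open>
  In coordinates, \<open>(E\<^sub>j\<^sub>i)\<^sub>k\<close> only sees the words whose \<open>k\<close>-th letter is \<open>j\<close>, and reads the coefficient of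
  the word in which this letter has been replaced by \<open>i\<close>. All relations are proved from this
  formula, word by word.
\<close>

lemma y_eq:
  assumes f: "f \<in> T" and w: "w \<in> ix n N" and k: "k \<in> {1..n}"
  shows "y k f w = - (\<Sum>i\<in>opp (w k). e i (w k) (f (w(k := i))))"
proof -
  let ?P = "{(i, j). i < N \<and> j < N \<and> (i < p) \<noteq> (j < p)}"
  have wk: "w k < N" by (rule ix_lt[OF w k])
  have fac: "on_factor n N s k (matrix_unit N j i) f w = (if j = w k then f (w(k := i)) else 0)"
    if "i < N" "j < N" for i j
  proof -
    have "(\<Sum>b<N. s (matrix_unit N j i $$ (w k, b)) (f (w(k := b))))
        = (\<Sum>b<N. if b = i then (if j = w k then f (w(k := i)) else 0) else 0)"
      by (intro sum.cong refl) (use wk in \<open>auto simp: matrix_unit_index\<close>)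
    also have "\<dots> = (if j = w k then f (w(k := i)) else 0)" using that by simp
    finally show ?thesis using w by (simp only: on_factor_def if_True)
  qed
  have "y k f w = - (\<Sum>(i, j)\<in>?P. e i j (on_factor n N s k (matrix_unit N j i) f w))"
    unfolding y_op_def by (simp add: sum_apply on_zeroth_def case_prod_unfold flip: e_def)
  also have "(\<Sum>(i, j)\<in>?P. e i j (on_factor n N s k (matrix_unit N j i) f w))
      = (\<Sum>(i, j)\<in>?P. if j = w k then e i j (f (w(k := i))) else 0)"
    by (intro sum.cong refl) (auto simp: fac split: if_splits)
  also have "\<dots> = (\<Sum>(i, j)\<in>opp (w k) \<times> {w k}. e i j (f (w(k := i))))"
    by (rule sum.mono_neutral_cong_right[OF finite_subset[of ?P "{..<N} \<times> {..<N}"]])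
      (use wk in \<open>auto simp: opp_def split: if_splits\<close>)
  also have "\<dots> = (\<Sum>i\<in>opp (w k). e i (w k) (f (w(k := i))))"
    by (simp add: sum.cartesian_product[symmetric])
  finally show ?thesis .
qed

lemma y_in_T: assumes "f \<in> T" "k \<in> {1..n}" shows "y k f \<in> T"
proof -
  have "y k f w \<in> U" if "w \<in> ix n N" for w
    unfolding y_eq[OF assms(1) that assms(2)]
    by (intro s.subspace_neg[OF subspace_U] s.subspace_sum[OF subspace_U] e_in T_in_U[OF assms(1)])
  then show ?thesis using y_out[OF assms(1)] by (simp add: tensor_space_def)
qed

lemma y_linear:
  assumes k: "k \<in> {1..n}"
  shows "linear_over (tscale s) (tscale s) T (y k)"
proof -
  interpret ts: vector_space "tscale s" using vs by (rule vector_space_tscale)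
  have "y k (f + g) w = y k f w + y k g w" if fg: "f \<in> T" "g \<in> T" for f g w
  proof (cases "w \<in> ix n N")
    case True
    show ?thesis unfolding y_eq[OF fg(1) True k] y_eq[OF fg(2) True k]
        y_eq[OF ts.subspace_add[OF subspace_T fg] True k]
      using T_in_U[OF fg(1)] T_in_U[OF fg(2)] by (simp add: e_add sum.distrib)
  qed (use y_out fg ts.subspace_add[OF subspace_T fg] in simp)
  moreover have "y k (tscale s c f) w = s c (y k f w)" if f: "f \<in> T" for c f w
  proof (cases "w \<in> ix n N")
    case True
    show ?thesis unfolding y_eq[OF f True k] y_eq[OF ts.subspace_scale[OF subspace_T f] True k]
      using T_in_U[OF f] by (simp add: e_scale tscale_def s.scale_sum_right)
  qed (use y_out f ts.subspace_scale[OF subspace_T f] in simp)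
  ultimately show ?thesis by (auto simp: linear_over_def tscale_def fun_eq_iff)
qed

lemma weyl_op_out:
  assumes "w \<in> carrier (weyl n)" "f \<in> T" "x \<notin> ix n N"
  shows "weyl_op p s w f x = 0"
proof -
  obtain \<sigma> A where w: "w = (\<sigma>, A)" by fastforce
  with assms have "x \<circ> \<sigma> \<notin> ix n N" using ix_permutes[of \<sigma> n x N] by (auto simp: weyl_def)
  then show ?thesis using T_out assms by (simp add: weyl_op_def w)
qed

lemma weyl_op_in_T:
  assumes w: "w \<in> carrier (weyl n)" and f: "f \<in> T"
  shows "weyl_op p s w f \<in> T"
proof -
  have "weyl_op p s w f x \<in> U" for x
    unfolding weyl_op_def case_prod_unfold by (rule s.subspace_scale[OF subspace_U T_in_U[OF f]])
  then show ?thesis using weyl_op_out[OF w f] by (simp add: tensor_space_def)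
qed

lemma weyl_op_linear: "linear_over (tscale s) (tscale s) T (weyl_op p s w)"
  by (auto simp: linear_over_def weyl_op_def tscale_def fun_eq_iff s.scale_right_distrib
      mult.commute split: prod.splits)

lemma upd_permute:
  assumes "\<sigma> permutes {1..n}"
  shows "(w(\<sigma> k := b)) \<circ> \<sigma> = (w \<circ> \<sigma>)(k := b)"
  using permutes_inj[OF assms] by (auto simp: fun_eq_iff inj_def)

lemma prod_Jsign_upd:
  assumes "finite A"
  shows "(\<Prod>i\<in>A. Jsign p ((w(k := b)) i))
    = (if k \<in> A then Jsign p b * Jsign p (w k) else 1) * (\<Prod>i\<in>A. Jsign p (w i))"
proof (cases "k \<in> A")
  case True
  have "(\<Prod>i\<in>A - {k}. Jsign p ((w(k := b)) i)) = (\<Prod>i\<in>A - {k}. Jsign p (w i))"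
    by (intro prod.cong) auto
  then have "(\<Prod>i\<in>A. Jsign p ((w(k := b)) i)) = Jsign p b * (\<Prod>i\<in>A - {k}. Jsign p (w i))"
    by (subst prod.remove[OF assms True]) simp
  moreover have "(\<Prod>i\<in>A. Jsign p (w i)) = Jsign p (w k) * (\<Prod>i\<in>A - {k}. Jsign p (w i))"
    by (rule prod.remove[OF assms True])
  ultimately show ?thesis using True by (simp add: Jsign_def)
next
  case False
  then show ?thesis by (auto intro!: prod.cong)
qed

lemma Jsign_opp: "i \<in> opp j \<Longrightarrow> Jsign p i = - Jsign p j"
  by (auto simp: opp_def Jsign_def)

text \<open>
  Both sides read off the same coefficients. The letter at place \<open>\<sigma> k\<close> moves to the other block under
  \<open>y\<close>, so its sign is reversed; this is seen by the sign set exactly if \<open>\<sigma> k \<in> A\<close>. All relations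
  between the \<open>y\<close> and the Weyl group are special cases.
\<close>

lemma y_weyl_op:
  assumes \<sigma>: "\<sigma> permutes {1..n}" and A: "A \<subseteq> {1..n}" and f: "f \<in> T" and k: "k \<in> {1..n}"
  shows "y (\<sigma> k) (weyl_op p s (\<sigma>, A) f)
    = tscale s (if \<sigma> k \<in> A then - 1 else 1) (weyl_op p s (\<sigma>, A) (y k f))"
proof
  fix w
  have \<sigma>A: "(\<sigma>, A) \<in> carrier (weyl n)" using \<sigma> A by (simp add: weyl_def)
  have \<sigma>k: "\<sigma> k \<in> {1..n}" using \<sigma> k by (simp only: permutes_in_image)
  have fin: "finite A" using A finite_subset by blast
  show "y (\<sigma> k) (weyl_op p s (\<sigma>, A) f) w
    = tscale s (if \<sigma> k \<in> A then - 1 else 1) (weyl_op p s (\<sigma>, A) (y k f)) w"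
  proof (cases "w \<in> ix n N")
    case True
    then have w\<sigma>: "w \<circ> \<sigma> \<in> ix n N" using \<sigma> by (simp add: ix_permutes)
    let ?P = "\<Prod>i\<in>A. Jsign p (w i)" and ?c = "if \<sigma> k \<in> A then - 1 else 1 :: complex"
    have "y (\<sigma> k) (weyl_op p s (\<sigma>, A) f) w
        = - (\<Sum>i\<in>opp (w (\<sigma> k)). e i (w (\<sigma> k)) (weyl_op p s (\<sigma>, A) f (w(\<sigma> k := i))))"
      by (rule y_eq[OF weyl_op_in_T[OF \<sigma>A f] True \<sigma>k])
    also have "(\<Sum>i\<in>opp (w (\<sigma> k)). e i (w (\<sigma> k)) (weyl_op p s (\<sigma>, A) f (w(\<sigma> k := i))))
        = (\<Sum>i\<in>opp (w (\<sigma> k)). s (?c * ?P) (e i (w (\<sigma> k)) (f ((w \<circ> \<sigma>)(k := i)))))"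
    proof (intro sum.cong refl)
      fix i assume i: "i \<in> opp (w (\<sigma> k))"
      have "weyl_op p s (\<sigma>, A) f (w(\<sigma> k := i)) = s (?c * ?P) (f ((w \<circ> \<sigma>)(k := i)))"
        unfolding weyl_op_def prod.case upd_permute[OF \<sigma>] prod_Jsign_upd[OF fin] Jsign_opp[OF i]
        by simp
      then show "e i (w (\<sigma> k)) (weyl_op p s (\<sigma>, A) f (w(\<sigma> k := i)))
          = s (?c * ?P) (e i (w (\<sigma> k)) (f ((w \<circ> \<sigma>)(k := i))))"
        using T_in_U[OF f] by (simp only: e_scale)
    qed
    also have "- \<dots> = tscale s ?c (weyl_op p s (\<sigma>, A) (y k f)) w"
      using y_eq[OF f w\<sigma> k] by (simp add: weyl_op_def tscale_def s.scale_sum_right)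
    finally show ?thesis .
  next
    case False
    then show ?thesis
      using y_out[OF weyl_op_in_T[OF \<sigma>A f] False] weyl_op_out[OF \<sigma>A y_in_T[OF f k] False]
      by (simp add: tscale_def)
  qed
qed

section \<open>Semi-invariants of \<open>\<kk>0\<close>\<close>

abbreviation F :: "complex \<Rightarrow> 'v tensor set" where "F \<mu> \<equiv> F_space n p q \<mu> s M"

lemma act_zero_vec: "X \<in> carrier_mat N N \<Longrightarrow> act M X 0 = 0"
  by (rule linear_over_zero[OF vs vs subspace_U act_linear])

lemma act_plus: "X \<in> carrier_mat N N \<Longrightarrow> u \<in> U \<Longrightarrow> v \<in> U \<Longrightarrow> act M X (u + v) = act M X u + act M X v"
  and act_scale: "X \<in> carrier_mat N N \<Longrightarrow> v \<in> U \<Longrightarrow> act M X (s c v) = s c (act M X v)"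
  using act_linear by (simp_all add: linear_over_def)

lemma act_minus: "X \<in> carrier_mat N N \<Longrightarrow> v \<in> U \<Longrightarrow> act M X (- v) = - act M X v"
  using act_scale[of X v "- 1"] by simp

lemma act_sum: "X \<in> carrier_mat N N \<Longrightarrow> finite A \<Longrightarrow> (\<And>a. a \<in> A \<Longrightarrow> g a \<in> U) \<Longrightarrow>
    act M X (sum g A) = (\<Sum>a\<in>A. act M X (g a))"
  by (rule linear_over_sum[OF vs vs subspace_U act_linear])

lemma tensor_act_out: "X \<in> carrier_mat N N \<Longrightarrow> f \<in> T \<Longrightarrow> w \<notin> ix n N \<Longrightarrow> tensor_act n N s M X f w = 0"
  by (simp add: tensor_act_def on_zeroth_def on_factor_def sum_apply T_out act_zero_vec)

lemma tensor_act_eq: "w \<in> ix n N \<Longrightarrow> tensor_act n N s M X f w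
    = act M X (f w) + (\<Sum>k\<in>{1..n}. \<Sum>b<N. s (X $$ (w k, b)) (f (w(k := b))))"
  by (simp add: tensor_act_def on_zeroth_def on_factor_def sum_apply)

lemma tensor_act_in_T:
  assumes X: "X \<in> carrier_mat N N" and f: "f \<in> T"
  shows "tensor_act n N s M X f \<in> T"
proof -
  have "tensor_act n N s M X f w \<in> U" if "w \<in> ix n N" for w
    unfolding tensor_act_eq[OF that]
    by (intro s.subspace_add[OF subspace_U] act_in[OF X] s.subspace_sum[OF subspace_U]
        s.subspace_scale[OF subspace_U] T_in_U[OF f])
  then show ?thesis using tensor_act_out[OF X f] by (simp add: tensor_space_def)
qed

lemma tensor_act_add:
  assumes X: "X \<in> carrier_mat N N" and f: "f \<in> T" and g: "g \<in> T"
  shows "tensor_act n N s M X (f + g) = tensor_act n N s M X f + tensor_act n N s M X g"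
proof
  fix w
  note U = T_in_U[OF f] T_in_U[OF g]
  show "tensor_act n N s M X (f + g) w = (tensor_act n N s M X f + tensor_act n N s M X g) w"
  proof (cases "w \<in> ix n N")
    case True
    then show ?thesis using U X by (simp add: tensor_act_eq act_plus s.scale_right_distrib sum.distrib)
  next
    case False
    then show ?thesis using U X f g
      by (simp add: tensor_act_def on_zeroth_def on_factor_def sum_apply T_out act_zero_vec)
  qed
qed

lemma tensor_act_scale:
  assumes X: "X \<in> carrier_mat N N" and f: "f \<in> T"
  shows "tensor_act n N s M X (tscale s c f) = tscale s c (tensor_act n N s M X f)"
proof
  fix w
  show "tensor_act n N s M X (tscale s c f) w = tscale s c (tensor_act n N s M X f) w"
  proof (cases "w \<in> ix n N")
    case True
    then show ?thesis using T_in_U[OF f] X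
      by (simp add: tensor_act_eq act_scale tscale_def s.scale_right_distrib s.scale_sum_right mult.commute)
  next
    case False
    then show ?thesis using X f
      by (simp add: tensor_act_def on_zeroth_def on_factor_def sum_apply T_out act_zero_vec tscale_def)
  qed
qed

lemma \<kk>0_carrier: "X \<in> \<kk>0 p q \<Longrightarrow> X \<in> carrier_mat N N"
  by (simp add: \<kk>0_def \<kk>_iff)

lemma F_in_T: "f \<in> F \<mu> \<Longrightarrow> f \<in> T"
  by (simp add: F_space_def)

lemma F_invariant: "f \<in> F \<mu> \<Longrightarrow> X \<in> \<kk>0 p q \<Longrightarrow> tensor_act n N s M X f = tscale s (\<mu> * chi p q X) f"
  by (simp add: F_space_def)

lemma subspace_F: "module.subspace (tscale s) (F \<mu>)"
proof -
  interpret ts: vector_space "tscale s" using vs by (rule vector_space_tscale)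
  have "0 \<in> F \<mu>"
  proof -
    have 0: "0 \<in> T" by (rule ts.subspace_0[OF subspace_T])
    show ?thesis using tensor_act_scale[OF \<kk>0_carrier 0, of _ 0] 0 by (simp add: F_space_def)
  qed
  then show ?thesis
    using ts.subspace_add[OF subspace_T] ts.subspace_scale[OF subspace_T]
    unfolding ts.subspace_def F_space_def
    by (simp add: tensor_act_add tensor_act_scale \<kk>0_carrier ts.scale_right_distrib mult.commute)
qed

lemma weyl_op_scale: "weyl_op p s w (tscale s c f) = tscale s c (weyl_op p s w f)"
  by (simp add: weyl_op_def tscale_def case_prod_unfold mult.commute)

text \<open>
  A block diagonal matrix never changes the block of a letter, so the signs stay the same, and the
  sum over all places is invariant under permutations of the places.
\<close>

lemma tensor_act_weyl_op:
  assumes X: "X \<in> \<kk> p q" and v: "v \<in> carrier (weyl n)" and f: "f \<in> T"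
  shows "tensor_act n N s M X (weyl_op p s v f) = weyl_op p s v (tensor_act n N s M X f)"
proof
  fix w
  have Xc: "X \<in> carrier_mat N N" using X by (simp add: \<kk>_iff)
  obtain \<sigma> A where vA: "v = (\<sigma>, A)" by fastforce
  with v have \<sigma>: "\<sigma> permutes {1..n}" and A: "A \<subseteq> {1..n}" by (auto simp: weyl_def)
  have fin: "finite A" using A finite_subset by blast
  show "tensor_act n N s M X (weyl_op p s v f) w = weyl_op p s v (tensor_act n N s M X f) w"
  proof (cases "w \<in> ix n N")
    case True
    then have w\<sigma>: "w \<circ> \<sigma> \<in> ix n N" using \<sigma> by (simp add: ix_permutes)
    let ?P = "\<Prod>i\<in>A. Jsign p (w i)"
    have "(\<Sum>k\<in>{1..n}. \<Sum>b<N. s (X $$ (w k, b)) (weyl_op p s v f (w(k := b))))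
        = (\<Sum>k\<in>{1..n}. \<Sum>b<N. s (X $$ (w (\<sigma> k), b)) (weyl_op p s v f (w(\<sigma> k := b))))"
      using sum.permute[OF \<sigma>, of "\<lambda>k. \<Sum>b<N. s (X $$ (w k, b)) (weyl_op p s v f (w(k := b)))"]
      by (simp only: o_def)
    also have "\<dots> = (\<Sum>k\<in>{1..n}. \<Sum>b<N. s ?P (s (X $$ (w (\<sigma> k), b)) (f ((w \<circ> \<sigma>)(k := b)))))"
    proof (intro sum.cong refl)
      fix k b assume k: "k \<in> {1..n}" and b: "b \<in> {..<N}"
      have "\<sigma> k \<in> {1..n}" using \<sigma> k by (simp only: permutes_in_image)
      then have wk: "w (\<sigma> k) < N" by (rule ix_lt[OF True])
      have "X $$ (w (\<sigma> k), b) = 0 \<or> Jsign p b * Jsign p (w (\<sigma> k)) = 1"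
        using X wk b by (auto simp: \<kk>_iff Jsign_def)
      then show "s (X $$ (w (\<sigma> k), b)) (weyl_op p s v f (w(\<sigma> k := b)))
          = s ?P (s (X $$ (w (\<sigma> k), b)) (f ((w \<circ> \<sigma>)(k := b))))"
        unfolding vA weyl_op_def prod.case upd_permute[OF \<sigma>] prod_Jsign_upd[OF fin]
        by (auto simp: mult.commute)
    qed
    finally show ?thesis
      using T_in_U[OF f] Xc
      by (simp add: tensor_act_eq[OF True]) (simp add: vA weyl_op_def tensor_act_eq[OF w\<sigma>]
        act_scale s.scale_right_distrib s.scale_sum_right)
  next
    case False
    then show ?thesis
      using tensor_act_out[OF Xc weyl_op_in_T[OF v f] False]
        weyl_op_out[OF v tensor_act_in_T[OF Xc f] False] by simp
  qed
qed

lemma weyl_op_in_F: "v \<in> carrier (weyl n) \<Longrightarrow> f \<in> F \<mu> \<Longrightarrow> weyl_op p s v f \<in> F \<mu>"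
  using tensor_act_weyl_op[of _ v f] weyl_op_in_T[of v f]
  by (simp add: F_space_def \<kk>0_def weyl_op_scale)

lemma opp_eq: "X \<in> \<kk> p q \<Longrightarrow> a < N \<Longrightarrow> b < N \<Longrightarrow> X $$ (a, b) \<noteq> 0 \<Longrightarrow> opp a = opp b"
  by (auto simp: \<kk>_iff opp_def)

lemma act_e_commutator:
  assumes X: "X \<in> carrier_mat N N" and v: "v \<in> U" and ij: "i < N" "j < N"
  shows "act M X (e i j v) = e i j (act M X v)
    + (\<Sum>a<N. s (X $$ (a, i)) (e a j v)) - (\<Sum>b<N. s (X $$ (j, b)) (e i b v))"
proof -
  have "act M X (e i j v) - e i j (act M X v)
      = (\<Sum>a<N. \<Sum>b<N. s (X $$ (a, b)) (e a b (e i j v) - e i j (e a b v)))"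
    using e_in[OF v]
    by (simp add: act_expand[OF X] v e_sum s.subspace_sum[OF subspace_U] s.subspace_scale[OF subspace_U]
        e_scale s.scale_right_diff_distrib sum_subtractf)
  also have "\<dots> = (\<Sum>a<N. \<Sum>b<N. (if b = i then s (X $$ (a, b)) (e a j v) else 0)
      - (if a = j then s (X $$ (a, b)) (e i b v) else 0))"
    using ij v by (intro sum.cong refl) (auto simp: e_bracket s.scale_right_diff_distrib)
  also have "\<dots> = (\<Sum>a<N. s (X $$ (a, i)) (e a j v)) - (\<Sum>b<N. s (X $$ (j, b)) (e i b v))"
  proof -
    have "(\<Sum>a<N. \<Sum>b<N. if a = j then s (X $$ (a, b)) (e i b v) else 0)
        = (\<Sum>b<N. \<Sum>a<N. if a = j then s (X $$ (a, b)) (e i b v) else 0)"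
      by (rule sum.swap)
    then show ?thesis using ij by (simp add: sum_subtractf)
  qed
  finally show ?thesis by (simp add: algebra_simps)
qed

text \<open>
  The element \<open>\<Sum> E\<^sub>i\<^sub>j \<otimes> E\<^sub>j\<^sub>i\<close>, summed over pairs in different blocks, is invariant under \<open>\<kk>\<close>. In
  coordinates: the places \<open>c \<noteq> k\<close> are untouched by \<open>y k\<close>, and the contribution of place \<open>k\<close> cancels
  against the commutator of \<open>X\<close> with \<open>e i (w k)\<close>.
\<close>

lemma tensor_act_y:
  assumes X: "X \<in> \<kk> p q" and f: "f \<in> T" and k: "k \<in> {1..n}"
  shows "tensor_act n N s M X (y k f) = y k (tensor_act n N s M X f)"
proof
  fix w
  have Xc: "X \<in> carrier_mat N N" using X by (simp add: \<kk>_iff)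
  note fU = T_in_U[OF f]
  show "tensor_act n N s M X (y k f) w = y k (tensor_act n N s M X f) w"
  proof (cases "w \<in> ix n N")
    case w: True
    have wk: "w k < N" by (rule ix_lt[OF w k])
    let ?O = "opp (w k)"
    define g where "g i = f (w(k := i))" for i
    have gU: "g i \<in> U" for i by (simp add: g_def fU)
    have O_lt: "i < N" if "i \<in> ?O" for i using that by (simp add: opp_def)
    let ?R = "\<Sum>c\<in>{1..n} - {k}. \<Sum>b<N. s (X $$ (w c, b)) (\<Sum>i\<in>?O. e i (w k) (f (w(k := i, c := b))))"

    have slots: "(\<Sum>c\<in>{1..n}. \<Sum>b<N. s (X $$ (w c, b)) (y k f (w(c := b))))
        = - (\<Sum>b<N. s (X $$ (w k, b)) (\<Sum>i\<in>?O. e i b (g i))) - ?R"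
    proof -
      have A: "s (X $$ (w k, b)) (y k f (w(k := b))) = - s (X $$ (w k, b)) (\<Sum>i\<in>?O. e i b (g i))"
        if b: "b \<in> {..<N}" for b
      proof (cases "X $$ (w k, b) = 0")
        case False
        with b wk have "opp b = ?O" using opp_eq[OF X wk, of b] by simp
        with b show ?thesis using y_eq[OF f ix_upd[OF w k, of b] k] by (simp add: g_def)
      qed simp
      have B: "s (X $$ (w c, b)) (y k f (w(c := b)))
          = - s (X $$ (w c, b)) (\<Sum>i\<in>?O. e i (w k) (f (w(k := i, c := b))))"
        if "c \<in> {1..n} - {k}" "b \<in> {..<N}" for c b
        using y_eq[OF f ix_upd[OF w, of c b] k] that by (simp add: fun_upd_twist)
      have "(\<Sum>b<N. s (X $$ (w k, b)) (y k f (w(k := b))))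
          = - (\<Sum>b<N. s (X $$ (w k, b)) (\<Sum>i\<in>?O. e i b (g i)))"
        unfolding sum_negf[symmetric] by (intro sum.cong refl A)
      moreover have "(\<Sum>c\<in>{1..n} - {k}. \<Sum>b<N. s (X $$ (w c, b)) (y k f (w(c := b)))) = - ?R"
        unfolding sum_negf[symmetric] by (intro sum.cong refl B)
      ultimately show ?thesis
        unfolding sum.remove[OF finite_atLeastAtMost k] by simp
    qed

    have act0: "act M X (y k f w) = - (\<Sum>i\<in>?O. e i (w k) (act M X (g i)))
        - (\<Sum>i\<in>?O. \<Sum>a<N. s (X $$ (a, i)) (e a (w k) (g i)))
        + (\<Sum>i\<in>?O. \<Sum>b<N. s (X $$ (w k, b)) (e i b (g i)))"
    proof -
      have "act M X (y k f w) = - (\<Sum>i\<in>?O. act M X (e i (w k) (g i)))"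
        unfolding y_eq[OF f w k]
        by (simp add: act_minus[OF Xc] act_sum[OF Xc] e_in fU s.subspace_sum[OF subspace_U] g_def)
      also have "(\<Sum>i\<in>?O. act M X (e i (w k) (g i))) = (\<Sum>i\<in>?O. e i (w k) (act M X (g i))
          + (\<Sum>a<N. s (X $$ (a, i)) (e a (w k) (g i))) - (\<Sum>b<N. s (X $$ (w k, b)) (e i b (g i))))"
        by (intro sum.cong refl act_e_commutator[OF Xc gU O_lt wk])
      finally show ?thesis by (simp add: sum.distrib sum_subtractf)
    qed

    have rhs: "y k (tensor_act n N s M X f) w = - (\<Sum>i\<in>?O. e i (w k) (act M X (g i)))
        - (\<Sum>i\<in>?O. \<Sum>b<N. s (X $$ (i, b)) (e i (w k) (g b))) - ?R"
    proof -
      have "e i (w k) (tensor_act n N s M X f (w(k := i)))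
          = e i (w k) (act M X (g i)) + (\<Sum>b<N. s (X $$ (i, b)) (e i (w k) (g b)))
            + (\<Sum>c\<in>{1..n} - {k}. \<Sum>b<N. s (X $$ (w c, b)) (e i (w k) (f (w(k := i, c := b)))))"
        if i: "i \<in> ?O" for i
      proof -
        have wi: "w(k := i) \<in> ix n N" by (rule ix_upd[OF w k O_lt[OF i]])
        have "(\<Sum>c\<in>{1..n}. \<Sum>b<N. s (X $$ ((w(k := i)) c, b)) (f (w(k := i, c := b))))
            = (\<Sum>b<N. s (X $$ (i, b)) (g b))
              + (\<Sum>c\<in>{1..n} - {k}. \<Sum>b<N. s (X $$ (w c, b)) (f (w(k := i, c := b))))"
          unfolding sum.remove[OF finite_atLeastAtMost k] g_def by simp
        then show ?thesis
          unfolding tensor_act_eq[OF wi]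
          by (simp add: g_def e_add e_sum e_scale fU act_in[OF Xc] s.subspace_add[OF subspace_U]
              s.subspace_sum[OF subspace_U] s.subspace_scale[OF subspace_U] add.assoc del: fun_upd_apply)
      qed
      moreover have "(\<Sum>i\<in>?O. \<Sum>c\<in>{1..n} - {k}. \<Sum>b<N. s (X $$ (w c, b)) (e i (w k) (f (w(k := i, c := b)))))
          = ?R"
        unfolding s.scale_sum_right by (subst sum.swap, rule sum.cong[OF refl], rule sum.swap)
      ultimately show ?thesis
        unfolding y_eq[OF tensor_act_in_T[OF Xc f] w k] by (simp add: sum.distrib)
    qed

    \<comment> \<open>The row of \<open>X\<close> through \<open>w k\<close> occurs with opposite signs in \<open>slots\<close> and in \<open>act0\<close>.\<close>
    have mid: "(\<Sum>i\<in>?O. \<Sum>b<N. s (X $$ (w k, b)) (e i b (g i)))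
        = (\<Sum>b<N. s (X $$ (w k, b)) (\<Sum>i\<in>?O. e i b (g i)))"
      unfolding s.scale_sum_right by (rule sum.swap)
    \<comment> \<open>Block diagonality cuts all sums down to the block opposite to \<open>w k\<close>.\<close>
    have restrict: "(\<Sum>a<N. h a) = (\<Sum>a\<in>?O. h a)" if "\<And>a. a < N \<Longrightarrow> a \<notin> ?O \<Longrightarrow> h a = 0" for h :: "nat \<Rightarrow> 'v"
      using that O_lt by (intro sum.mono_neutral_right) auto
    have off: "X $$ (a, i) = 0" "X $$ (i, a) = 0" if "i \<in> ?O" "a < N" "a \<notin> ?O" for i a
      using X that by (auto simp: \<kk>_iff opp_def)
    have "(\<Sum>i\<in>?O. \<Sum>a<N. s (X $$ (a, i)) (e a (w k) (g i)))
        = (\<Sum>i\<in>?O. \<Sum>a\<in>?O. s (X $$ (a, i)) (e a (w k) (g i)))"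
      using off by (intro sum.cong refl restrict) simp
    also have "\<dots> = (\<Sum>i\<in>?O. \<Sum>b\<in>?O. s (X $$ (i, b)) (e i (w k) (g b)))"
      by (rule sum.swap)
    also have "\<dots> = (\<Sum>i\<in>?O. \<Sum>b<N. s (X $$ (i, b)) (e i (w k) (g b)))"
      using off by (intro sum.cong refl restrict[symmetric]) simp
    finally show ?thesis
      unfolding tensor_act_eq[OF w] slots act0 rhs mid by simp
  next
    case False
    then show ?thesis
      using tensor_act_out[OF Xc y_in_T[OF f k] False] y_out[OF tensor_act_in_T[OF Xc f] False] by simp
  qed
qed

lemma y_scale: "k \<in> {1..n} \<Longrightarrow> f \<in> T \<Longrightarrow> y k (tscale s c f) = tscale s c (y k f)"
  using y_linear by (simp add: linear_over_def)

lemma y_in_F: "k \<in> {1..n} \<Longrightarrow> f \<in> F \<mu> \<Longrightarrow> y k f \<in> F \<mu>"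
  using tensor_act_y[of _ f k] y_in_T[of f k] by (simp add: F_space_def \<kk>0_def y_scale)

section \<open>The bracket of two operators \<open>y\<close>\<close>

text \<open>
  The Casimir element \<open>\<Sum> E\<^sub>i\<^sub>j \<otimes> E\<^sub>j\<^sub>i\<close> of \<open>\<kk>\<close>, with its first factor acting on \<open>M\<close> and its second one on
  place \<open>a\<close>; here \<open>i\<close> and \<open>j\<close> lie in the same block.
\<close>

definition Casimir :: "nat \<Rightarrow> 'v tensor \<Rightarrow> 'v tensor" where
  "Casimir a f w = (\<Sum>i\<in>same (w a). e i (w a) (f (w(a := i))))"

lemma opp_sym: "i \<in> opp j \<Longrightarrow> j < N \<Longrightarrow> j \<in> opp i"
  by (auto simp: opp_def)

lemma opp_same: "i \<in> opp j \<Longrightarrow> opp i = same j"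
  by (auto simp: opp_def same_def)

text \<open>
  The operators on the places \<open>a\<close> and \<open>b\<close> commute, so only commutators \<open>[E\<^sub>i\<^sub>j, E\<^sub>k\<^sub>l]\<close> on \<open>M\<close> survive.
  Each of them is nonzero only when an index of one place meets an index of the other; this
  exchanges the two letters and leaves a sum over one block, namely the difference of two Casimir
  operators. It requires the letters at \<open>a\<close> and \<open>b\<close> to lie in different blocks.
\<close>

lemma y_bracket_Casimir:
  assumes f: "f \<in> T" and w: "w \<in> ix n N" and a: "a \<in> {1..n}" and b: "b \<in> {1..n}" and ab: "a \<noteq> b"
  shows "y a (y b f) w - y b (y a f) w
    = (if w a \<in> opp (w b) then Casimir a f (w \<circ> transpose a b) - Casimir b f (w \<circ> transpose a b) else 0)"
proof -
  define g where "g i j = f (w(a := i, b := j))" for i j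
  have gU: "g i j \<in> U" for i j by (simp add: g_def T_in_U[OF f])
  have lt: "w a < N" "w b < N" using ix_lt[OF w] a b by auto
  have O_lt: "i < N" if "i \<in> opp j" for i j using that by (simp add: opp_def)
  have "y a (y b f) w = - (\<Sum>i\<in>opp (w a). e i (w a) (y b f (w(a := i))))"
    by (rule y_eq[OF y_in_T[OF f b] w a])
  also have "\<dots> = - (\<Sum>i\<in>opp (w a). - (\<Sum>j\<in>opp (w b). e i (w a) (e j (w b) (g i j))))"
    using y_eq[OF f ix_upd[OF w a O_lt] b] ab gU
    by (simp add: g_def e_minus e_sum e_in s.subspace_sum[OF subspace_U])
  finally have 1: "y a (y b f) w = (\<Sum>i\<in>opp (w a). \<Sum>j\<in>opp (w b). e i (w a) (e j (w b) (g i j)))"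
    by (simp add: sum_negf)
  have "y b (y a f) w = - (\<Sum>j\<in>opp (w b). e j (w b) (y a f (w(b := j))))"
    by (rule y_eq[OF y_in_T[OF f a] w b])
  also have "\<dots> = - (\<Sum>j\<in>opp (w b). - (\<Sum>i\<in>opp (w a). e j (w b) (e i (w a) (g i j))))"
    using y_eq[OF f ix_upd[OF w b O_lt] a] ab gU
    by (simp add: g_def e_minus e_sum e_in s.subspace_sum[OF subspace_U] fun_upd_twist[OF ab])
  also have "\<dots> = (\<Sum>j\<in>opp (w b). \<Sum>i\<in>opp (w a). e j (w b) (e i (w a) (g i j)))"
    by (simp add: sum_negf)
  also have "\<dots> = (\<Sum>i\<in>opp (w a). \<Sum>j\<in>opp (w b). e j (w b) (e i (w a) (g i j)))"
    by (rule sum.swap)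
  finally have 2: "y b (y a f) w = \<dots>" .
  have "y a (y b f) w - y b (y a f) w = (\<Sum>i\<in>opp (w a). \<Sum>j\<in>opp (w b).
      (if j = w a then e i (w b) (g i (w a)) else 0) - (if i = w b then e j (w a) (g (w b) j) else 0))"
    unfolding 1 2 sum_subtractf[symmetric] using lt O_lt gU
    by (intro sum.cong refl) (subst e_bracket, auto)
  also have "\<dots> = (\<Sum>i\<in>opp (w a). if w a \<in> opp (w b) then e i (w b) (g i (w a)) else 0)
      - (\<Sum>j\<in>opp (w b). if w b \<in> opp (w a) then e j (w a) (g (w b) j) else 0)"
  proof -
    have "(\<Sum>i\<in>opp (w a). \<Sum>j\<in>opp (w b). if i = w b then e j (w a) (g (w b) j) else 0)
        = (\<Sum>j\<in>opp (w b). if w b \<in> opp (w a) then e j (w a) (g (w b) j) else 0)"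
      by (subst sum.swap) simp
    then show ?thesis by (simp only: sum_subtractf) simp
  qed
  finally have diff: "y a (y b f) w - y b (y a f) w = \<dots>" .
  show ?thesis
  proof (cases "w a \<in> opp (w b)")
    case True
    \<comment> \<open>Replacing both letters amounts to exchanging them and then replacing one.\<close>
    have upd: "w(a := i, b := w a) = (w \<circ> transpose a b)(a := i)"
      "w(a := w b, b := i) = (w \<circ> transpose a b)(b := i)" for i
      using ab by (auto simp: fun_eq_iff transpose_def)
    have ba: "w b \<in> opp (w a)" by (rule opp_sym[OF True lt(2)])
    show ?thesis unfolding diff Casimir_def
      using True ba ab opp_same[OF True] opp_same[OF ba] by (simp add: g_def upd)
  next
    case False
    then have "w b \<notin> opp (w a)" using opp_sym lt by blast
    with False show ?thesis unfolding diff by simp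
  qed
qed

lemma F_invariant_at:
  assumes f: "f \<in> F \<mu>" and w: "w \<in> ix n N" and X: "X \<in> \<kk>0 p q"
  shows "act M X (f w) + (\<Sum>c\<in>{1..n}. \<Sum>b<N. s (X $$ (w c, b)) (f (w(c := b)))) = s (\<mu> * chi p q X) (f w)"
  using tensor_act_eq[OF w, of X f] F_invariant[OF f X] by (simp add: tscale_def)

text \<open>
  On semi-invariants the action on \<open>M\<close> can be traded for the action on the other factors. An
  off-diagonal matrix unit of \<open>\<kk>\<close> has trace zero, and \<open>\<chi>\<close> vanishes on it.
\<close>

lemma F_off_diagonal:
  assumes f: "f \<in> F \<mu>" and w: "w \<in> ix n N" and ij: "i \<in> same j" "j < N" "i \<noteq> j"
  shows "e i j (f w) = - (\<Sum>c\<in>{1..n}. if w c = i then f (w(c := j)) else 0)"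
proof -
  let ?X = "matrix_unit N i j"
  have i: "i < N" using ij by (simp add: same_def)
  have "tr ?X = 0" using ij by (auto simp: tr_def matrix_unit_def intro!: sum.neutral)
  then have X: "?X \<in> \<kk>0 p q" using ij by (auto simp: \<kk>0_def \<kk>_iff matrix_unit_index same_def)
  have chi: "chi p q ?X = 0"
    using ij by (auto simp: chi_altdef matrix_unit_index sum.neutral)
  have "(\<Sum>b<N. s (?X $$ (w c, b)) (f (w(c := b)))) = (if w c = i then f (w(c := j)) else 0)"
    if c: "c \<in> {1..n}" for c
  proof -
    have "(\<Sum>b<N. s (?X $$ (w c, b)) (f (w(c := b))))
        = (\<Sum>b<N. if b = j then (if w c = i then f (w(c := j)) else 0) else 0)"
      by (intro sum.cong refl) (use ix_lt[OF w c] in \<open>auto simp: matrix_unit_index\<close>)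
    then show ?thesis using ij by simp
  qed
  then have "(\<Sum>c\<in>{1..n}. \<Sum>b<N. s (?X $$ (w c, b)) (f (w(c := b))))
      = (\<Sum>c\<in>{1..n}. if w c = i then f (w(c := j)) else 0)"
    by (intro sum.cong refl)
  then show ?thesis
    using F_invariant_at[OF f w X] unfolding chi e_def by (simp add: eq_neg_iff_add_eq_0)
qed

text \<open>
  A single diagonal matrix unit does not have trace zero, but a difference of two does. For indices
  in different blocks the value of \<open>\<chi>\<close> is \<open>q + p = N\<close>, and this is where the term \<open>\<mu> N\<close> of \<open>\<kappa>2\<close>
  comes from.
\<close>

lemma F_diagonal:
  assumes f: "f \<in> F \<mu>" and w: "w \<in> ix n N" and i: "i < p" and j: "p \<le> j" "j < N"
  shows "e i i (f w) - e j j (f w) = s (\<mu> * of_nat N) (f w)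
    - (\<Sum>c\<in>{1..n}. if w c = i then f w else 0) + (\<Sum>c\<in>{1..n}. if w c = j then f w else 0)"
proof -
  \<comment> \<open>The traceless diagonal matrix whose \<open>\<chi>\<close> is \<open>q \<cdot> 1 - p \<cdot> (- 1) = N\<close>.\<close>
  let ?X = "matrix_unit N i i - matrix_unit N j j"
  have Xc: "?X \<in> carrier_mat N N" by (intro minus_carrier_mat matrix_unit_carrier)
  have ind: "?X $$ (a, b) = (if a = i \<and> b = i then 1 else 0) - (if a = j \<and> b = j then 1 else 0)"
    if "a < N" "b < N" for a b
    using that by (subst index_minus_mat) (auto simp: matrix_unit_def)
  have sums: "(\<Sum>a<p. ?X $$ (a, a)) = 1" "(\<Sum>a<q. ?X $$ (a + p, a + p)) = - 1"
  proof -
    have "(\<Sum>a<p. ?X $$ (a, a)) = (\<Sum>a<p. if a = i then 1 else 0)"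
      using i j by (intro sum.cong refl) (auto simp: ind)
    then show "(\<Sum>a<p. ?X $$ (a, a)) = 1" using i by simp
    have "(\<Sum>a<q. ?X $$ (a + p, a + p)) = (\<Sum>a<q. if a = j - p then - 1 else 0)"
      using i j by (intro sum.cong refl) (auto simp: ind)
    then show "(\<Sum>a<q. ?X $$ (a + p, a + p)) = - 1" using j by simp
  qed
  have X: "?X \<in> \<kk>0 p q"
    using sums Xc i j by (auto simp: \<kk>0_def \<kk>_iff tr_altdef[OF Xc] ind)
  have chi: "chi p q ?X = of_nat N"
    by (simp add: chi_altdef[OF Xc] sums)
  have "(\<Sum>b<N. s (?X $$ (w c, b)) (f (w(c := b))))
      = (if w c = i then f w else 0) - (if w c = j then f w else 0)" if c: "c \<in> {1..n}" for c
  proof -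
    have "(\<Sum>b<N. s (?X $$ (w c, b)) (f (w(c := b))))
        = (\<Sum>b<N. if b = w c then (if w c = i then f w else 0) - (if w c = j then f w else 0) else 0)"
      by (intro sum.cong refl) (use ix_lt[OF w c] in \<open>auto simp: ind\<close>)
    then show ?thesis using ix_lt[OF w c] by simp
  qed
  then have slots: "(\<Sum>c\<in>{1..n}. \<Sum>b<N. s (?X $$ (w c, b)) (f (w(c := b))))
      = (\<Sum>c\<in>{1..n}. if w c = i then f w else 0) - (\<Sum>c\<in>{1..n}. if w c = j then f w else 0)"
    unfolding sum_subtractf[symmetric] by (intro sum.cong refl)
  have act: "act M ?X (f w) = e i i (f w) - e j j (f w)"
    by (simp add: e_def act_diff T_in_U[OF F_in_T[OF f]])
  show ?thesis
    using F_invariant_at[OF f w X] unfolding chi slots act by (simp only: algebra_simps)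
qed

text \<open>
  All terms of the Casimir operator except the diagonal one are moved to the other factors. Moving
  \<open>E\<^sub>i\<^sub>j\<close> back to place \<open>a\<close> itself contributes \<open>f w\<close> for each index of the block, which gives the size of
  the block; moving it to a place \<open>c\<close> with a letter of the same block exchanges the letters at \<open>a\<close>
  and \<open>c\<close>. Places with the same letter as \<open>a\<close> are inserted into the last sum, where the exchange does
  nothing, and are compensated by the second term.
\<close>

lemma Casimir_eq:
  assumes f: "f \<in> F \<mu>" and w: "w \<in> ix n N" and a: "a \<in> {1..n}"
  shows "Casimir a f w = e (w a) (w a) (f w) + (\<Sum>c\<in>{1..n}. if w c = w a then f w else 0)
    - s (of_nat (card (same (w a)))) (f w)
    - (\<Sum>c\<in>{1..n} - {a}. if w c \<in> same (w a) then f (w \<circ> transpose a c) else 0)"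
proof -
  let ?B = "same (w a)" and ?I = "{1..n} - {a}"
  have wa: "w a < N" by (rule ix_lt[OF w a])
  have wB: "w a \<in> ?B" using wa by (simp add: same_def)
  have each: "e i (w a) (f (w(a := i)))
      = - f w - (\<Sum>c\<in>?I. if w c = i then f (w \<circ> transpose a c) else 0)" if i: "i \<in> ?B - {w a}" for i
  proof -
    have iN: "i < N" using i by (simp add: same_def)
    have "e i (w a) (f (w(a := i)))
        = - (\<Sum>c\<in>{1..n}. if (w(a := i)) c = i then f (w(a := i, c := w a)) else 0)"
      by (rule F_off_diagonal[OF f ix_upd[OF w a iN] _ wa]) (use i in auto)
    also have "(\<Sum>c\<in>{1..n}. if (w(a := i)) c = i then f (w(a := i, c := w a)) else 0)
        = f w + (\<Sum>c\<in>?I. if (w(a := i)) c = i then f (w(a := i, c := w a)) else 0)"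
      unfolding sum.remove[OF finite_atLeastAtMost a] by simp
    also have "(\<Sum>c\<in>?I. if (w(a := i)) c = i then f (w(a := i, c := w a)) else 0)
        = (\<Sum>c\<in>?I. if w c = i then f (w \<circ> transpose a c) else 0)"
    proof (intro sum.cong refl)
      fix c assume c: "c \<in> ?I"
      have "w(a := i, c := w a) = w \<circ> transpose a c" if "w c = i"
        using that c by (auto simp: fun_eq_iff transpose_def)
      then show "(if (w(a := i)) c = i then f (w(a := i, c := w a)) else 0)
          = (if w c = i then f (w \<circ> transpose a c) else 0)" using c by auto
    qed
    finally show ?thesis by (simp only: minus_add_distrib diff_conv_add_uminus)
  qed
  have "Casimir a f w = e (w a) (w a) (f w) + (\<Sum>i\<in>?B - {w a}. e i (w a) (f (w(a := i))))"
    unfolding Casimir_def by (subst sum.remove[OF _ wB]) simp_all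
  also have "(\<Sum>i\<in>?B - {w a}. e i (w a) (f (w(a := i))))
      = (\<Sum>i\<in>?B - {w a}. - f w - (\<Sum>c\<in>?I. if w c = i then f (w \<circ> transpose a c) else 0))"
    by (intro sum.cong refl each)
  also have "\<dots> = - s (of_nat (card (?B - {w a}))) (f w)
      - (\<Sum>c\<in>?I. if w c \<in> ?B - {w a} then f (w \<circ> transpose a c) else 0)"
  proof -
    have "(\<Sum>i\<in>?B - {w a}. f w) = s (of_nat (card (?B - {w a}))) (f w)"
      by (induction rule: infinite_finite_induct[of "\<lambda>A. (\<Sum>i\<in>A. f w) = s (of_nat (card A)) (f w)"])
        (simp_all add: s.scale_left_distrib)
    moreover have "(\<Sum>i\<in>?B - {w a}. \<Sum>c\<in>?I. if w c = i then f (w \<circ> transpose a c) else 0)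
        = (\<Sum>c\<in>?I. if w c \<in> ?B - {w a} then f (w \<circ> transpose a c) else 0)"
      by (subst sum.swap) (intro sum.cong refl sum.delta', simp)
    ultimately show ?thesis by (simp only: sum_subtractf sum_negf)
  qed
  also have "of_nat (card (?B - {w a})) = (of_nat (card ?B) - 1 :: complex)"
  proof -
    have "card ?B = Suc (card (?B - {w a}))" using wB by (intro card.remove) simp_all
    then show ?thesis by simp
  qed
  also have "(\<Sum>c\<in>?I. if w c \<in> ?B - {w a} then f (w \<circ> transpose a c) else 0)
      = (\<Sum>c\<in>?I. if w c \<in> ?B then f (w \<circ> transpose a c) else 0) - (\<Sum>c\<in>?I. if w c = w a then f w else 0)"
  proof -
    have "w \<circ> transpose a c = w" if "w c = w a" for c
      using that by (auto simp: fun_eq_iff transpose_def)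
    then show ?thesis unfolding sum_subtractf[symmetric] using wB by (intro sum.cong refl) auto
  qed
  finally show ?thesis
    unfolding sum.remove[OF finite_atLeastAtMost a, of "\<lambda>c. if w c = w a then f w else 0"]
    by (simp add: s.scale_left_diff_distrib)
qed

lemma card_same: "card (same j) = (if j < p then p else q)"
proof -
  have "same j = (if j < p then {..<p} else {p..<N})" by (auto simp: same_def)
  then show ?thesis by simp
qed

text \<open>
  In the difference only \<open>E\<^sub>i\<^sub>i - E\<^sub>j\<^sub>j\<close> is left on \<open>M\<close>, with \<open>i\<close> and \<open>j\<close> in different blocks. It is traded by
  \<open>F_diagonal\<close> and contributes \<open>\<mu> N\<close>; the two block sizes contribute \<open>p - q\<close>. Together they form \<open>\<kappa>2\<close>.
\<close>

lemma Casimir_difference: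
  assumes f: "f \<in> F \<mu>" and w: "w \<in> ix n N" and a: "a \<in> {1..n}" and b: "b \<in> {1..n}"
    and opp: "w a \<in> opp (w b)"
  shows "Casimir a f w - Casimir b f w = - s (Jsign p (w a) * (of_nat p - of_nat q - \<mu> * of_nat N)) (f w)
    - (\<Sum>c\<in>{1..n} - {a, b}. if w c \<in> same (w a) then f (w \<circ> transpose a c) else 0)
    + (\<Sum>c\<in>{1..n} - {a, b}. if w c \<in> same (w b) then f (w \<circ> transpose b c) else 0)"
proof -
  let ?D = "\<lambda>i. \<Sum>c\<in>{1..n}. if w c = i then f w else 0"
  have ab: "a \<noteq> b" using opp by (auto simp: opp_def)
  have lt: "w a < N" "w b < N" using ix_lt[OF w] a b by auto
  have "w b \<notin> same (w a)" "w a \<notin> same (w b)" using opp by (auto simp: opp_def same_def)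
  then have A: "(\<Sum>c\<in>{1..n} - {a}. if w c \<in> same (w a) then f (w \<circ> transpose a c) else 0)
      = (\<Sum>c\<in>{1..n} - {a, b}. if w c \<in> same (w a) then f (w \<circ> transpose a c) else 0)"
    and B: "(\<Sum>c\<in>{1..n} - {b}. if w c \<in> same (w b) then f (w \<circ> transpose b c) else 0)
      = (\<Sum>c\<in>{1..n} - {a, b}. if w c \<in> same (w b) then f (w \<circ> transpose b c) else 0)"
    using a b by (auto intro!: sum.mono_neutral_right)
  have "e (w a) (w a) (f w) + ?D (w a) - s (of_nat (card (same (w a)))) (f w)
      - (e (w b) (w b) (f w) + ?D (w b) - s (of_nat (card (same (w b)))) (f w))
      = - s (Jsign p (w a) * (of_nat p - of_nat q - \<mu> * of_nat N)) (f w)"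
  proof (cases "w a < p")
    case True
    then have wb: "p \<le> w b" using opp by (auto simp: opp_def)
    show ?thesis using F_diagonal[OF f w True wb lt(2)] True wb
      by (simp add: card_same Jsign_def s.scale_left_diff_distrib s.scale_left_distrib algebra_simps)
  next
    case False
    then have wb: "w b < p" "p \<le> w a" using opp by (auto simp: opp_def)
    show ?thesis using F_diagonal[OF f w wb lt(1)] False wb
      by (simp add: card_same Jsign_def s.scale_left_diff_distrib s.scale_left_distrib algebra_simps)
  qed
  then show ?thesis unfolding Casimir_eq[OF f w a] Casimir_eq[OF f w b] A B by (simp add: algebra_simps)
qed

text \<open>
  The right-hand side is the value at the word \<open>w\<close> of the commutator relation. The factor
  \<open>(1 - J\<^sub>a J\<^sub>b) / 2\<close> is the indicator of letters in different blocks, and \<open>(1 + J\<^sub>a J\<^sub>c) / 2\<close> that of letters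
  in the same block. Expanding the products of these indicators produces the four sums of the
  relation, up to the identities \<open>S\<^sub>a\<^sub>b S\<^sub>a\<^sub>c = S\<^sub>a\<^sub>c S\<^sub>b\<^sub>c\<close> and \<open>S\<^sub>a\<^sub>b S\<^sub>b\<^sub>c = S\<^sub>b\<^sub>c S\<^sub>a\<^sub>c\<close>.
\<close>

lemma y_bracket_at:
  assumes f: "f \<in> F \<mu>" and w: "w \<in> ix n N" and a: "a \<in> {1..n}" and b: "b \<in> {1..n}" and ab: "a \<noteq> b"
    and \<kappa>2: "\<kappa>2 = of_nat p - of_nat q - \<mu> * of_nat N"
  defines "I \<equiv> {1..n} - {a, b}" and "J \<equiv> \<lambda>i. Jsign p (w i)"
    and "u \<equiv> \<lambda>c. f (w \<circ> transpose a c \<circ> transpose b c)"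
    and "u' \<equiv> \<lambda>c. f (w \<circ> transpose b c \<circ> transpose a c)"
  shows "y a (y b f) w - y b (y a f) w
    = s (\<kappa>2 / 2) (s (J a - J b) (f (w \<circ> transpose a b)))
    + s (1/4) (\<Sum>c\<in>I. u' c) - s (1/4) (\<Sum>c\<in>I. u c)
    + s (1/4) (\<Sum>c\<in>I. s (- (J c * J b) + J c * J a + J a * J b) (u c))
    - s (1/4) (\<Sum>c\<in>I. s (J b * J c - J c * J a + J b * J a) (u' c))"
proof -
  let ?w = "w \<circ> transpose a b"
  have w': "?w \<in> ix n N" by (rule ix_transpose[OF w a b])
  have lt: "w a < N" "w b < N" using ix_lt[OF w] a b by auto
  have ltc: "w c < N" if "c \<in> I" for c using ix_lt[OF w, of c] that by (simp add: I_def)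
  have "s (1/4) (\<Sum>c\<in>I. u' c) - s (1/4) (\<Sum>c\<in>I. u c)
    + s (1/4) (\<Sum>c\<in>I. s (- (J c * J b) + J c * J a + J a * J b) (u c))
    - s (1/4) (\<Sum>c\<in>I. s (J b * J c - J c * J a + J b * J a) (u' c))
    = (\<Sum>c\<in>I. s (1/4 * (1 - (J b * J c - J c * J a + J b * J a))) (u' c)
        - s (1/4 * (1 - (- (J c * J b) + J c * J a + J a * J b))) (u c))"
    unfolding s.scale_sum_right sum_subtractf[symmetric] sum.distrib[symmetric]
    by (intro sum.cong refl)
      (simp only: right_diff_distrib mult_1_right s.scale_left_diff_distrib s.scale_scale[symmetric],
        simp)
  also have "\<dots> = (\<Sum>c\<in>I. (if w a \<in> opp (w b) \<and> w c \<in> same (w a) then u' c else 0)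
        - (if w a \<in> opp (w b) \<and> w c \<in> same (w b) then u c else 0))"
  proof (intro sum.cong refl)
    fix c assume c: "c \<in> I"
    \<comment> \<open>With all signs equal to \<open>1\<close> or \<open>-1\<close>, eight cases remain, each a numerical identity.\<close>
    have pm: "J i = 1 \<or> J i = - 1" for i by (simp add: J_def Jsign_def)
    have *: "w a \<in> opp (w b) \<longleftrightarrow> J a \<noteq> J b" "w c \<in> same (w a) \<longleftrightarrow> J c = J a"
      "w c \<in> same (w b) \<longleftrightarrow> J c = J b"
      using lt ltc[OF c] by (simp_all add: J_def Jsign_def opp_def same_def)
    show "s (1/4 * (1 - (J b * J c - J c * J a + J b * J a))) (u' c)
        - s (1/4 * (1 - (- (J c * J b) + J c * J a + J a * J b))) (u c)
      = (if w a \<in> opp (w b) \<and> w c \<in> same (w a) then u' c else 0)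
        - (if w a \<in> opp (w b) \<and> w c \<in> same (w b) then u c else 0)"
      unfolding * using pm[of a] pm[of b] pm[of c] by (elim disjE) simp_all
  qed
  finally have sums: "s (1/4) (\<Sum>c\<in>I. u' c) - s (1/4) (\<Sum>c\<in>I. u c)
    + s (1/4) (\<Sum>c\<in>I. s (- (J c * J b) + J c * J a + J a * J b) (u c))
    - s (1/4) (\<Sum>c\<in>I. s (J b * J c - J c * J a + J b * J a) (u' c)) = \<dots>" .
  have "y a (y b f) w - y b (y a f) w = s (\<kappa>2 / 2) (s (J a - J b) (f ?w))
    + (\<Sum>c\<in>I. (if w a \<in> opp (w b) \<and> w c \<in> same (w a) then u' c else 0)
        - (if w a \<in> opp (w b) \<and> w c \<in> same (w b) then u c else 0))"
  proof (cases "w a \<in> opp (w b)")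
    case False
    then have "J a = J b" using lt by (auto simp: J_def Jsign_def opp_def)
    with False show ?thesis
      unfolding y_bracket_Casimir[OF F_in_T[OF f] w a b ab] by simp
  next
    case True
    then have J: "J b = - J a" using lt by (auto simp: J_def Jsign_def opp_def)
    have opp': "?w a \<in> opp (?w b)" using opp_sym[OF True lt(2)] by simp
    have A: "(\<Sum>c\<in>I. if ?w c \<in> same (?w a) then f (?w \<circ> transpose a c) else 0)
        = (\<Sum>c\<in>I. if w c \<in> same (w b) then u c else 0)"
      using ab by (intro sum.cong refl if_cong)
        (auto simp: u_def I_def fun_eq_iff transpose_def intro!: arg_cong[of _ _ f])
    have B: "(\<Sum>c\<in>I. if ?w c \<in> same (?w b) then f (?w \<circ> transpose b c) else 0)
        = (\<Sum>c\<in>I. if w c \<in> same (w a) then u' c else 0)"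
      using ab by (intro sum.cong refl if_cong)
        (auto simp: u'_def I_def fun_eq_iff transpose_def intro!: arg_cong[of _ _ f])
    have C: "- s (Jsign p (?w a) * \<kappa>2) (f ?w) = s (\<kappa>2 / 2) (s (J a - J b) (f ?w))"
      using J by (simp add: J_def[symmetric] mult.commute flip: s.scale_minus_left) (simp add: J_def)
    have "Casimir a f ?w - Casimir b f ?w = s (\<kappa>2 / 2) (s (J a - J b) (f ?w))
        - (\<Sum>c\<in>I. if w c \<in> same (w b) then u c else 0) + (\<Sum>c\<in>I. if w c \<in> same (w a) then u' c else 0)"
      using Casimir_difference[OF f w' a b opp'] unfolding \<kappa>2[symmetric] I_def[symmetric] A B C .
    with True show ?thesis
      unfolding y_bracket_Casimir[OF F_in_T[OF f] w a b ab] by (simp add: sum_subtractf)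
  qed
  then show ?thesis unfolding sums[symmetric] by (simp add: algebra_simps)
qed

section \<open>The Hecke module of a module over the general linear Lie algebra\<close>

definition hecke_op :: "hecke_gen \<Rightarrow> 'v tensor \<Rightarrow> 'v tensor" where
  "hecke_op g = (case g of W w \<Rightarrow> weyl_op p s w | Y k \<Rightarrow> y k)"

lemma hecke_op_simps [simp]: "hecke_op (W w) = weyl_op p s w" "hecke_op (Y k) = y k"
  by (simp_all add: hecke_op_def)

lemma hecke_op_operators: "operators (tscale s) (F \<mu>) (hecke_gens n) hecke_op"
proof (rule operators.intro)
  show "vector_space (tscale s)" by (rule vector_space_tscale[OF vs])
  show "module.subspace (tscale s) (F \<mu>)" by (rule subspace_F)
  fix g assume g: "g \<in> hecke_gens n"
  show "linear_over (tscale s) (tscale s) (F \<mu>) (hecke_op g)"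
    by (rule linear_over_subset[of _ _ T])
      (use g weyl_op_linear y_linear F_in_T in \<open>auto simp: hecke_gens_def\<close>)
  show "hecke_op g f \<in> F \<mu>" if "f \<in> F \<mu>" for f
    using g that weyl_op_in_F y_in_F by (auto simp: hecke_gens_def)
qed

text \<open>
  The relation rewritten at a word. In a product \<open>S\<^sub>a\<^sub>c S\<^sub>b\<^sub>c \<gamma>\<close> the signs \<open>\<gamma>\<close> act first, that is, they are
  evaluated at the permuted word; there the places \<open>a\<close>, \<open>b\<close>, \<open>c\<close> carry the letters \<open>w c\<close>, \<open>w a\<close>, \<open>w b\<close>,
  and for \<open>S\<^sub>b\<^sub>c S\<^sub>a\<^sub>c\<close> the letters \<open>w b\<close>, \<open>w c\<close>, \<open>w a\<close>.
\<close>

lemma evaluate_y_commutator: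
  assumes f: "f \<in> F \<mu>" and a: "a \<in> {1..n}" and b: "b \<in> {1..n}" and ab: "a \<noteq> b"
  defines "I \<equiv> {1..n} - {a, b}" and "J \<equiv> \<lambda>w i. Jsign p (w i)"
  shows "evaluate (tscale s) hecke_op (y_commutator n 1 \<kappa>2 a b) f w
    = s (\<kappa>2 / 2) (s (J w a - J w b) (f (w \<circ> transpose a b)))
    + s (1/4) (\<Sum>c\<in>I. f (w \<circ> transpose b c \<circ> transpose a c))
    - s (1/4) (\<Sum>c\<in>I. f (w \<circ> transpose a c \<circ> transpose b c))
    + s (1/4) (\<Sum>c\<in>I. s (- (J w c * J w b) + J w c * J w a + J w a * J w b)
        (f (w \<circ> transpose a c \<circ> transpose b c)))
    - s (1/4) (\<Sum>c\<in>I. s (J w b * J w c - J w c * J w a + J w b * J w a)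
        (f (w \<circ> transpose b c \<circ> transpose a c)))"
proof -
  interpret operators "tscale s" "F \<mu>" "hecke_gens n" hecke_op by (rule hecke_op_operators)
  let ?ev = "evaluate (tscale s) hecke_op"
  let ?FA = "carrier (free_algebra (hecke_gens n))"
  have S: "?ev (\<S> i j * P) f w = ?ev P f (w \<circ> transpose i j)"
    if "i \<in> {1..n}" "j \<in> {1..n}" "P \<in> ?FA" for i j P w
    using that f by (simp add: evaluate_mult W_in_free refl_S_in_weyl weyl_op_refl_S[OF vs])
  have S1: "?ev (\<S> i j) f w = f (w \<circ> transpose i j)" for i j w
    by (simp add: weyl_op_refl_S[OF vs])
  have G: "?ev (\<G> i) f w = s (J w i) (f w)" for i w
    by (simp add: weyl_op_refl_gamma J_def)
  have GG: "?ev (\<G> i * \<G> j) f w = s (J w i * J w j) (f w)" if "i \<in> {1..n}" "j \<in> {1..n}" for i j w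
    using that f by (simp add: evaluate_mult W_in_free refl_gamma_in_weyl weyl_op_refl_gamma J_def)
  have c: "?ev (scal c * P) f w = s c (?ev P f w)" if "P \<in> ?FA" for c P w
    using that f by (simp add: evaluate_mult scal_in_free tscale_def)
  have I: "c \<in> {1..n}" "c \<noteq> a" "c \<noteq> b" if "c \<in> I" for c using that by (auto simp: I_def)
  have free: "\<S> a b * (\<G> b - \<G> a) \<in> ?FA"
    "(\<Sum>c\<in>I. \<S> b c * \<S> a c) \<in> ?FA" "(\<Sum>c\<in>I. \<S> a c * \<S> b c) \<in> ?FA"
    "(\<Sum>c\<in>I. \<S> a c * \<S> b c * (- (\<G> a * \<G> c) + \<G> a * \<G> b + \<G> b * \<G> c)) \<in> ?FA"
    "(\<Sum>c\<in>I. \<S> b c * \<S> a c * (\<G> a * \<G> b - \<G> b * \<G> c + \<G> a * \<G> c)) \<in> ?FA"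
    by (intro hecke_in_free a b I; assumption)+
  have 1: "?ev (\<S> a b * (\<G> b - \<G> a)) f w = s (J w a - J w b) (f (w \<circ> transpose a b))"
    by (subst S[OF a b]) (intro hecke_in_free a b,
        simp add: evaluate_diff G J_def s.scale_left_diff_distrib del: evaluate_gen)
  have 2: "?ev (\<S> b c * \<S> a c) f w = f (w \<circ> transpose b c \<circ> transpose a c)"
    "?ev (\<S> a c * \<S> b c) f w = f (w \<circ> transpose a c \<circ> transpose b c)" if "c \<in> I" for c
    using I[OF that] a b by (simp_all add: S S1 W_in_free refl_S_in_weyl del: evaluate_gen)
  have 3: "?ev (\<S> a c * \<S> b c * (- (\<G> a * \<G> c) + \<G> a * \<G> b + \<G> b * \<G> c)) f w
      = s (- (J w c * J w b) + J w c * J w a + J w a * J w b) (f (w \<circ> transpose a c \<circ> transpose b c))"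
    if "c \<in> I" for c
  proof -
    let ?x = "w \<circ> transpose a c \<circ> transpose b c"
    have x: "?x a = w c" "?x b = w a" "?x c = w b"
      using I[OF that] ab by (auto simp: transpose_def)
    have "?ev (\<S> a c * \<S> b c * (- (\<G> a * \<G> c) + \<G> a * \<G> b + \<G> b * \<G> c)) f w
      = ?ev (- (\<G> a * \<G> c) + \<G> a * \<G> b + \<G> b * \<G> c) f ?x"
      unfolding mult.assoc
      by (subst S, (intro hecke_in_free a b I[OF that])+)+ (rule refl)
    also have "\<dots> = s (- (J ?x a * J ?x c) + J ?x a * J ?x b + J ?x b * J ?x c) (f ?x)"
      using I[OF that] a b
      by (simp add: evaluate_add evaluate_diff evaluate_uminus GG s.scale_left_distrib s.scale_left_diff_distrib
          del: evaluate_gen o_apply)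
    finally show ?thesis unfolding J_def x .
  qed
  have 4: "?ev (\<S> b c * \<S> a c * (\<G> a * \<G> b - \<G> b * \<G> c + \<G> a * \<G> c)) f w
      = s (J w b * J w c - J w c * J w a + J w b * J w a) (f (w \<circ> transpose b c \<circ> transpose a c))"
    if "c \<in> I" for c
  proof -
    let ?x = "w \<circ> transpose b c \<circ> transpose a c"
    have x: "?x a = w b" "?x b = w c" "?x c = w a"
      using I[OF that] ab by (auto simp: transpose_def)
    have "?ev (\<S> b c * \<S> a c * (\<G> a * \<G> b - \<G> b * \<G> c + \<G> a * \<G> c)) f w
      = ?ev (\<G> a * \<G> b - \<G> b * \<G> c + \<G> a * \<G> c) f ?x"
      unfolding mult.assoc
      by (subst S, (intro hecke_in_free a b I[OF that])+)+ (rule refl)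
    also have "\<dots> = s (J ?x a * J ?x b - J ?x b * J ?x c + J ?x a * J ?x c) (f ?x)"
      using I[OF that] a b
      by (simp add: evaluate_add evaluate_diff GG s.scale_left_distrib s.scale_left_diff_distrib
          del: evaluate_gen o_apply)
    finally show ?thesis unfolding J_def x .
  qed
  show ?thesis
    unfolding y_commutator_def I_def[symmetric] evaluate_add evaluate_diff plus_fun_apply
      fun_diff_def c[OF free(1)] c[OF free(2)] c[OF free(3)] c[OF free(4)] c[OF free(5)] 1
    by (simp only: evaluate_sum sum_apply 2 3 4 power_one mult_1_left cong: sum.cong)
qed

text \<open>
  All defining relations hold on the semi-invariants: those inside the Weyl group by \<open>weyl_op_mult\<close>,
  the mixed ones by \<open>y_weyl_op\<close>, and the bracket by \<open>y_bracket_at\<close>.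
\<close>

lemma hecke_op_hecke_operators:
  assumes n: "1 \<le> n" and \<kappa>2: "\<kappa>2 = of_nat p - of_nat q - \<mu> * of_nat N"
  shows "hecke_operators (tscale s) (F \<mu>) n hecke_op 1 \<kappa>2"
proof -
  interpret operators "tscale s" "F \<mu>" "hecke_gens n" hecke_op by (rule hecke_op_operators)
  let ?ev = "evaluate (tscale s) hecke_op"
  have "?ev P f = 0" if P: "P \<in> hecke_relations n 1 \<kappa>2" and f: "f \<in> F \<mu>" for P f
  proof -
    note fT = F_in_T[OF f]
    have perm: "transpose i j permutes {1..n}" if "i \<in> {1..n}" "j \<in> {1..n}" for i j
      using that by (rule permutes_swap_id)
    note mem = evaluate_mult W_in_free Y_in_free refl_S_in_weyl refl_gamma_in_weyl
    consider (mult) v w where "P = gen (W v) * gen (W w) - gen (W (v \<otimes>\<^bsub>weyl n\<^esub> w))"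
        "v \<in> carrier (weyl n)" "w \<in> carrier (weyl n)"
      | (one) "P = gen (W \<one>\<^bsub>weyl n\<^esub>) - 1"
      | (braid) i where "P = \<S> i (i + 1) * \<Y> i - \<Y> (i + 1) * \<S> i (i + 1)" "1 \<le> i" "i < n"
      | (far) i j where "P = \<S> j (j + 1) * \<Y> i - \<Y> i * \<S> j (j + 1)"
          "1 \<le> j" "j < n" "i \<in> {1..n}" "i \<noteq> j" "i \<noteq> j + 1"
      | (anti) "P = \<Y> n * \<G> n + \<G> n * \<Y> n"
      | (comm) i where "P = \<Y> i * \<G> n - \<G> n * \<Y> i" "i \<in> {1..n}" "i \<noteq> n"
      | (bracket) i j where "P = \<Y> i * \<Y> j - \<Y> j * \<Y> i - y_commutator n 1 \<kappa>2 i j"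
          "i \<in> {1..n}" "j \<in> {1..n}" "i \<noteq> j"
      using P unfolding hecke_relations_def by blast
    then show ?thesis
    proof cases
      case mult
      then show ?thesis using f by (simp add: evaluate_diff mem weyl_op_mult[OF vs])
    next
      case one
      then show ?thesis by (simp add: evaluate_diff weyl_op_one[OF vs])
    next
      case (braid i)
      then have i: "i \<in> {1..n}" "i + 1 \<in> {1..n}" by auto
      have "y (i + 1) (weyl_op p s (refl_S i (i + 1)) f) = weyl_op p s (refl_S i (i + 1)) (y i f)"
        using y_weyl_op[OF perm[OF i] empty_subsetI fT i(1)] by (simp add: refl_S_def tscale_def)
      then show ?thesis using f i braid(1) by (simp add: evaluate_diff mem)
    next
      case (far i j)
      then have j: "j \<in> {1..n}" "j + 1 \<in> {1..n}" by auto
      have "transpose j (j + 1) i = i" using far by (intro transpose_apply_other) auto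
      then have "y i (weyl_op p s (refl_S j (j + 1)) f) = weyl_op p s (refl_S j (j + 1)) (y i f)"
        using y_weyl_op[OF perm[OF j] empty_subsetI fT far(4)] by (simp add: refl_S_def tscale_def)
      then show ?thesis using f j far(1,4) by (simp add: evaluate_diff mem)
    next
      case anti
      have n': "n \<in> {1..n}" using n by simp
      have "y n (weyl_op p s (refl_gamma n) f) = tscale s (- 1) (weyl_op p s (refl_gamma n) (y n f))"
        using y_weyl_op[OF permutes_id _ fT n', of "{n}"] n' by (simp add: refl_gamma_def)
      then show ?thesis using f n' anti by (simp add: evaluate_add mem t.scale_minus_left)
    next
      case (comm i)
      have n': "n \<in> {1..n}" using n by simp
      have "y i (weyl_op p s (refl_gamma n) f) = weyl_op p s (refl_gamma n) (y i f)"
        using y_weyl_op[OF permutes_id _ fT comm(2), of "{n}"] n' comm(3)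
        by (simp add: refl_gamma_def tscale_def)
      then show ?thesis using f n' comm(1,2) by (simp add: evaluate_diff mem)
    next
      case (bracket i j)
      have PF: "P \<in> carrier (free_algebra (hecke_gens n))"
        using P hecke_relations_in_free[OF n] by blast
      have "?ev P f w = 0" for w
      proof (cases "w \<in> ix n N")
        case True
        show ?thesis
          unfolding bracket(1) evaluate_diff fun_diff_def evaluate_y_commutator[OF f bracket(2-4)]
          using y_bracket_at[OF f True bracket(2-4) \<kappa>2] f bracket(2,3) by (simp add: mem)
      next
        case False
        then show ?thesis using T_out F_in_T evaluate_in[OF PF f] by blast
      qed
      then show ?thesis by (simp add: fun_eq_iff)
    qed
  qed
  then show ?thesis
    using n operators_axioms by (simp add: hecke_operators_def hecke_operators_axioms_def)
qed

definition hecke_module :: "complex \<Rightarrow> complex \<Rightarrow> (hecke_gen free_alg set, 'v tensor) repn" where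
  "hecke_module \<mu> \<kappa>2 = hecke_operators.action (tscale s) (F \<mu>) n hecke_op 1 \<kappa>2"

context
  fixes \<mu> \<kappa>2 :: complex
  assumes n: "1 \<le> n" and \<kappa>2: "\<kappa>2 = of_nat p - of_nat q - \<mu> * of_nat N"
begin

lemma vecs_hecke_module: "vecs (hecke_module \<mu> \<kappa>2) = F \<mu>"
proof -
  interpret hecke_operators "tscale s" "F \<mu>" n hecke_op 1 \<kappa>2
    by (rule hecke_op_hecke_operators[OF n \<kappa>2])
  show ?thesis by (simp add: hecke_module_def)
qed

lemma act_hecke_module:
  "P \<in> carrier (free_algebra (hecke_gens n)) \<Longrightarrow> f \<in> F \<mu> \<Longrightarrow>
    act (hecke_module \<mu> \<kappa>2) (hecke_class n 1 \<kappa>2 P) f = evaluate (tscale s) hecke_op P f"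
proof -
  interpret hecke_operators "tscale s" "F \<mu>" n hecke_op 1 \<kappa>2
    by (rule hecke_op_hecke_operators[OF n \<kappa>2])
  show "P \<in> carrier (free_algebra (hecke_gens n)) \<Longrightarrow> f \<in> F \<mu> \<Longrightarrow> ?thesis"
    unfolding hecke_module_def by (rule act_action)
qed

lemma hecke_rep_hecke_module: "hecke_rep n 1 \<kappa>2 (tscale s) (hecke_module \<mu> \<kappa>2)"
proof -
  interpret hecke_operators "tscale s" "F \<mu>" n hecke_op 1 \<kappa>2
    by (rule hecke_op_hecke_operators[OF n \<kappa>2])
  show ?thesis unfolding hecke_module_def by (rule hecke_rep_action)
qed

text \<open>
  Existence and uniqueness at once, which also identifies the value of the description operator in
  \<open>F_obj\<close>.
\<close>

lemma is_F_rep_iff: "is_F_rep n p q \<mu> s 1 \<kappa>2 M R \<longleftrightarrow> R = hecke_module \<mu> \<kappa>2"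
proof -
  interpret operators "tscale s" "F \<mu>" "hecke_gens n" hecke_op by (rule hecke_op_operators)
  have S: "act (hecke_module \<mu> \<kappa>2) (hecke_class n 1 \<kappa>2 (\<S> i j)) f = swap_factors n N i j f"
    if "i \<in> {1..n}" "j \<in> {1..n}" "f \<in> F \<mu>" for i j f
    using that swap_factors_weyl_op[OF vs that(1,2) F_in_T[OF that(3)]]
    by (simp add: act_hecke_module W_in_free refl_S_in_weyl)
  have G: "act (hecke_module \<mu> \<kappa>2) (hecke_class n 1 \<kappa>2 (\<G> i)) f = on_factor n N s i (Jmat p q) f"
    if "i \<in> {1..n}" "f \<in> F \<mu>" for i f
    using that on_factor_Jmat[OF vs that(1) F_in_T[OF that(2)]]
    by (simp add: act_hecke_module W_in_free refl_gamma_in_weyl)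
  have Y: "act (hecke_module \<mu> \<kappa>2) (hecke_class n 1 \<kappa>2 (\<Y> k)) f = y k f"
    if "k \<in> {1..n}" "f \<in> F \<mu>" for k f
    using that by (simp add: act_hecke_module Y_in_free)
  show ?thesis
  proof
    assume R: "is_F_rep n p q \<mu> s 1 \<kappa>2 M R"
    show "R = hecke_module \<mu> \<kappa>2"
      by (rule hecke_rep_eqI[OF n vector_space_tscale[OF vs] _ hecke_rep_hecke_module])
        (use R S G Y in \<open>simp_all add: is_F_rep_def vecs_hecke_module\<close>)
  next
    assume "R = hecke_module \<mu> \<kappa>2"
    then show "is_F_rep n p q \<mu> s 1 \<kappa>2 M R"
      using S G Y by (simp add: is_F_rep_def vecs_hecke_module hecke_rep_hecke_module)
  qed
qed

lemma F_obj_eq: "F_obj n p q \<mu> s 1 \<kappa>2 M = hecke_module \<mu> \<kappa>2"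
  unfolding F_obj_def is_F_rep_iff by simp

end

end

section \<open>The functor on morphisms\<close>

text \<open>
  A linear map \<open>\<phi>\<close> from \<open>L\<close> to \<open>M\<close> acts on tensors by \<open>\<phi> \<otimes> id\<close>. What it commutes with is
  stated lemma by lemma, because two kinds of maps occur: morphisms, and sections of morphisms,
  which commute with \<open>\<kk>\<close> only and still transport semi-invariants.
\<close>

locale gl_module_pair =
  L: gl_module_operators p q n s L + M: gl_module_operators p q n s M
  for p q n :: nat and s :: "complex \<Rightarrow> 'v::ab_group_add \<Rightarrow> 'v" and L M :: "(complex mat, 'v) repn"
begin

context
  fixes \<phi> :: "'v \<Rightarrow> 'v"
  assumes lin: "linear_over s s (vecs L) \<phi>" and into: "v \<in> vecs L \<Longrightarrow> \<phi> v \<in> vecs M"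
begin

lemma \<phi>_zero: "\<phi> 0 = 0"
  by (rule linear_over_zero[OF L.vs L.vs L.subspace_U lin])

lemma \<phi>_add: "u \<in> vecs L \<Longrightarrow> v \<in> vecs L \<Longrightarrow> \<phi> (u + v) = \<phi> u + \<phi> v"
  and \<phi>_scale: "v \<in> vecs L \<Longrightarrow> \<phi> (s c v) = s c (\<phi> v)"
  using lin by (simp_all add: linear_over_def)

lemma \<phi>_minus: "v \<in> vecs L \<Longrightarrow> \<phi> (- v) = - \<phi> v"
  using \<phi>_scale[of v "- 1"] by simp

lemma \<phi>_sum: "finite A \<Longrightarrow> (\<And>a. a \<in> A \<Longrightarrow> g a \<in> vecs L) \<Longrightarrow> \<phi> (sum g A) = (\<Sum>a\<in>A. \<phi> (g a))"
  by (rule linear_over_sum[OF L.vs L.vs L.subspace_U lin])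

lemma on_zeroth_in_T: "f \<in> L.T \<Longrightarrow> on_zeroth \<phi> f \<in> M.T"
  using into by (auto simp: tensor_space_def on_zeroth_def \<phi>_zero)

lemma on_zeroth_linear: "linear_over (tscale s) (tscale s) L.T (on_zeroth \<phi>)"
  using L.T_in_U by (auto simp: linear_over_def on_zeroth_def tscale_def fun_eq_iff \<phi>_add \<phi>_scale)

lemma on_zeroth_tensor_act:
  assumes X: "X \<in> carrier_mat (p + q) (p + q)" and f: "f \<in> L.T"
    and eqv: "\<And>v. v \<in> vecs L \<Longrightarrow> \<phi> (act L X v) = act M X (\<phi> v)"
  shows "on_zeroth \<phi> (tensor_act n (p + q) s L X f) = tensor_act n (p + q) s M X (on_zeroth \<phi> f)"
proof
  fix w
  show "on_zeroth \<phi> (tensor_act n (p + q) s L X f) w = tensor_act n (p + q) s M X (on_zeroth \<phi> f) w"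
  proof (cases "w \<in> ix n (p + q)")
    case True
    then show ?thesis using L.T_in_U[OF f]
      by (simp add: L.tensor_act_eq M.tensor_act_eq on_zeroth_def \<phi>_add \<phi>_sum \<phi>_scale eqv L.act_in[OF X]
          L.s.subspace_sum[OF L.subspace_U] L.s.subspace_scale[OF L.subspace_U])
  next
    case False
    then show ?thesis
      using L.tensor_act_out[OF X f] M.tensor_act_out[OF X on_zeroth_in_T[OF f]]
      by (simp add: on_zeroth_def \<phi>_zero)
  qed
qed

lemma on_zeroth_in_F:
  assumes f: "f \<in> L.F \<mu>"
    and eqv: "\<And>X v. X \<in> \<kk>0 p q \<Longrightarrow> v \<in> vecs L \<Longrightarrow> \<phi> (act L X v) = act M X (\<phi> v)"
  shows "on_zeroth \<phi> f \<in> M.F \<mu>"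
proof -
  have "tensor_act n (p + q) s M X (on_zeroth \<phi> f) = tscale s (\<mu> * chi p q X) (on_zeroth \<phi> f)"
    if X: "X \<in> \<kk>0 p q" for X
  proof -
    have "tensor_act n (p + q) s M X (on_zeroth \<phi> f) = on_zeroth \<phi> (tensor_act n (p + q) s L X f)"
      by (rule on_zeroth_tensor_act[OF L.\<kk>0_carrier[OF X] L.F_in_T[OF f] eqv[OF X], symmetric])
    also have "\<dots> = tscale s (\<mu> * chi p q X) (on_zeroth \<phi> f)"
      using on_zeroth_linear L.F_in_T[OF f] by (simp add: L.F_invariant[OF f X] linear_over_def)
    finally show ?thesis .
  qed
  then show ?thesis using on_zeroth_in_T[OF L.F_in_T[OF f]] by (simp add: F_space_def)
qed

lemma on_zeroth_hecke_op:
  assumes g: "g \<in> hecke_gens n" and f: "f \<in> L.T"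
    and eqv: "\<And>X v. X \<in> carrier_mat (p + q) (p + q) \<Longrightarrow> v \<in> vecs L \<Longrightarrow> \<phi> (act L X v) = act M X (\<phi> v)"
  shows "on_zeroth \<phi> (L.hecke_op g f) = M.hecke_op g (on_zeroth \<phi> f)"
proof (cases g)
  case (W v)
  then show ?thesis using L.T_in_U[OF f]
    by (simp add: on_zeroth_def weyl_op_def \<phi>_scale fun_eq_iff case_prod_unfold)
next
  case (Y k)
  with g have k: "k \<in> {1..n}" by (auto simp: hecke_gens_def)
  have e: "\<phi> (L.e i j v) = M.e i j (\<phi> v)" if "v \<in> vecs L" for i j v
    using that by (simp add: L.e_def M.e_def eqv)
  have "\<phi> (y_op n p q s L k f w) = y_op n p q s M k (on_zeroth \<phi> f) w" for w
  proof (cases "w \<in> ix n (p + q)")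
    case True
    then show ?thesis unfolding L.y_eq[OF f True k] M.y_eq[OF on_zeroth_in_T[OF f] True k]
      using L.T_in_U[OF f]
      by (simp add: on_zeroth_def \<phi>_minus \<phi>_sum e L.e_in L.s.subspace_sum[OF L.subspace_U]
          L.opp_def M.opp_def)
  next
    case False
    then show ?thesis
      using L.y_out[OF f] M.y_out[OF on_zeroth_in_T[OF f]] by (simp add: \<phi>_zero)
  qed
  then show ?thesis by (simp add: Y on_zeroth_def[of \<phi> "y_op n p q s L k f"])
qed

end

lemma F_map_hom:
  assumes n: "1 \<le> n" and \<kappa>2: "\<kappa>2 = of_nat p - of_nat q - \<mu> * of_nat (p + q)"
    and \<phi>: "\<phi> \<in> rep_hom s (carrier_mat (p + q) (p + q)) L M"
  shows "F_map n p q \<mu> s L M \<phi>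
    \<in> rep_hom (tscale s) (carrier (hecke n 1 \<kappa>2)) (L.hecke_module \<mu> \<kappa>2) (M.hecke_module \<mu> \<kappa>2)"
proof -
  have lin: "linear_over s s (vecs L) \<phi>" and into: "\<And>v. v \<in> vecs L \<Longrightarrow> \<phi> v \<in> vecs M"
    and eqv: "\<And>X v. X \<in> carrier_mat (p + q) (p + q) \<Longrightarrow> v \<in> vecs L \<Longrightarrow> \<phi> (act L X v) = act M X (\<phi> v)"
    using \<phi> by (auto simp: rep_hom_def)
  interpret LF: operators "tscale s" "L.F \<mu>" "hecke_gens n" L.hecke_op by (rule L.hecke_op_operators)
  note vecs = L.vecs_hecke_module[OF n \<kappa>2] M.vecs_hecke_module[OF n \<kappa>2]
  have inF: "on_zeroth \<phi> f \<in> M.F \<mu>" if "f \<in> L.F \<mu>" for f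
    by (rule on_zeroth_in_F[OF lin into that]) (simp_all add: eqv L.\<kk>0_carrier)
  have linF: "linear_over (tscale s) (tscale s) (L.F \<mu>) (on_zeroth \<phi>)"
    by (rule linear_over_subset[OF on_zeroth_linear[OF lin into]]) (auto dest: L.F_in_T)
  have "on_zeroth \<phi> (act (L.hecke_module \<mu> \<kappa>2) C f) = act (M.hecke_module \<mu> \<kappa>2) C (on_zeroth \<phi> f)
      \<and> act (L.hecke_module \<mu> \<kappa>2) C f \<in> L.F \<mu>"
    if C: "C \<in> carrier (hecke n 1 \<kappa>2)" and f: "f \<in> L.F \<mu>" for C f
  proof -
    from C obtain P where P: "P \<in> carrier (free_algebra (hecke_gens n))" "C = hecke_class n 1 \<kappa>2 P"
      unfolding hecke_carrier by blast
    have "on_zeroth \<phi> (evaluate (tscale s) L.hecke_op P f) = evaluate (tscale s) M.hecke_op P (on_zeroth \<phi> f)"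
      by (rule LF.evaluate_intertwines[OF P(1) f linF])
        (rule on_zeroth_hecke_op[OF lin into _ L.F_in_T eqv])
    then show ?thesis
      using P f inF[OF f] LF.evaluate_in[OF P(1) f]
      by (simp add: L.act_hecke_module[OF n \<kappa>2] M.act_hecke_module[OF n \<kappa>2])
  qed
  moreover have "linear_over (tscale s) (tscale s) (L.F \<mu>) (F_map n p q \<mu> s L M \<phi>)"
    by (rule linear_over_cong[OF LF.vector_space L.subspace_F linF]) (simp add: F_map_def)
  ultimately show ?thesis
    using inF by (auto simp: rep_hom_def vecs F_map_def)
qed

end

lemma gl_module_operatorsI: "vector_space s \<Longrightarrow> gl_module (p + q) s M \<Longrightarrow> gl_module_operators p q s M"
  by (simp add: gl_module_operators_def)

text \<open>
  Stated for an arbitrary full subcategory, to cover all modules and the Harish-Chandra modules.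
\<close>

lemma F_is_functor:
  fixes s :: "complex \<Rightarrow> 'v::ab_group_add \<Rightarrow> 'v"
  assumes n: "1 \<le> n" and s: "vector_space s"
    and \<kappa>2: "\<kappa>2 = of_nat p - of_nat q - \<mu> * of_nat (p + q)"
    and Obs: "\<And>M. M \<in> Obs \<Longrightarrow> gl_module (p + q) s M"
  shows "is_functor (rep_cat s (carrier_mat (p + q) (p + q)) Obs) (hecke_cat n 1 \<kappa>2 (tscale s))
    (F_obj n p q \<mu> s 1 \<kappa>2) (F_map n p q \<mu> s)"
proof -
  let ?G = "carrier_mat (p + q) (p + q)"
  note loc = gl_module_operatorsI[OF s Obs]
  note obj = gl_module_operators.F_obj_eq[OF loc n \<kappa>2]
  note rep = gl_module_operators.hecke_rep_hecke_module[OF loc n \<kappa>2]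
  note vecs = gl_module_operators.vecs_hecke_module[OF loc n \<kappa>2]
  have cat1: "is_category (rep_cat s ?G Obs)"
    by (rule rep_cat_is_category[OF s])
      (use loc in \<open>auto intro: gl_module_operators.subspace_U gl_module_operators.act_in\<close>)
  have cat2: "is_category (hecke_cat n 1 \<kappa>2 (tscale s))"
    unfolding hecke_cat_def
    by (rule rep_cat_is_category[OF vector_space_tscale[OF s]]) (auto simp: hecke_rep_def Let_def)
  have hom: "F_map n p q \<mu> s A B f \<in> rep_hom (tscale s) (carrier (hecke n 1 \<kappa>2))
      (F_obj n p q \<mu> s 1 \<kappa>2 A) (F_obj n p q \<mu> s 1 \<kappa>2 B)"
    if A: "A \<in> Obs" and B: "B \<in> Obs" and f: "f \<in> rep_hom s ?G A B" for A B f
  proof -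
    interpret gl_module_pair p q n s A B
      by (intro gl_module_pair.intro loc A B)
    show ?thesis unfolding obj[OF A] obj[OF B] by (rule F_map_hom[OF n \<kappa>2 f])
  qed
  have idn: "F_map n p q \<mu> s A A (\<lambda>v\<in>vecs A. v) = (\<lambda>f\<in>F_space n p q \<mu> s A. f)" if A: "A \<in> Obs" for A
  proof -
    interpret gl_module_operators p q n s A by (rule loc[OF A])
    show ?thesis using T_in_U F_in_T by (auto simp: F_map_def on_zeroth_def fun_eq_iff)
  qed
  have comp: "F_map n p q \<mu> s A D (compose (vecs A) g f)
      = compose (F_space n p q \<mu> s A) (F_map n p q \<mu> s B D g) (F_map n p q \<mu> s A B f)"
    if A: "A \<in> Obs" and B: "B \<in> Obs" and f: "f \<in> rep_hom s ?G A B" for A B D f g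
  proof -
    interpret gl_module_operators p q n s A by (rule loc[OF A])
    have "F_map n p q \<mu> s A B f h \<in> F_space n p q \<mu> s B" if "h \<in> F_space n p q \<mu> s A" for h
      using hom[OF A B f] that unfolding obj[OF A] obj[OF B]
      by (auto simp: rep_hom_def vecs[OF A] vecs[OF B])
    then show ?thesis using T_in_U F_in_T
      by (auto simp: F_map_def compose_def on_zeroth_def fun_eq_iff)
  qed
  show ?thesis
    unfolding is_functor_def using cat1 cat2 hom idn comp
    by (simp add: rep_cat_def hecke_cat_def obj rep vecs)
qed

section \<open>Exactness on Harish-Chandra modules\<close>

text \<open>
  Submodules of semisimple modules have complements. A complement is a submodule \<open>C\<close> that is maximal
  among those meeting \<open>K\<close> trivially: a simple summand \<open>T\<close> not contained in \<open>K + C\<close> meets it trivially,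
  so \<open>C + T\<close> would still meet \<open>K\<close> trivially, contradicting maximality.
\<close>

lemma harish_chandra_complement:
  assumes s: "vector_space s" and M: "harish_chandra_module p q s M" and K: "k_submodule p q s M K"
  obtains C where "k_submodule p q s M C" "C \<inter> K = {0}"
    "\<And>v. v \<in> vecs M \<Longrightarrow> \<exists>k\<in>K. \<exists>c\<in>C. v = k + c"
proof -
  interpret s: vector_space s by fact
  from M obtain \<T> where gl: "gl_module (p + q) s M"
    and simple: "\<And>T. T \<in> \<T> \<Longrightarrow> simple_k_submodule p q s M T" and span: "s.span (\<Union>\<T>) = vecs M"
    by (auto simp: harish_chandra_module_def is_direct_sum_def)
  \<comment> \<open>No tensors occur here: the number of factors \<open>V\<close> is \<open>0\<close>.\<close>
  interpret gl_module_operators p q 0 s M using s gl by (rule gl_module_operatorsI)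
  have \<kk>_carrier: "X \<in> carrier_mat N N" if "X \<in> \<kk> p q" for X using that by (simp add: \<kk>_iff)
  note sub = k_submodule_def
  define \<A> where "\<A> = {C. k_submodule p q s M C \<and> C \<inter> K = {0}}"
  have "{0} \<in> \<A>" using K subspace_U
    by (auto simp: \<A>_def sub s.subspace_0 s.subspace_single_0 act_zero_vec \<kk>_carrier)
  then have "\<A> \<noteq> {}" by blast
  moreover have "\<Union>\<C> \<in> \<A>" if ne: "\<C> \<noteq> {}" and chain: "subset.chain \<A> \<C>" for \<C>
  proof -
    have \<C>: "k_submodule p q s M C" "C \<inter> K = {0}" if "C \<in> \<C>" for C
      using chain that by (auto simp: subset.chain_def \<A>_def)
    have "s.subspace (\<Union>\<C>)"
      unfolding s.subspace_def
    proof (intro conjI ballI allI)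
      show "0 \<in> \<Union>\<C>" using ne \<C>(1) s.subspace_0 by (fastforce simp: sub)
      show "x + z \<in> \<Union>\<C>" if xz: "x \<in> \<Union>\<C>" "z \<in> \<Union>\<C>" for x z
      proof -
        obtain A B where AB: "A \<in> \<C>" "x \<in> A" "B \<in> \<C>" "z \<in> B" using xz by blast
        then have "A \<subseteq> B \<or> B \<subseteq> A" using chain by (auto simp: subset.chain_def)
        then obtain D where "D \<in> \<C>" "x \<in> D" "z \<in> D" using AB by blast
        then show ?thesis using \<C>(1)[of D] s.subspace_add by (auto simp: sub)
      qed
      show "s c x \<in> \<Union>\<C>" if "x \<in> \<Union>\<C>" for c x
        using that \<C>(1) s.subspace_scale by (fastforce simp: sub)
    qed
    moreover have "\<Union>\<C> \<subseteq> vecs M" using \<C>(1) by (auto simp: sub)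
    moreover have "act M X v \<in> \<Union>\<C>" if "X \<in> \<kk> p q" "v \<in> \<Union>\<C>" for X v
      using that \<C>(1) by (fastforce simp: sub)
    moreover have "\<Union>\<C> \<inter> K = {0}" using ne \<C>(2) by blast
    ultimately show ?thesis by (simp add: \<A>_def sub)
  qed
  ultimately obtain C where C: "C \<in> \<A>" and max: "\<And>D. D \<in> \<A> \<Longrightarrow> C \<subseteq> D \<Longrightarrow> D = C"
    using subset_Zorn_nonempty[of \<A>] by blast
  have Csub: "k_submodule p q s M C" and CK: "C \<inter> K = {0}" using C by (auto simp: \<A>_def)
  have add_sub: "k_submodule p q s M {a + b | a b. a \<in> A \<and> b \<in> B}"
    if A: "k_submodule p q s M A" and B: "k_submodule p q s M B" for A B
  proof -
    have AB: "s.subspace A" "s.subspace B" "A \<subseteq> U" "B \<subseteq> U" using A B by (auto simp: sub)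
    have "act M X v \<in> {a + b | a b. a \<in> A \<and> b \<in> B}"
      if X: "X \<in> \<kk> p q" and v: "v \<in> {a + b | a b. a \<in> A \<and> b \<in> B}" for X v
    proof -
      obtain a b where ab: "v = a + b" "a \<in> A" "b \<in> B" using v by blast
      then have "act M X v = act M X a + act M X b"
        using AB act_plus[OF \<kk>_carrier[OF X], of a b] by auto
      moreover have "act M X a \<in> A" "act M X b \<in> B" using A B X ab by (auto simp: sub)
      ultimately show ?thesis by blast
    qed
    moreover have "a + b \<in> U" if "a \<in> A" "b \<in> B" for a b
      using that AB s.subspace_add[OF subspace_U] by blast
    ultimately show ?thesis using s.subspace_sums[OF AB(1,2)] by (auto simp: sub)
  qed
  have inter_sub: "k_submodule p q s M (A \<inter> B)"
    if "k_submodule p q s M A" "k_submodule p q s M B" for A B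
    using that s.subspace_inter[of A B] by (auto simp: sub)
  let ?S = "{k + c | k c. k \<in> K \<and> c \<in> C}"
  have S: "k_submodule p q s M ?S" by (rule add_sub[OF K Csub])
  have "T \<subseteq> ?S" if T: "T \<in> \<T>" for T
  proof -
    from simple[OF T] have Tsub: "k_submodule p q s M T" and "T \<noteq> {0}"
      and min: "\<And>T'. k_submodule p q s M T' \<Longrightarrow> T' \<subseteq> T \<Longrightarrow> T' = {0} \<or> T' = T"
      by (auto simp: simple_k_submodule_def)
    have "k_submodule p q s M (T \<inter> ?S)" by (rule inter_sub[OF Tsub S])
    then have "T \<inter> ?S = {0} \<or> T \<inter> ?S = T" by (rule min) simp
    moreover have False if 0: "T \<inter> ?S = {0}"
    proof -
      let ?D = "{c + t | c t. c \<in> C \<and> t \<in> T}"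
      have zero: "0 \<in> C" "0 \<in> T" "0 \<in> K" using Csub Tsub K s.subspace_0 by (auto simp: sub)
      have "?D \<inter> K \<subseteq> {0}"
      proof
        fix x assume "x \<in> ?D \<inter> K"
        then obtain c t where x: "x = c + t" "c \<in> C" "t \<in> T" "x \<in> K" by blast
        have "t = x + (- c)" using x by simp
        moreover have "- c \<in> C" using x Csub s.subspace_neg by (auto simp: sub)
        ultimately have "t \<in> ?S" using x by blast
        then have "t = 0" using 0 x by blast
        then show "x \<in> {0}" using x CK by auto
      qed
      moreover have "0 \<in> ?D" using zero by force
      ultimately have "?D \<inter> K = {0}" using zero(3) by blast
      with add_sub[OF Csub Tsub] have "?D \<in> \<A>" unfolding \<A>_def by blast
      moreover have "C \<subseteq> ?D" using zero by force
      ultimately have "?D = C" by (rule max)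
      moreover have "T \<subseteq> ?D" using zero by force
      ultimately have "T \<subseteq> C" by simp
      then have "T \<subseteq> ?S" using zero by force
      with 0 \<open>T \<noteq> {0}\<close> zero show False by blast
    qed
    ultimately show ?thesis by blast
  qed
  then have "vecs M \<subseteq> ?S"
    unfolding span[symmetric] using S by (intro s.span_minimal) (auto simp: sub)
  then have "\<exists>k\<in>K. \<exists>c\<in>C. v = k + c" if "v \<in> vecs M" for v using that by blast
  with Csub CK show ?thesis by (rule that)
qed

text \<open>
  A complement of the kernel of \<open>g\<close> is mapped isomorphically onto \<open>R\<close>; \<open>\<sigma>\<close> is the inverse of this
  isomorphism, and commutes with \<open>\<kk>\<close> because the complement is a \<open>\<kk>\<close>-submodule.
\<close>

lemma harish_chandra_section:
  assumes s: "vector_space s" and M: "harish_chandra_module p q s M" and R: "gl_module (p + q) s R"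
    and g: "g \<in> rep_hom s (carrier_mat (p + q) (p + q)) M R" and surj: "g ` vecs M = vecs R"
  obtains \<sigma> where "linear_over s s (vecs R) \<sigma>" "\<And>r. r \<in> vecs R \<Longrightarrow> \<sigma> r \<in> vecs M"
    "\<And>r. r \<in> vecs R \<Longrightarrow> g (\<sigma> r) = r"
    "\<And>X r. X \<in> \<kk> p q \<Longrightarrow> r \<in> vecs R \<Longrightarrow> \<sigma> (act R X r) = act M X (\<sigma> r)"
proof -
  interpret s: vector_space s by fact
  have glM: "gl_module (p + q) s M" using M by (simp add: harish_chandra_module_def)
  \<comment> \<open>The number of factors \<open>V\<close> is \<open>0\<close> again.\<close>
  interpret M: gl_module_operators p q 0 s M using s glM by (rule gl_module_operatorsI)
  interpret R: gl_module_operators p q 0 s R using s R by (rule gl_module_operatorsI)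
  have \<kk>_carrier: "X \<in> carrier_mat (p + q) (p + q)" if "X \<in> \<kk> p q" for X using that by (simp add: \<kk>_iff)
  have lin: "linear_over s s (vecs M) g" and into: "\<And>v. v \<in> vecs M \<Longrightarrow> g v \<in> vecs R"
    and eqv: "\<And>X v. X \<in> carrier_mat (p + q) (p + q) \<Longrightarrow> v \<in> vecs M \<Longrightarrow> g (act M X v) = act R X (g v)"
    using g by (auto simp: rep_hom_def)
  have g0: "g 0 = 0" by (rule linear_over_zero[OF s s M.subspace_U lin])
  have gadd: "g (u + v) = g u + g v" and gscale: "g (s c u) = s c (g u)"
    if "u \<in> vecs M" "v \<in> vecs M" for u v c using lin that by (simp_all add: linear_over_def)
  let ?K = "{v \<in> vecs M. g v = 0}"
  have "k_submodule p q s M ?K"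
    unfolding k_submodule_def s.subspace_def
    using s.subspace_0[OF M.subspace_U] s.subspace_add[OF M.subspace_U] s.subspace_scale[OF M.subspace_U]
    by (auto simp: g0 gadd gscale eqv M.act_in \<kk>_carrier R.act_zero_vec)
  then obtain C where C: "k_submodule p q s M C" "C \<inter> ?K = {0}"
    and dec: "\<And>v. v \<in> vecs M \<Longrightarrow> \<exists>k\<in>?K. \<exists>c\<in>C. v = k + c"
    using harish_chandra_complement[OF s M] by blast
  have CM: "c \<in> vecs M" if "c \<in> C" for c using that C(1) by (auto simp: k_submodule_def)
  have Csub: "s.subspace C" using C(1) by (simp add: k_submodule_def)
  have inj: "c = c'" if "c \<in> C" "c' \<in> C" "g c = g c'" for c c'
  proof -
    have "g (c - c') = 0"
      using gadd[of c "s (- 1) c'"] gscale[of c' c' "- 1"] CM that s.subspace_neg[OF M.subspace_U]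
      by simp
    then have "c - c' \<in> C \<inter> ?K"
      using that CM s.subspace_diff[OF Csub] s.subspace_diff[OF M.subspace_U] by simp
    then show ?thesis using C(2) by auto
  qed
  have ex: "\<exists>c\<in>C. g c = r" if "r \<in> vecs R" for r
  proof -
    have "r \<in> g ` vecs M" using that surj by simp
    then obtain v where v: "v \<in> vecs M" "g v = r" by auto
    obtain k c where "k \<in> ?K" "c \<in> C" "v = k + c" using dec[OF v(1)] by auto
    then have "g c = r" using v gadd[of k c] CM by simp
    then show ?thesis using \<open>c \<in> C\<close> by blast
  qed
  define \<sigma> where "\<sigma> r = (SOME c. c \<in> C \<and> g c = r)" for r
  have \<sigma>: "\<sigma> r \<in> C" "g (\<sigma> r) = r" if "r \<in> vecs R" for r
    using someI_ex[of "\<lambda>c. c \<in> C \<and> g c = r"] ex[OF that] by (auto simp: \<sigma>_def)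
  have \<sigma>_eq: "\<sigma> r = c" if "c \<in> C" "g c = r" for r c
  proof -
    have "r \<in> vecs R" using that into CM by blast
    then show ?thesis using inj[OF \<sigma>(1) that(1)] \<sigma>(2) that(2) by simp
  qed
  show ?thesis
  proof
    show "linear_over s s (vecs R) \<sigma>"
      unfolding linear_over_def
    proof (intro conjI ballI allI)
      show "\<sigma> (u + v) = \<sigma> u + \<sigma> v" if "u \<in> vecs R" "v \<in> vecs R" for u v
        using that by (intro \<sigma>_eq) (simp_all add: s.subspace_add[OF Csub] gadd CM \<sigma>)
      show "\<sigma> (s c u) = s c (\<sigma> u)" if "u \<in> vecs R" for c u
        using that by (intro \<sigma>_eq) (simp_all add: s.subspace_scale[OF Csub] gscale[of _ 0]
          s.subspace_0[OF M.subspace_U] CM \<sigma>)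
    qed
    show "\<sigma> (act R X r) = act M X (\<sigma> r)" if "X \<in> \<kk> p q" "r \<in> vecs R" for X r
      using that \<sigma> C(1) by (intro \<sigma>_eq) (auto simp: k_submodule_def eqv \<kk>_carrier CM)
  qed (use \<sigma> CM in auto)
qed

text \<open>
  Exactness on the left is checked word by word: a preimage under the injection \<open>f\<close> of a
  semi-invariant is a semi-invariant, because \<open>f\<close> commutes with \<open>\<kk>0\<close>. On the right, the section \<open>\<sigma>\<close>
  lifts semi-invariants to semi-invariants.
\<close>

lemma F_map_short_exact:
  assumes s: "vector_space s" and L: "gl_module (p + q) s L" and M: "harish_chandra_module p q s M"
    and R: "gl_module (p + q) s R"
    and f: "f \<in> rep_hom s (carrier_mat (p + q) (p + q)) L M"
    and g: "g \<in> rep_hom s (carrier_mat (p + q) (p + q)) M R"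
    and exact: "short_exact L M R f g"
  shows "inj_on (F_map n p q \<mu> s L M f) (F_space n p q \<mu> s L)"
    and "F_map n p q \<mu> s L M f ` F_space n p q \<mu> s L
      = {h \<in> F_space n p q \<mu> s M. F_map n p q \<mu> s M R g h = 0}"
    and "F_map n p q \<mu> s M R g ` F_space n p q \<mu> s M = F_space n p q \<mu> s R"
proof -
  have glM: "gl_module (p + q) s M" using M by (simp add: harish_chandra_module_def)
  interpret LM: gl_module_pair p q n s L M
    using s L glM by (intro gl_module_pair.intro gl_module_operatorsI)
  interpret MR: gl_module_pair p q n s M R
    using s glM R by (intro gl_module_pair.intro gl_module_operatorsI)
  interpret RM: gl_module_pair p q n s R M
    using s glM R by (intro gl_module_pair.intro gl_module_operatorsI)
  let ?FL = "F_space n p q \<mu> s L" and ?FM = "F_space n p q \<mu> s M" and ?FR = "F_space n p q \<mu> s R"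
  have inj: "inj_on f (vecs L)" and ker: "f ` vecs L = {v \<in> vecs M. g v = 0}"
    and surj: "g ` vecs M = vecs R"
    using exact by (simp_all add: short_exact_def)
  have flin: "linear_over s s (vecs L) f" and finto: "\<And>v. v \<in> vecs L \<Longrightarrow> f v \<in> vecs M"
    and feqv: "\<And>X v. X \<in> carrier_mat (p + q) (p + q) \<Longrightarrow> v \<in> vecs L \<Longrightarrow> f (act L X v) = act M X (f v)"
    using f by (auto simp: rep_hom_def)
  have glin: "linear_over s s (vecs M) g" and ginto: "\<And>v. v \<in> vecs M \<Longrightarrow> g v \<in> vecs R"
    and geqv: "\<And>X v. X \<in> carrier_mat (p + q) (p + q) \<Longrightarrow> v \<in> vecs M \<Longrightarrow> g (act M X v) = act R X (g v)"
    using g by (auto simp: rep_hom_def)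
  have fF: "on_zeroth f h \<in> ?FM" if "h \<in> ?FL" for h
    by (rule LM.on_zeroth_in_F[OF flin finto that]) (simp_all add: feqv LM.L.\<kk>0_carrier)
  have gF: "on_zeroth g h \<in> ?FR" if "h \<in> ?FM" for h
    by (rule MR.on_zeroth_in_F[OF glin ginto that]) (simp_all add: geqv LM.L.\<kk>0_carrier)
  note inL = LM.L.T_in_U[OF LM.L.F_in_T] and inM = LM.M.T_in_U[OF LM.M.F_in_T]
    and inR = MR.M.T_in_U[OF MR.M.F_in_T]

  show "inj_on (F_map n p q \<mu> s L M f) ?FL"
  proof (rule inj_onI)
    fix h h' assume h: "h \<in> ?FL" "h' \<in> ?FL" and eq: "F_map n p q \<mu> s L M f h = F_map n p q \<mu> s L M f h'"
    have "h w = h' w" for w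
    proof (rule inj_onD[OF inj _ inL[OF h(1)] inL[OF h(2)]])
      show "f (h w) = f (h' w)" using fun_cong[OF eq, of w] h by (simp add: F_map_def on_zeroth_def)
    qed
    then show "h = h'" by (rule ext)
  qed

  show "F_map n p q \<mu> s L M f ` ?FL = {h \<in> ?FM. F_map n p q \<mu> s M R g h = 0}"
  proof
    show "F_map n p q \<mu> s L M f ` ?FL \<subseteq> {h \<in> ?FM. F_map n p q \<mu> s M R g h = 0}"
    proof clarify
      fix h assume h: "h \<in> ?FL"
      have "g (f (h w)) = 0" for w using ker inL[OF h, of w] by blast
      then show "F_map n p q \<mu> s L M f h \<in> ?FM \<and> F_map n p q \<mu> s M R g (F_map n p q \<mu> s L M f h) = 0"
        using h fF[OF h] by (simp add: F_map_def on_zeroth_def fun_eq_iff)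
    qed
    show "{h \<in> ?FM. F_map n p q \<mu> s M R g h = 0} \<subseteq> F_map n p q \<mu> s L M f ` ?FL"
    proof clarify
      fix h assume h: "h \<in> ?FM" and h0: "F_map n p q \<mu> s M R g h = 0"
      define k where "k w = inv_into (vecs L) f (h w)" for w
      have "g (h w) = 0" for w using fun_cong[OF h0, of w] h by (simp add: F_map_def on_zeroth_def)
      then have hw: "h w \<in> f ` vecs L" for w using ker inM[OF h] by blast
      have kL: "k w \<in> vecs L" and fk: "f (k w) = h w" for w
        using inv_into_into[OF hw] f_inv_into_f[OF hw] by (simp_all add: k_def)
      have fk': "on_zeroth f k = h" by (simp add: on_zeroth_def fk)
      have "k w = 0" if "w \<notin> ix n (p + q)" for w
      proof (rule inj_onD[OF inj _ kL LM.L.s.subspace_0[OF LM.L.subspace_U]])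
        show "f (k w) = f 0"
          using LM.M.T_out[OF LM.M.F_in_T[OF h] that] by (simp add: fk LM.\<phi>_zero[OF flin finto])
      qed
      then have kT: "k \<in> LM.L.T" using kL by (simp add: tensor_space_def)
      have "k \<in> ?FL"
      proof -
        have "tensor_act n (p + q) s L X k = tscale s (\<mu> * chi p q X) k" if X: "X \<in> \<kk>0 p q" for X
        proof
          fix w
          have Xc: "X \<in> carrier_mat (p + q) (p + q)" by (rule LM.L.\<kk>0_carrier[OF X])
          have "on_zeroth f (tensor_act n (p + q) s L X k) = tscale s (\<mu> * chi p q X) (on_zeroth f k)"
            by (simp add: LM.on_zeroth_tensor_act[OF flin finto Xc kT feqv[OF Xc]] fk'
                LM.M.F_invariant[OF h X])
          also have "\<dots> = on_zeroth f (tscale s (\<mu> * chi p q X) k)"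
            using LM.on_zeroth_linear[OF flin finto] kT by (simp add: linear_over_def)
          finally have "f (tensor_act n (p + q) s L X k w) = f (tscale s (\<mu> * chi p q X) k w)"
            by (simp add: on_zeroth_def fun_eq_iff)
          then show "tensor_act n (p + q) s L X k w = tscale s (\<mu> * chi p q X) k w"
            by (rule inj_onD[OF inj _ LM.L.T_in_U[OF LM.L.tensor_act_in_T[OF Xc kT]]])
              (simp add: tscale_def LM.L.s.subspace_scale[OF LM.L.subspace_U] kL)
        qed
        with kT show ?thesis by (simp add: F_space_def)
      qed
      then show "h \<in> F_map n p q \<mu> s L M f ` ?FL"
        using fk' by (intro image_eqI[of _ _ k]) (simp_all add: F_map_def)
    qed
  qed

  obtain \<sigma> where \<sigma>: "linear_over s s (vecs R) \<sigma>" "\<And>r. r \<in> vecs R \<Longrightarrow> \<sigma> r \<in> vecs M"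
      "\<And>r. r \<in> vecs R \<Longrightarrow> g (\<sigma> r) = r"
      "\<And>X r. X \<in> \<kk> p q \<Longrightarrow> r \<in> vecs R \<Longrightarrow> \<sigma> (act R X r) = act M X (\<sigma> r)"
    by (rule harish_chandra_section[OF s M R g surj]) (rule that, assumption+)
  show "F_map n p q \<mu> s M R g ` ?FM = ?FR"
  proof
    show "F_map n p q \<mu> s M R g ` ?FM \<subseteq> ?FR" using gF by (auto simp: F_map_def)
    show "?FR \<subseteq> F_map n p q \<mu> s M R g ` ?FM"
    proof
      fix h assume h: "h \<in> ?FR"
      have "on_zeroth \<sigma> h \<in> ?FM"
        by (rule RM.on_zeroth_in_F[OF \<sigma>(1,2) h]) (simp_all add: \<sigma>(4) \<kk>0_def)
      moreover have "on_zeroth g (on_zeroth \<sigma> h) = h"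
        using \<sigma>(3) inR[OF h] by (simp add: on_zeroth_def)
      ultimately show "h \<in> F_map n p q \<mu> s M R g ` ?FM"
        by (intro image_eqI[of _ _ "on_zeroth \<sigma> h"]) (simp_all add: F_map_def)
    qed
  qed
qed

theorem theorem4p3:
  fixes n p q N :: nat and \<mu> \<kappa>2 :: complex
    and scale :: "complex \<Rightarrow> 'v::ab_group_add \<Rightarrow> 'v"
  assumes "n \<ge> 1" and "p \<ge> 1" and "q \<ge> 1"
    and "N = p + q"
    and "\<kappa>2 = of_nat p - of_nat q - \<mu> * of_nat N"
    and "vector_space scale"
  shows "(\<forall>M. gl_module N scale M \<longrightarrow> (\<exists>!R. is_F_rep n p q \<mu> scale 1 \<kappa>2 M R)) \<and>
    is_functor (gl_cat N scale) (hecke_cat n 1 \<kappa>2 (tscale scale))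
      (F_obj n p q \<mu> scale 1 \<kappa>2) (F_map n p q \<mu> scale) \<and>
    is_exact_functor (harish_chandra_cat p q scale) (hecke_cat n 1 \<kappa>2 (tscale scale))
      (F_obj n p q \<mu> scale 1 \<kappa>2) (F_map n p q \<mu> scale)"
proof -
  note n = assms(1) and vs = assms(6)
  have \<kappa>2: "\<kappa>2 = of_nat p - of_nat q - \<mu> * of_nat (p + q)" using assms(4,5) by simp
  have unique: "\<exists>!R. is_F_rep n p q \<mu> scale 1 \<kappa>2 M R" if "gl_module (p + q) scale M" for M
    by (simp add: gl_module_operators.is_F_rep_iff[OF gl_module_operatorsI[OF vs that] n \<kappa>2])
  have functor_gl: "is_functor (gl_cat (p + q) scale) (hecke_cat n 1 \<kappa>2 (tscale scale))
      (F_obj n p q \<mu> scale 1 \<kappa>2) (F_map n p q \<mu> scale)"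
    unfolding gl_cat_def by (rule F_is_functor[OF n vs \<kappa>2]) simp
  have functor_hc: "is_functor (harish_chandra_cat p q scale) (hecke_cat n 1 \<kappa>2 (tscale scale))
      (F_obj n p q \<mu> scale 1 \<kappa>2) (F_map n p q \<mu> scale)"
    unfolding harish_chandra_cat_def
    by (rule F_is_functor[OF n vs \<kappa>2]) (simp add: harish_chandra_module_def)
  have "short_exact (F_obj n p q \<mu> scale 1 \<kappa>2 L) (F_obj n p q \<mu> scale 1 \<kappa>2 M) (F_obj n p q \<mu> scale 1 \<kappa>2 R)
      (F_map n p q \<mu> scale L M f) (F_map n p q \<mu> scale M R g)"
    if "harish_chandra_module p q scale L" "harish_chandra_module p q scale M"
      "harish_chandra_module p q scale R"
      and f: "f \<in> rep_hom scale (carrier_mat (p + q) (p + q)) L M"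
      and g: "g \<in> rep_hom scale (carrier_mat (p + q) (p + q)) M R" and ex: "short_exact L M R f g"
    for L M R f g
  proof -
    have gl: "gl_module (p + q) scale L" "gl_module (p + q) scale M" "gl_module (p + q) scale R"
      using that by (simp_all add: harish_chandra_module_def)
    have vecs: "vecs (F_obj n p q \<mu> scale 1 \<kappa>2 A) = F_space n p q \<mu> scale A"
      if "gl_module (p + q) scale A" for A
      using gl_module_operators.F_obj_eq[OF gl_module_operatorsI[OF vs that] n \<kappa>2]
        gl_module_operators.vecs_hecke_module[OF gl_module_operatorsI[OF vs that] n \<kappa>2] by simp
    show ?thesis
      unfolding short_exact_def vecs[OF gl(1)] vecs[OF gl(2)] vecs[OF gl(3)]
      using F_map_short_exact[OF vs gl(1) that(2) gl(3) f g ex] by blast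
  qed
  then have "is_exact_functor (harish_chandra_cat p q scale) (hecke_cat n 1 \<kappa>2 (tscale scale))
      (F_obj n p q \<mu> scale 1 \<kappa>2) (F_map n p q \<mu> scale)"
    using functor_hc by (simp add: is_exact_functor_def harish_chandra_cat_def rep_cat_def)
  with unique functor_gl show ?thesis using assms(4) by simp
qed

end
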